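(* Let $R$ be an algebra over a commutative ring $\mathbb K$, let $\mathcal B$ be a right $\times_R$-Hopf algebra over $R$, and let $C$ be a right $\mathcal B$-module coring with action $\triangleleft$. (1) Let $X$ be an anti Yetter-Drinfel'd module of $\mathcal B$. Then the para-cyclic $\mathbb K$-module $C^{\widehat\otimes_R\,\ast+1}\widehat\otimes_RX$ with para-cyclic morphism $$w_n(c_0\widehat\otimes_R\dots\widehat\otimes_Rc_n\widehat\otimes_Rx)=(c_n\triangleleft x^{[1]})\widehat\otimes_Rc_0\widehat\otimes_R\dots\widehat\otimes_Rc_{n-1}\widehat\otimes_Rx^{[0]}$$ projects, along the canonical epimorphisms $C^{\widehat\otimes_R\,n+1}\widehat\otimes_RX\to C^{\otimes_R\,n+1}\otimes_{\mathcal B}X$, to a para-cyclic structure on $C^{\otimes_R\,\ast+1}\otimes_{\mathcal B}X$. (2) If $X$ is a stable anti Yetter-Drinfel'd module of $\mathcal B$, then the para-cyclic object $C^{\otimes_R\,\ast+1}\otimes_{\mathcal B}X$ in part (1) is cyclic.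
   Context: All algebras are associative and unital; implicit summation is used in index notations. An $R$-coring is a coalgebra in the monoidal category of $R$-bimodules. Right bialgebroid over $R$: data $\mathcal B=(B,\xi,\zeta,\Delta,\epsilon)$ with $B$ a $\mathbb K$-algebra, $\xi:R\to B$ and $\zeta:R^{op}\to B$ algebra maps with commuting ranges; $B$ is an $R$-bimodule by $r_1\cdot b\cdot r_2=b\,\zeta(r_1)\xi(r_2)$; $\Delta:B\to B\otimes_RB$, $b\mapsto b^{(1)}\otimes_Rb^{(2)}$, and $\epsilon:B\to R$ make this bimodule an $R$-coring; and (i) $\xi(r)b^{(1)}\otimes_Rb^{(2)}=b^{(1)}\otimes_R\zeta(r)b^{(2)}$; (ii) $\Delta(1_B)=1_B\otimes_R1_B$, $\Delta(bb')=b^{(1)}b'^{(1)}\otimes_Rb^{(2)}b'^{(2)}$; (iii) $\epsilon(1_B)=1_R$, $\epsilon(bb')=\epsilon(\xi(\epsilon(b))b')$. Iterated coproducts are written $b^{(1)}\otimes_R\dots\otimes_Rb^{(n)}$. It is a right $\times_R$-Hopf algebra if $\vartheta:\mathcal B\otimes_{R^{op}}\mathcal B\to\mathcal B\otimes_R\mathcal B$, $b\otimes_{R^{op}}b'\mapsto bb'^{(1)}\otimes_Rb'^{(2)}$ is bijective; here in the domain $b\zeta(r)\otimes_{R^{op}}b'=b\otimes_{R^{op}}\zeta(r)b'$, and in the codomain $b\xi(r)\otimes_Rb'=b\otimes_Rb'\zeta(r)$. Write $b_-\otimes_{R^{op}}b_+:=\vartheta^{-1}(1_B\otimes_Rb)$.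 A right $\mathcal B$-module $V$ is an $R$-bimodule by $r_1\cdot v\cdot r_2=v\triangleleft(\zeta(r_1)\xi(r_2))$. A right $\mathcal B$-comodule is a right $R$-module $X$ with a right $R$-linear, coassociative, counital coaction $X\to X\otimes_R\mathcal B$, $x\mapsto x^{[0]}\otimes_Rx^{[1]}$; it is an $R$-bimodule with left action $r\cdot x:=x^{[0]}\cdot\epsilon(\xi(r)x^{[1]})$. A right $\mathcal B$-module coring is an $R$-coring $(C,\Delta_C,\epsilon_C)$, $\Delta_C(c)=c^{(1)}\otimes_Rc^{(2)}$, which is a right $\mathcal B$-module with the same underlying $R$-bimodule structure, such that $\epsilon_C(c\triangleleft b)=\epsilon(\xi(\epsilon_C(c))b)$ and $\Delta_C(c\triangleleft b)=c^{(1)}\triangleleft b^{(1)}\otimes_Rc^{(2)}\triangleleft b^{(2)}$. An anti Yetter-Drinfel'd module of $\mathcal B$ is a right $\mathcal B$-comodule and left $\mathcal B$-module $X$ (action $\triangleright$) such that $x\cdot r=\zeta(r)\triangleright x$, $r\cdot x=\xi(r)\triangleright x$ (left sides: the $R$-actions underlying the comodule $X$), and $(b\triangleright x)^{[0]}\otimes_R(b\triangleright x)^{[1]}={b^{(1)}}_+\triangleright x^{[0]}\otimes_Rb^{(2)}x^{[1]}{b^{(1)}}_-$ for all $b\in B$, $x\in X$, $r\in R$. It is stable if moreover $x^{[1]}\triangleright x^{[0]}=x$ for all $x\in X$. Cyclic tensor product: for $R$-bimodules, $X_1\widehat\otimes_R\dots\widehat\otimes_RX_n$ is the quotient of $Y=X_1\otimes_R\dots\otimes_RX_n$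 by the $\mathbb K$-submodule generated by $r\cdot y-y\cdot r$, $r\in R$, $y\in Y$. The simplicial structure on $Z_n=C^{\widehat\otimes_R\,n+1}\widehat\otimes_RX$: for $0\le k\le n$ the face $d_k:Z_n\to Z_{n-1}$ applies $\epsilon_C$ to $c_k$ (absorbing the result via the $R$-actions) and the degeneracy $s_k:Z_n\to Z_{n+1}$ applies $\Delta_C$ to $c_k$. In $C^{\otimes_R\,n+1}\otimes_{\mathcal B}X$, $C^{\otimes_R\,n+1}$ is a right $\mathcal B$-module by the diagonal action $(c_0\otimes_R\dots\otimes_Rc_n)\triangleleft b=c_0\triangleleft b^{(1)}\otimes_R\dots\otimes_Rc_n\triangleleft b^{(n+1)}$; the canonical epimorphism sends $c_0\widehat\otimes_R\dots\widehat\otimes_Rc_n\widehat\otimes_Rx$ to $(c_0\otimes_R\dots\otimes_Rc_n)\otimes_{\mathcal B}x$. "Projects" means that all faces, degeneracies and the maps $w_n$ factor through these epimorphisms. A para-cyclic object is a simplicial object with morphisms $w_n:Z_n\to Z_n$ such that $d_0w_n=d_n$, $d_kw_n=w_{n-1}d_{k-1}$, $s_0w_n=(w_{n+1})^2s_n$, $s_kw_n=w_{n+1}s_{k-1}$ for $1\le k\le n$ (relations with faces for $n\ge1$); it is cyclic if $(w_n)^{n+1}=\mathrm{id}$ for all $n$. *)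

theory Defs
  imports Complex_Main "HOL-Library.Poly_Mapping" "HOL-Library.Set_Algebras" "HOL-Algebra.Module"
begin

text \<open>
  Algebras and modules live on whole types, with the \<open>\<bbbK>\<close>-scaling given by a separate function.
  Sort \<open>{ring, monoid_mult}\<close> is that of unital rings without the axiom \<open>0 \<noteq> 1\<close> of \<open>ring_1\<close>.
  After the imports, \<open>Modules.module\<close> is the type-based module locale of HOL and
  \<open>Module.module\<close> the carrier-based one of HOL-Algebra.
\<close>

section \<open>Algebras, modules, bimodules\<close>

locale k_algebra = Modules.module sc
  for sc :: "'k::comm_ring_1 \<Rightarrow> 'a::{ring,monoid_mult} \<Rightarrow> 'a" +
  assumes sc_mult_left: "sc k a * b = sc k (a * b)"
    and sc_mult_right: "a * sc k b = sc k (a * b)"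

locale alg_left_module = A: k_algebra scA + Modules.module sc
  for scA :: "'k::comm_ring_1 \<Rightarrow> 'a::{ring,monoid_mult} \<Rightarrow> 'a"
    and sc :: "'k \<Rightarrow> 'm::ab_group_add \<Rightarrow> 'm" +
  fixes lact :: "'a \<Rightarrow> 'm \<Rightarrow> 'm"
  assumes lact_add_left: "lact (a + b) m = lact a m + lact b m"
    and lact_add_right: "lact a (m + m') = lact a m + lact a m'"
    and lact_one: "lact 1 m = m"
    and lact_mult: "lact (a * b) m = lact a (lact b m)"
    and lact_sc_left: "lact (scA k a) m = sc k (lact a m)"
    and lact_sc_right: "lact a (sc k m) = sc k (lact a m)"

locale alg_right_module = A: k_algebra scA + Modules.module sc
  for scA :: "'k::comm_ring_1 \<Rightarrow> 'a::{ring,monoid_mult} \<Rightarrow> 'a"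
    and sc :: "'k \<Rightarrow> 'm::ab_group_add \<Rightarrow> 'm" +
  fixes ract :: "'m \<Rightarrow> 'a \<Rightarrow> 'm"
  assumes ract_add_left: "ract (m + m') a = ract m a + ract m' a"
    and ract_add_right: "ract m (a + b) = ract m a + ract m b"
    and ract_one: "ract m 1 = m"
    and ract_mult: "ract m (a * b) = ract (ract m a) b"
    and ract_sc_left: "ract (sc k m) a = sc k (ract m a)"
    and ract_sc_right: "ract m (scA k a) = sc k (ract m a)"

locale bimodule = left: alg_left_module scR sc lact + right: alg_right_module scR sc ract
  for scR :: "'k::comm_ring_1 \<Rightarrow> 'r::{ring,monoid_mult} \<Rightarrow> 'r"
    and sc :: "'k \<Rightarrow> 'm::ab_group_add \<Rightarrow> 'm"
    and lact :: "'r \<Rightarrow> 'm \<Rightarrow> 'm" and ract :: "'m \<Rightarrow> 'r \<Rightarrow> 'm" +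
  assumes lact_ract: "ract (lact r m) s = lact r (ract m s)"


section \<open>Free modules and their quotients\<close>

definition fsmult :: "'k::comm_ring_1 \<Rightarrow> ('s \<Rightarrow>\<^sub>0 'k) \<Rightarrow> ('s \<Rightarrow>\<^sub>0 'k)" where
  "fsmult k p = Poly_Mapping.map ((*) k) p"

lemma module_fsmult: "Modules.module fsmult"
proof
  fix a b :: "'k::comm_ring_1" and x y :: "'s \<Rightarrow>\<^sub>0 'k"
  have l: "Poly_Mapping.lookup (fsmult a x) s = a * Poly_Mapping.lookup x s" for a :: 'k and x :: "'s \<Rightarrow>\<^sub>0 'k" and s
    by (simp add: fsmult_def map.rep_eq when_def)
  show "fsmult a (x + y) = fsmult a x + fsmult a y"
    by (rule poly_mapping_eqI) (simp add: l Poly_Mapping.lookup_add algebra_simps)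
  show "fsmult (a + b) x = fsmult a x + fsmult b x"
    by (rule poly_mapping_eqI) (simp add: l Poly_Mapping.lookup_add algebra_simps)
  show "fsmult a (fsmult b x) = fsmult (a * b) x"
    by (rule poly_mapping_eqI) (simp add: l algebra_simps)
  show "fsmult 1 x = x"
    by (rule poly_mapping_eqI) (simp add: l)
qed

abbreviation gen :: "'s \<Rightarrow> ('s \<Rightarrow>\<^sub>0 'k::comm_ring_1)" where
  "gen s \<equiv> Poly_Mapping.single s 1"

abbreviation fspan :: "('s \<Rightarrow>\<^sub>0 'k::comm_ring_1) set \<Rightarrow> ('s \<Rightarrow>\<^sub>0 'k) set" where
  "fspan \<equiv> Modules.module.span fsmult"

text \<open>Linear extension of a map on generators; the target is a module with scaling \<open>sc\<close>.\<close>

definition lext :: "('k \<Rightarrow> 'm \<Rightarrow> 'm) \<Rightarrow> ('s \<Rightarrow> 'm::ab_group_add) \<Rightarrow> ('s \<Rightarrow>\<^sub>0 'k::comm_ring_1) \<Rightarrow> 'm" where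
  "lext sc f p = (\<Sum>s\<in>Poly_Mapping.keys p. sc (Poly_Mapping.lookup p s) (f s))"

abbreviation flin :: "('s \<Rightarrow> ('t \<Rightarrow>\<^sub>0 'k)) \<Rightarrow> ('s \<Rightarrow>\<^sub>0 'k::comm_ring_1) \<Rightarrow> ('t \<Rightarrow>\<^sub>0 'k)" where
  "flin \<equiv> lext fsmult"

definition coeff_ring :: "'k::comm_ring_1 ring" where
  "coeff_ring = \<lparr>carrier = UNIV, monoid.mult = (*), one = 1, zero = 0, add = (+)\<rparr>"

text \<open>
  The quotient of the free module on the set \<open>G\<close> of generators by a submodule \<open>N\<close>; its elements
  are the cosets \<open>v +o N\<close>. The fields \<open>mult\<close> and \<open>one\<close> of a module record carry no meaning.
\<close>

definition quot_mod :: "'s set \<Rightarrow> ('s \<Rightarrow>\<^sub>0 'k) set \<Rightarrow> ('k::comm_ring_1, ('s \<Rightarrow>\<^sub>0 'k) set) module" where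
  "quot_mod G N = \<lparr>carrier = {v +o N |v. Poly_Mapping.keys v \<subseteq> G},
     monoid.mult = undefined, one = undefined,
     zero = N, add = (+), smult = (\<lambda>k A. fsmult k ` A + N)\<rparr>"

text \<open>
  The map between quotients given on the class of a generator \<open>s\<close> by the class, modulo \<open>N'\<close>, of any
  element of \<open>F s\<close>. Here \<open>F s\<close> is the set of values of a Sweedler-type formula over all
  representatives of the tensors occurring in it. The result is the union of the cosets over all
  choices of representatives, so it is a single coset exactly if the formula is well defined.
\<close>

definition induced ::
  "('t \<Rightarrow>\<^sub>0 'k) set \<Rightarrow> ('s \<Rightarrow> ('t \<Rightarrow>\<^sub>0 'k) set) \<Rightarrow> ('s \<Rightarrow>\<^sub>0 'k::comm_ring_1) set \<Rightarrow> ('t \<Rightarrow>\<^sub>0 'k) set" where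
  "induced N' F A = {flin f v + m |f v m. v \<in> A \<and> m \<in> N' \<and> (\<forall>s\<in>Poly_Mapping.keys v. f s \<in> F s)}"


section \<open>Tensor powers\<close>

text \<open>Linearity in one slot; \<open>h\<close> is a tuple with a hole in it.\<close>

definition slot_rels :: "('k \<Rightarrow> 'm \<Rightarrow> 'm) \<Rightarrow> ('m::ab_group_add \<Rightarrow> 's) \<Rightarrow> ('s \<Rightarrow>\<^sub>0 'k::comm_ring_1) set" where
  "slot_rels sc h = {gen (h (a + b)) - gen (h a) - gen (h b) |a b. True}
     \<union> {gen (h (sc k a)) - fsmult k (gen (h a)) |k a. True}"

text \<open>\<open>M \<otimes>\<^sub>R \<dots> \<otimes>\<^sub>R M\<close> with \<open>n\<close> factors is generated by the lists of length \<open>n\<close>.\<close>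

definition tpow_rels ::
  "('k \<Rightarrow> 'm \<Rightarrow> 'm) \<Rightarrow> ('r \<Rightarrow> 'm \<Rightarrow> 'm) \<Rightarrow> ('m \<Rightarrow> 'r \<Rightarrow> 'm) \<Rightarrow> nat
     \<Rightarrow> ('m::ab_group_add list \<Rightarrow>\<^sub>0 'k::comm_ring_1) set" where
  "tpow_rels sc lact ract n =
     \<Union> {slot_rels sc (\<lambda>m. us @ m # vs) |us vs. length us + length vs + 1 = n}
     \<union> {gen (us @ ract a r # b # vs) - gen (us @ a # lact r b # vs) |us vs a b r.
          length us + length vs + 2 = n}"

abbreviation tpow_null where
  "tpow_null sc lact ract n \<equiv> fspan (tpow_rels sc lact ract n)"

definition tpow ::
  "('k \<Rightarrow> 'm \<Rightarrow> 'm) \<Rightarrow> ('r \<Rightarrow> 'm \<Rightarrow> 'm) \<Rightarrow> ('m \<Rightarrow> 'r \<Rightarrow> 'm) \<Rightarrow> nat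
     \<Rightarrow> ('k::comm_ring_1, ('m::ab_group_add list \<Rightarrow>\<^sub>0 'k) set) module" where
  "tpow sc lact ract n = quot_mod {ms. length ms = n} (tpow_null sc lact ract n)"

text \<open>The representatives of the tensor obtained from a list \<open>ms\<close> by applying \<open>\<Delta>\<close> to its \<open>k\<close>-th entry.\<close>

definition split_at ::
  "('m \<Rightarrow> ('m list \<Rightarrow>\<^sub>0 'k::comm_ring_1) set) \<Rightarrow> nat \<Rightarrow> 'm list \<Rightarrow> ('m list \<Rightarrow>\<^sub>0 'k) set" where
  "split_at \<Delta> k ms = flin (\<lambda>ds. gen (take k ms @ ds @ drop (Suc k) ms)) ` \<Delta> (ms ! k)"


section \<open>Corings and right bialgebroids\<close>

text \<open>
  The coproduct takes its values in cosets. In the axioms, an element \<open>p\<close> of \<open>\<Delta> m\<close> is a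
  representative of \<open>m\<^sup>(\<^sup>1\<^sup>) \<otimes>\<^sub>R m\<^sup>(\<^sup>2\<^sup>)\<close>, and membership of a formal sum in such a coset is equality of
  the corresponding tensors.
\<close>

locale coring = bimodule scR sc lact ract
  for scR :: "'k::comm_ring_1 \<Rightarrow> 'r::{ring,monoid_mult} \<Rightarrow> 'r"
    and sc :: "'k \<Rightarrow> 'm::ab_group_add \<Rightarrow> 'm"
    and lact :: "'r \<Rightarrow> 'm \<Rightarrow> 'm" and ract :: "'m \<Rightarrow> 'r \<Rightarrow> 'm" +
  fixes \<Delta> :: "'m \<Rightarrow> ('m list \<Rightarrow>\<^sub>0 'k) set" and \<epsilon> :: "'m \<Rightarrow> 'r"
  assumes coprod_closed: "\<Delta> m \<in> carrier (tpow sc lact ract 2)"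
    and coprod_add: "\<Delta> (m + m') = \<Delta> m + \<Delta> m'"
    and coprod_lact: "p \<in> \<Delta> m \<Longrightarrow> flin (\<lambda>ms. gen [lact r (ms ! 0), ms ! 1]) p \<in> \<Delta> (lact r m)"
    and coprod_ract: "p \<in> \<Delta> m \<Longrightarrow> flin (\<lambda>ms. gen [ms ! 0, ract (ms ! 1) r]) p \<in> \<Delta> (ract m r)"
    and counit_add: "\<epsilon> (m + m') = \<epsilon> m + \<epsilon> m'"
    and counit_lact: "\<epsilon> (lact r m) = r * \<epsilon> m"
    and counit_ract: "\<epsilon> (ract m r) = \<epsilon> m * r"
    and coassoc: "induced (tpow_null sc lact ract 3) (split_at \<Delta> 0) (\<Delta> m)
      = induced (tpow_null sc lact ract 3) (split_at \<Delta> 1) (\<Delta> m)"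
    and counit_left: "p \<in> \<Delta> m \<Longrightarrow> lext sc (\<lambda>ms. lact (\<epsilon> (ms ! 0)) (ms ! 1)) p = m"
    and counit_right: "p \<in> \<Delta> m \<Longrightarrow> lext sc (\<lambda>ms. ract (ms ! 0) (\<epsilon> (ms ! 1))) p = m"

locale right_bialgebroid = R: k_algebra scR + B: k_algebra scB
    + coring scR scB "\<lambda>r b. b * \<zeta> r" "\<lambda>b r. b * \<xi> r" \<Delta> \<epsilon>
  for scR :: "'k::comm_ring_1 \<Rightarrow> 'r::{ring,monoid_mult} \<Rightarrow> 'r"
    and scB :: "'k \<Rightarrow> 'b::{ring,monoid_mult} \<Rightarrow> 'b"
    and \<xi> \<zeta> :: "'r \<Rightarrow> 'b"
    and \<Delta> :: "'b \<Rightarrow> ('b list \<Rightarrow>\<^sub>0 'k) set" and \<epsilon> :: "'b \<Rightarrow> 'r" +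
  assumes xi_add: "\<xi> (r + s) = \<xi> r + \<xi> s" and xi_sc: "\<xi> (scR k r) = scB k (\<xi> r)"
    and xi_one: "\<xi> 1 = 1" and xi_mult: "\<xi> (r * s) = \<xi> r * \<xi> s"
    and zeta_add: "\<zeta> (r + s) = \<zeta> r + \<zeta> s" and zeta_sc: "\<zeta> (scR k r) = scB k (\<zeta> r)"
    and zeta_one: "\<zeta> 1 = 1" and zeta_mult: "\<zeta> (r * s) = \<zeta> s * \<zeta> r"
    and xi_zeta: "\<xi> r * \<zeta> s = \<zeta> s * \<xi> r"
    and takeuchi: "p \<in> \<Delta> b \<Longrightarrow>
      flin (\<lambda>bs. gen [\<xi> r * bs ! 0, bs ! 1]) p - flin (\<lambda>bs. gen [bs ! 0, \<zeta> r * bs ! 1]) p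
        \<in> tpow_null scB (\<lambda>r b. b * \<zeta> r) (\<lambda>b r. b * \<xi> r) 2"
    and coprod_one: "gen [1, 1] \<in> \<Delta> 1"
    and coprod_mult: "p \<in> \<Delta> b \<Longrightarrow> q \<in> \<Delta> b' \<Longrightarrow>
      flin (\<lambda>bs. flin (\<lambda>bs'. gen [bs ! 0 * bs' ! 0, bs ! 1 * bs' ! 1]) q) p \<in> \<Delta> (b * b')"
    and counit_one: "\<epsilon> 1 = 1"
    and counit_mult: "\<epsilon> (b * b') = \<epsilon> (\<xi> (\<epsilon> b) * b')"

text \<open>The class of \<open>b\<^sup>(\<^sup>1\<^sup>) \<otimes>\<^sub>R \<dots> \<otimes>\<^sub>R b\<^sup>(\<^sup>n\<^sup>+\<^sup>1\<^sup>)\<close>, with \<open>n + 1\<close> factors.\<close>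

primrec iter_coprod ::
  "('k \<Rightarrow> 'b \<Rightarrow> 'b) \<Rightarrow> ('r \<Rightarrow> 'b) \<Rightarrow> ('r \<Rightarrow> 'b) \<Rightarrow> ('b \<Rightarrow> ('b list \<Rightarrow>\<^sub>0 'k) set)
     \<Rightarrow> nat \<Rightarrow> 'b::{ring,monoid_mult} \<Rightarrow> ('b list \<Rightarrow>\<^sub>0 'k::comm_ring_1) set" where
  "iter_coprod scB \<xi> \<zeta> \<Delta> 0 b = gen [b] +o tpow_null scB (\<lambda>r b. b * \<zeta> r) (\<lambda>b r. b * \<xi> r) 1"
| "iter_coprod scB \<xi> \<zeta> \<Delta> (Suc n) b =
     induced (tpow_null scB (\<lambda>r b. b * \<zeta> r) (\<lambda>b r. b * \<xi> r) (n + 2)) (split_at \<Delta> 0)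
       (iter_coprod scB \<xi> \<zeta> \<Delta> n b)"


section \<open>The Galois map\<close>

definition op_tensor ::
  "('k \<Rightarrow> 'b \<Rightarrow> 'b) \<Rightarrow> ('r \<Rightarrow> 'b)
     \<Rightarrow> ('k::comm_ring_1, ('b::{ring,monoid_mult} \<times> 'b \<Rightarrow>\<^sub>0 'k) set) module" where
  "op_tensor scB \<zeta> = quot_mod UNIV (fspan
     ((\<Union>b'. slot_rels scB (\<lambda>b. (b, b'))) \<union> (\<Union>b. slot_rels scB (\<lambda>b'. (b, b')))
      \<union> {gen (b * \<zeta> r, b') - gen (b, \<zeta> r * b') |b b' r. True}))"

definition galois ::
  "('k \<Rightarrow> 'b \<Rightarrow> 'b) \<Rightarrow> ('r \<Rightarrow> 'b) \<Rightarrow> ('r \<Rightarrow> 'b) \<Rightarrow> ('b \<Rightarrow> ('b list \<Rightarrow>\<^sub>0 'k) set)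
     \<Rightarrow> ('b::{ring,monoid_mult} \<times> 'b \<Rightarrow>\<^sub>0 'k::comm_ring_1) set \<Rightarrow> ('b list \<Rightarrow>\<^sub>0 'k) set" where
  "galois scB \<xi> \<zeta> \<Delta> = induced (tpow_null scB (\<lambda>r b. b * \<zeta> r) (\<lambda>b r. b * \<xi> r) 2)
     (\<lambda>(b, b'). flin (\<lambda>bs. gen [b * bs ! 0, bs ! 1]) ` \<Delta> b')"

text \<open>The class of \<open>b\<^sub>- \<otimes> b\<^sub>+\<close>.\<close>

definition translation ::
  "('k \<Rightarrow> 'b \<Rightarrow> 'b) \<Rightarrow> ('r \<Rightarrow> 'b) \<Rightarrow> ('r \<Rightarrow> 'b) \<Rightarrow> ('b \<Rightarrow> ('b list \<Rightarrow>\<^sub>0 'k) set)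
     \<Rightarrow> 'b::{ring,monoid_mult} \<Rightarrow> ('b \<times> 'b \<Rightarrow>\<^sub>0 'k::comm_ring_1) set" where
  "translation scB \<xi> \<zeta> \<Delta> b = inv_into (carrier (op_tensor scB \<zeta>)) (galois scB \<xi> \<zeta> \<Delta>)
     (gen [1, b] +o tpow_null scB (\<lambda>r b. b * \<zeta> r) (\<lambda>b r. b * \<xi> r) 2)"

locale right_times_R_hopf_algebra = right_bialgebroid +
  assumes galois_bij: "bij_betw (galois scB \<xi> \<zeta> \<Delta>) (carrier (op_tensor scB \<zeta>))
    (carrier (tpow scB (\<lambda>r b. b * \<zeta> r) (\<lambda>b r. b * \<xi> r) 2))"


section \<open>Module corings, comodules, anti Yetter-Drinfel'd modules\<close>

locale module_coring = right_bialgebroid scR scB \<xi> \<zeta> \<Delta> \<epsilon> + C: alg_right_module scB scC act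
    + C: coring scR scC "\<lambda>r c. act c (\<zeta> r)" "\<lambda>c r. act c (\<xi> r)" \<Delta>C \<epsilon>C
  for scR :: "'k::comm_ring_1 \<Rightarrow> 'r::{ring,monoid_mult} \<Rightarrow> 'r"
    and scB :: "'k \<Rightarrow> 'b::{ring,monoid_mult} \<Rightarrow> 'b"
    and \<xi> \<zeta> :: "'r \<Rightarrow> 'b"
    and \<Delta> :: "'b \<Rightarrow> ('b list \<Rightarrow>\<^sub>0 'k) set" and \<epsilon> :: "'b \<Rightarrow> 'r"
    and scC :: "'k \<Rightarrow> 'c::ab_group_add \<Rightarrow> 'c" and act :: "'c \<Rightarrow> 'b \<Rightarrow> 'c"
    and \<Delta>C :: "'c \<Rightarrow> ('c list \<Rightarrow>\<^sub>0 'k) set" and \<epsilon>C :: "'c \<Rightarrow> 'r" +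
  assumes counit_act: "\<epsilon>C (act c b) = \<epsilon> (\<xi> (\<epsilon>C c) * b)"
    and coprod_act: "p \<in> \<Delta>C c \<Longrightarrow> q \<in> \<Delta> b \<Longrightarrow>
      flin (\<lambda>cs. flin (\<lambda>bs. gen [act (cs ! 0) (bs ! 0), act (cs ! 1) (bs ! 1)]) q) p
        \<in> \<Delta>C (act c b)"

text \<open>
  \<open>X \<otimes>\<^sub>R B \<otimes>\<^sub>R \<dots> \<otimes>\<^sub>R B\<close> with \<open>n\<close> factors \<open>B\<close>. The first set of relations imposes those of
  \<open>B \<otimes>\<^sub>R \<dots> \<otimes>\<^sub>R B\<close> on the second component.
\<close>

definition comod_rels ::
  "('k \<Rightarrow> 'b \<Rightarrow> 'b) \<Rightarrow> ('r \<Rightarrow> 'b) \<Rightarrow> ('r \<Rightarrow> 'b) \<Rightarrow> ('k \<Rightarrow> 'x \<Rightarrow> 'x) \<Rightarrow> ('x \<Rightarrow> 'r \<Rightarrow> 'x) \<Rightarrow> nat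
     \<Rightarrow> ('x::ab_group_add \<times> 'b::{ring,monoid_mult} list \<Rightarrow>\<^sub>0 'k::comm_ring_1) set" where
  "comod_rels scB \<xi> \<zeta> scX ractX n =
     {flin (\<lambda>bs. gen (x, bs)) t |x t. t \<in> tpow_rels scB (\<lambda>r b. b * \<zeta> r) (\<lambda>b r. b * \<xi> r) n}
     \<union> \<Union> {slot_rels scX (\<lambda>x. (x, bs)) |bs. length bs = n}
     \<union> {gen (ractX x r, b # bs) - gen (x, b * \<zeta> r # bs) |x r b bs. length bs + 1 = n}"

abbreviation comod_null where
  "comod_null scB \<xi> \<zeta> scX ractX n \<equiv> fspan (comod_rels scB \<xi> \<zeta> scX ractX n)"

locale right_comodule = right_bialgebroid scR scB \<xi> \<zeta> \<Delta> \<epsilon> + X: alg_right_module scR scX ractX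
  for scR :: "'k::comm_ring_1 \<Rightarrow> 'r::{ring,monoid_mult} \<Rightarrow> 'r"
    and scB :: "'k \<Rightarrow> 'b::{ring,monoid_mult} \<Rightarrow> 'b"
    and \<xi> \<zeta> :: "'r \<Rightarrow> 'b"
    and \<Delta> :: "'b \<Rightarrow> ('b list \<Rightarrow>\<^sub>0 'k) set" and \<epsilon> :: "'b \<Rightarrow> 'r"
    and scX :: "'k \<Rightarrow> 'x::ab_group_add \<Rightarrow> 'x" and ractX :: "'x \<Rightarrow> 'r \<Rightarrow> 'x" +
  fixes \<rho> :: "'x \<Rightarrow> ('x \<times> 'b list \<Rightarrow>\<^sub>0 'k) set"
  assumes coact_closed: "\<rho> x \<in> carrier
      (quot_mod {(x, bs). length bs = 1} (comod_null scB \<xi> \<zeta> scX ractX 1))"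
    and coact_add: "\<rho> (x + y) = \<rho> x + \<rho> y"
    and coact_ract: "p \<in> \<rho> x \<Longrightarrow>
      flin (\<lambda>(x0, bs). gen (x0, [hd bs * \<xi> r])) p \<in> \<rho> (ractX x r)"
    and coact_coassoc:
      "induced (comod_null scB \<xi> \<zeta> scX ractX 2)
         (\<lambda>(x0, bs). flin (\<lambda>(x00, bs'). gen (x00, bs' @ bs)) ` \<rho> x0) (\<rho> x)
       = induced (comod_null scB \<xi> \<zeta> scX ractX 2)
         (\<lambda>(x0, bs). flin (\<lambda>bs'. gen (x0, bs')) ` \<Delta> (hd bs)) (\<rho> x)"
    and coact_counit: "p \<in> \<rho> x \<Longrightarrow> lext scX (\<lambda>(x0, bs). ractX x0 (\<epsilon> (hd bs))) p = x"

text \<open>The left action \<open>r \<cdot> x = x\<^sup>[\<^sup>0\<^sup>] \<cdot> \<epsilon> (\<xi> r x\<^sup>[\<^sup>1\<^sup>])\<close> of a comodule, which does not depend on the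
  chosen representative.\<close>

definition comod_lact ::
  "('r \<Rightarrow> 'b) \<Rightarrow> ('b \<Rightarrow> 'r) \<Rightarrow> ('k \<Rightarrow> 'x \<Rightarrow> 'x) \<Rightarrow> ('x \<Rightarrow> 'r \<Rightarrow> 'x)
     \<Rightarrow> ('x \<Rightarrow> ('x \<times> 'b::{ring,monoid_mult} list \<Rightarrow>\<^sub>0 'k::comm_ring_1) set)
     \<Rightarrow> 'r \<Rightarrow> 'x::ab_group_add \<Rightarrow> 'x" where
  "comod_lact \<xi> \<epsilon> scX ractX \<rho> r x =
     lext scX (\<lambda>(x0, bs). ractX x0 (\<epsilon> (\<xi> r * hd bs))) (SOME p. p \<in> \<rho> x)"

text \<open>In \<open>ayd_coaction\<close>, \<open>t a\<close> is a choice of representatives of \<open>a\<^sub>- \<otimes> a\<^sub>+\<close>.\<close>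

locale anti_yetter_drinfeld_module =
    right_times_R_hopf_algebra scR scB \<xi> \<zeta> \<Delta> \<epsilon> + right_comodule scR scB \<xi> \<zeta> \<Delta> \<epsilon> scX ractX \<rho>
    + Xl: alg_left_module scB scX lactB
  for scR :: "'k::comm_ring_1 \<Rightarrow> 'r::{ring,monoid_mult} \<Rightarrow> 'r"
    and scB :: "'k \<Rightarrow> 'b::{ring,monoid_mult} \<Rightarrow> 'b"
    and \<xi> \<zeta> :: "'r \<Rightarrow> 'b"
    and \<Delta> :: "'b \<Rightarrow> ('b list \<Rightarrow>\<^sub>0 'k) set" and \<epsilon> :: "'b \<Rightarrow> 'r"
    and scX :: "'k \<Rightarrow> 'x::ab_group_add \<Rightarrow> 'x" and ractX :: "'x \<Rightarrow> 'r \<Rightarrow> 'x"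
    and \<rho> :: "'x \<Rightarrow> ('x \<times> 'b list \<Rightarrow>\<^sub>0 'k) set"
    and lactB :: "'b \<Rightarrow> 'x \<Rightarrow> 'x" +
  assumes ayd_ract: "ractX x r = lactB (\<zeta> r) x"
    and ayd_lact: "comod_lact \<xi> \<epsilon> scX ractX \<rho> r x = lactB (\<xi> r) x"
    and ayd_coaction: "p \<in> \<Delta> b \<Longrightarrow> q \<in> \<rho> x \<Longrightarrow> (\<And>a. t a \<in> translation scB \<xi> \<zeta> \<Delta> a) \<Longrightarrow>
      flin (\<lambda>bs. flin (\<lambda>(x0, xs). flin (\<lambda>(bm, bp). gen (lactB bp x0, [bs ! 1 * hd xs * bm]))
        (t (bs ! 0))) q) p \<in> \<rho> (lactB b x)"

locale stable_anti_yetter_drinfeld_module = anti_yetter_drinfeld_module +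
  assumes stable: "p \<in> \<rho> x \<Longrightarrow> lext scX (\<lambda>(x0, bs). lactB (hd bs) x0) p = x"


section \<open>Para-cyclic and cyclic modules\<close>

definition module_maps :: "('k, 'm, 'x) module_scheme \<Rightarrow> ('k, 'n, 'y) module_scheme \<Rightarrow> ('m \<Rightarrow> 'n) set" where
  "module_maps M N = {h \<in> carrier M \<rightarrow> carrier N.
     (\<forall>x\<in>carrier M. \<forall>y\<in>carrier M. h (x \<oplus>\<^bsub>M\<^esub> y) = h x \<oplus>\<^bsub>N\<^esub> h y)
     \<and> (\<forall>k. \<forall>x\<in>carrier M. h (k \<odot>\<^bsub>M\<^esub> x) = k \<odot>\<^bsub>N\<^esub> h x)}"

text \<open>\<open>d n k\<close> and \<open>s n k\<close> are defined on \<open>Z n\<close>, for \<open>k \<le> n\<close>; the values of \<open>d 0\<close> are irrelevant.\<close>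

locale simplicial_module =
  fixes Z :: "nat \<Rightarrow> ('k::comm_ring_1, 'z) module" and d s :: "nat \<Rightarrow> nat \<Rightarrow> 'z \<Rightarrow> 'z"
  assumes module_Z: "Module.module coeff_ring (Z n)"
    and face_hom: "k \<le> Suc n \<Longrightarrow> d (Suc n) k \<in> module_maps (Z (Suc n)) (Z n)"
    and degen_hom: "k \<le> n \<Longrightarrow> s n k \<in> module_maps (Z n) (Z (Suc n))"
    and face_face: "i < j \<Longrightarrow> j \<le> n + 2 \<Longrightarrow> z \<in> carrier (Z (n + 2)) \<Longrightarrow>
      d (n + 1) i (d (n + 2) j z) = d (n + 1) (j - 1) (d (n + 2) i z)"
    and degen_degen: "i \<le> j \<Longrightarrow> j \<le> n \<Longrightarrow> z \<in> carrier (Z n) \<Longrightarrow>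
      s (n + 1) i (s n j z) = s (n + 1) (j + 1) (s n i z)"
    and face_degen_less: "i < j \<Longrightarrow> j \<le> n + 1 \<Longrightarrow> z \<in> carrier (Z (n + 1)) \<Longrightarrow>
      d (n + 2) i (s (n + 1) j z) = s n (j - 1) (d (n + 1) i z)"
    and face_degen_same: "j \<le> n \<Longrightarrow> z \<in> carrier (Z n) \<Longrightarrow> d (n + 1) j (s n j z) = z"
    and face_degen_next: "j \<le> n \<Longrightarrow> z \<in> carrier (Z n) \<Longrightarrow> d (n + 1) (j + 1) (s n j z) = z"
    and face_degen_greater: "j + 1 < i \<Longrightarrow> i \<le> n + 2 \<Longrightarrow> z \<in> carrier (Z (n + 1)) \<Longrightarrow>
      d (n + 2) i (s (n + 1) j z) = s n j (d (n + 1) (i - 1) z)"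

locale para_cyclic_module = simplicial_module Z d s
  for Z :: "nat \<Rightarrow> ('k::comm_ring_1, 'z) module" and d s :: "nat \<Rightarrow> nat \<Rightarrow> 'z \<Rightarrow> 'z" +
  fixes w :: "nat \<Rightarrow> 'z \<Rightarrow> 'z"
  assumes w_hom: "w n \<in> module_maps (Z n) (Z n)"
    and face_w_0: "n \<ge> 1 \<Longrightarrow> z \<in> carrier (Z n) \<Longrightarrow> d n 0 (w n z) = d n n z"
    and face_w: "1 \<le> k \<Longrightarrow> k \<le> n \<Longrightarrow> z \<in> carrier (Z n) \<Longrightarrow>
      d n k (w n z) = w (n - 1) (d n (k - 1) z)"
    and degen_w_0: "z \<in> carrier (Z n) \<Longrightarrow> s n 0 (w n z) = w (n + 1) (w (n + 1) (s n n z))"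
    and degen_w: "1 \<le> k \<Longrightarrow> k \<le> n \<Longrightarrow> z \<in> carrier (Z n) \<Longrightarrow>
      s n k (w n z) = w (n + 1) (s n (k - 1) z)"

locale cyclic_module = para_cyclic_module +
  assumes w_power: "z \<in> carrier (Z n) \<Longrightarrow> (w n ^^ (n + 1)) z = z"

text \<open>\<open>d', s', w'\<close> are factorizations of \<open>d, s, w\<close> through the maps \<open>\<pi> n\<close>.\<close>

definition projects_to ::
  "(nat \<Rightarrow> ('k, 'z) module) \<Rightarrow> (nat \<Rightarrow> nat \<Rightarrow> 'z \<Rightarrow> 'z) \<Rightarrow> (nat \<Rightarrow> nat \<Rightarrow> 'z \<Rightarrow> 'z) \<Rightarrow> (nat \<Rightarrow> 'z \<Rightarrow> 'z)
     \<Rightarrow> (nat \<Rightarrow> 'z \<Rightarrow> 'y)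
     \<Rightarrow> (nat \<Rightarrow> nat \<Rightarrow> 'y \<Rightarrow> 'y) \<Rightarrow> (nat \<Rightarrow> nat \<Rightarrow> 'y \<Rightarrow> 'y) \<Rightarrow> (nat \<Rightarrow> 'y \<Rightarrow> 'y) \<Rightarrow> bool" where
  "projects_to Z d s w \<pi> d' s' w' \<longleftrightarrow>
     (\<forall>n. \<forall>k\<le>Suc n. \<forall>z\<in>carrier (Z (Suc n)). d' (Suc n) k (\<pi> (Suc n) z) = \<pi> n (d (Suc n) k z))
     \<and> (\<forall>n. \<forall>k\<le>n. \<forall>z\<in>carrier (Z n). s' n k (\<pi> n z) = \<pi> (Suc n) (s n k z))
     \<and> (\<forall>n. \<forall>z\<in>carrier (Z n). w' n (\<pi> n z) = \<pi> n (w n z))"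


section \<open>The cyclic tensor product and its quotient\<close>

text \<open>
  Both modules are quotients of \<open>(C \<otimes>\<^sub>R \<dots> \<otimes>\<^sub>R C) \<otimes>\<^sub>\<bbbK> X\<close>, with \<open>n + 1\<close> factors \<open>C\<close>. The arguments
  \<open>lC\<close>, \<open>rC\<close>, \<open>lX\<close>, \<open>rX\<close> are the \<open>R\<close>-actions on \<open>C\<close> and \<open>X\<close>.
\<close>

definition pre_rels ::
  "('k \<Rightarrow> 'c \<Rightarrow> 'c) \<Rightarrow> ('r \<Rightarrow> 'c \<Rightarrow> 'c) \<Rightarrow> ('c \<Rightarrow> 'r \<Rightarrow> 'c) \<Rightarrow> ('k \<Rightarrow> 'x \<Rightarrow> 'x) \<Rightarrow> nat
     \<Rightarrow> ('c::ab_group_add list \<times> 'x::ab_group_add \<Rightarrow>\<^sub>0 'k::comm_ring_1) set" where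
  "pre_rels scC lC rC scX n =
     {flin (\<lambda>cs. gen (cs, x)) t |x t. t \<in> tpow_rels scC lC rC (n + 1)}
     \<union> \<Union> {slot_rels scX (\<lambda>x. (cs, x)) |cs. length cs = n + 1}"

text \<open>The last set of relations is \<open>r \<cdot> y - y \<cdot> r\<close>.\<close>

definition cyc_null ::
  "('k \<Rightarrow> 'c \<Rightarrow> 'c) \<Rightarrow> ('r \<Rightarrow> 'c \<Rightarrow> 'c) \<Rightarrow> ('c \<Rightarrow> 'r \<Rightarrow> 'c)
     \<Rightarrow> ('k \<Rightarrow> 'x \<Rightarrow> 'x) \<Rightarrow> ('r \<Rightarrow> 'x \<Rightarrow> 'x) \<Rightarrow> ('x \<Rightarrow> 'r \<Rightarrow> 'x) \<Rightarrow> nat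
     \<Rightarrow> ('c::ab_group_add list \<times> 'x::ab_group_add \<Rightarrow>\<^sub>0 'k::comm_ring_1) set" where
  "cyc_null scC lC rC scX lX rX n = fspan (pre_rels scC lC rC scX n
     \<union> {gen (cs @ [rC c r], x) - gen (cs @ [c], lX r x) |cs c r x. length cs = n}
     \<union> {gen (lC r c # cs, x) - gen (c # cs, rX x r) |cs c r x. length cs = n})"

definition cyc_tensor ::
  "('k \<Rightarrow> 'c \<Rightarrow> 'c) \<Rightarrow> ('r \<Rightarrow> 'c \<Rightarrow> 'c) \<Rightarrow> ('c \<Rightarrow> 'r \<Rightarrow> 'c)
     \<Rightarrow> ('k \<Rightarrow> 'x \<Rightarrow> 'x) \<Rightarrow> ('r \<Rightarrow> 'x \<Rightarrow> 'x) \<Rightarrow> ('x \<Rightarrow> 'r \<Rightarrow> 'x) \<Rightarrow> nat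
     \<Rightarrow> ('k::comm_ring_1, ('c::ab_group_add list \<times> 'x::ab_group_add \<Rightarrow>\<^sub>0 'k) set) module" where
  "cyc_tensor scC lC rC scX lX rX n =
     quot_mod {(cs, x). length cs = n + 1} (cyc_null scC lC rC scX lX rX n)"

text \<open>\<open>\<epsilon>C (c\<^sub>k)\<close> is absorbed by the next factor to the right, which is \<open>x\<close> for \<open>k = n\<close>.\<close>

definition cyc_face ::
  "('k \<Rightarrow> 'c \<Rightarrow> 'c) \<Rightarrow> ('r \<Rightarrow> 'c \<Rightarrow> 'c) \<Rightarrow> ('c \<Rightarrow> 'r \<Rightarrow> 'c)
     \<Rightarrow> ('k \<Rightarrow> 'x \<Rightarrow> 'x) \<Rightarrow> ('r \<Rightarrow> 'x \<Rightarrow> 'x) \<Rightarrow> ('x \<Rightarrow> 'r \<Rightarrow> 'x) \<Rightarrow> ('c \<Rightarrow> 'r) \<Rightarrow> nat \<Rightarrow> nat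
     \<Rightarrow> ('c::ab_group_add list \<times> 'x::ab_group_add \<Rightarrow>\<^sub>0 'k::comm_ring_1) set
     \<Rightarrow> ('c list \<times> 'x \<Rightarrow>\<^sub>0 'k) set" where
  "cyc_face scC lC rC scX lX rX \<epsilon>C n k = induced (cyc_null scC lC rC scX lX rX (n - 1))
     (\<lambda>(cs, x). {gen (if k < n
        then (take k cs @ lC (\<epsilon>C (cs ! k)) (cs ! (k + 1)) # drop (k + 2) cs, x)
        else (take n cs, lX (\<epsilon>C (cs ! n)) x))})"

definition cyc_degen ::
  "('k \<Rightarrow> 'c \<Rightarrow> 'c) \<Rightarrow> ('r \<Rightarrow> 'c \<Rightarrow> 'c) \<Rightarrow> ('c \<Rightarrow> 'r \<Rightarrow> 'c)
     \<Rightarrow> ('k \<Rightarrow> 'x \<Rightarrow> 'x) \<Rightarrow> ('r \<Rightarrow> 'x \<Rightarrow> 'x) \<Rightarrow> ('x \<Rightarrow> 'r \<Rightarrow> 'x)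
     \<Rightarrow> ('c \<Rightarrow> ('c list \<Rightarrow>\<^sub>0 'k) set) \<Rightarrow> nat \<Rightarrow> nat
     \<Rightarrow> ('c::ab_group_add list \<times> 'x::ab_group_add \<Rightarrow>\<^sub>0 'k::comm_ring_1) set
     \<Rightarrow> ('c list \<times> 'x \<Rightarrow>\<^sub>0 'k) set" where
  "cyc_degen scC lC rC scX lX rX \<Delta>C n k = induced (cyc_null scC lC rC scX lX rX (n + 1))
     (\<lambda>(cs, x). flin (\<lambda>cs'. gen (cs', x)) ` split_at \<Delta>C k cs)"

definition cyc_w ::
  "('k \<Rightarrow> 'c \<Rightarrow> 'c) \<Rightarrow> ('r \<Rightarrow> 'c \<Rightarrow> 'c) \<Rightarrow> ('c \<Rightarrow> 'r \<Rightarrow> 'c)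
     \<Rightarrow> ('k \<Rightarrow> 'x \<Rightarrow> 'x) \<Rightarrow> ('r \<Rightarrow> 'x \<Rightarrow> 'x) \<Rightarrow> ('x \<Rightarrow> 'r \<Rightarrow> 'x)
     \<Rightarrow> ('c \<Rightarrow> 'b \<Rightarrow> 'c) \<Rightarrow> ('x \<Rightarrow> ('x \<times> 'b list \<Rightarrow>\<^sub>0 'k) set) \<Rightarrow> nat
     \<Rightarrow> ('c::ab_group_add list \<times> 'x::ab_group_add \<Rightarrow>\<^sub>0 'k::comm_ring_1) set
     \<Rightarrow> ('c list \<times> 'x \<Rightarrow>\<^sub>0 'k) set" where
  "cyc_w scC lC rC scX lX rX act \<rho> n = induced (cyc_null scC lC rC scX lX rX n)
     (\<lambda>(cs, x). flin (\<lambda>(x0, bs). gen (act (cs ! n) (hd bs) # take n cs, x0)) ` \<rho> x)"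

text \<open>\<open>(C \<otimes>\<^sub>R \<dots> \<otimes>\<^sub>R C) \<otimes>\<^sub>\<B> X\<close>; the elements \<open>p\<close> represent \<open>b\<^sup>(\<^sup>1\<^sup>) \<otimes>\<^sub>R \<dots> \<otimes>\<^sub>R b\<^sup>(\<^sup>n\<^sup>+\<^sup>1\<^sup>)\<close>.\<close>

definition bal_null ::
  "('k \<Rightarrow> 'b \<Rightarrow> 'b) \<Rightarrow> ('r \<Rightarrow> 'b) \<Rightarrow> ('r \<Rightarrow> 'b) \<Rightarrow> ('b \<Rightarrow> ('b list \<Rightarrow>\<^sub>0 'k) set)
     \<Rightarrow> ('k \<Rightarrow> 'c \<Rightarrow> 'c) \<Rightarrow> ('c \<Rightarrow> 'b \<Rightarrow> 'c) \<Rightarrow> ('k \<Rightarrow> 'x \<Rightarrow> 'x) \<Rightarrow> ('b::{ring,monoid_mult} \<Rightarrow> 'x \<Rightarrow> 'x) \<Rightarrow> nat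
     \<Rightarrow> ('c::ab_group_add list \<times> 'x::ab_group_add \<Rightarrow>\<^sub>0 'k::comm_ring_1) set" where
  "bal_null scB \<xi> \<zeta> \<Delta> scC act scX lactB n = fspan
     (pre_rels scC (\<lambda>r c. act c (\<zeta> r)) (\<lambda>c r. act c (\<xi> r)) scX n
      \<union> {flin (\<lambda>bs. gen (map2 act cs bs, x)) p - gen (cs, lactB b x) |cs x b p.
           length cs = n + 1 \<and> p \<in> iter_coprod scB \<xi> \<zeta> \<Delta> n b})"

definition bal_tensor ::
  "('k \<Rightarrow> 'b \<Rightarrow> 'b) \<Rightarrow> ('r \<Rightarrow> 'b) \<Rightarrow> ('r \<Rightarrow> 'b) \<Rightarrow> ('b \<Rightarrow> ('b list \<Rightarrow>\<^sub>0 'k) set)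
     \<Rightarrow> ('k \<Rightarrow> 'c \<Rightarrow> 'c) \<Rightarrow> ('c \<Rightarrow> 'b \<Rightarrow> 'c) \<Rightarrow> ('k \<Rightarrow> 'x \<Rightarrow> 'x) \<Rightarrow> ('b::{ring,monoid_mult} \<Rightarrow> 'x \<Rightarrow> 'x) \<Rightarrow> nat
     \<Rightarrow> ('k::comm_ring_1, ('c::ab_group_add list \<times> 'x::ab_group_add \<Rightarrow>\<^sub>0 'k) set) module" where
  "bal_tensor scB \<xi> \<zeta> \<Delta> scC act scX lactB n =
     quot_mod {(cs, x). length cs = n + 1} (bal_null scB \<xi> \<zeta> \<Delta> scC act scX lactB n)"

definition canonical_map ::
  "('k \<Rightarrow> 'b \<Rightarrow> 'b) \<Rightarrow> ('r \<Rightarrow> 'b) \<Rightarrow> ('r \<Rightarrow> 'b) \<Rightarrow> ('b \<Rightarrow> ('b list \<Rightarrow>\<^sub>0 'k) set)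
     \<Rightarrow> ('k \<Rightarrow> 'c \<Rightarrow> 'c) \<Rightarrow> ('c \<Rightarrow> 'b \<Rightarrow> 'c) \<Rightarrow> ('k \<Rightarrow> 'x \<Rightarrow> 'x) \<Rightarrow> ('b::{ring,monoid_mult} \<Rightarrow> 'x \<Rightarrow> 'x) \<Rightarrow> nat
     \<Rightarrow> ('c::ab_group_add list \<times> 'x::ab_group_add \<Rightarrow>\<^sub>0 'k::comm_ring_1) set
     \<Rightarrow> ('c list \<times> 'x \<Rightarrow>\<^sub>0 'k) set" where
  "canonical_map scB \<xi> \<zeta> \<Delta> scC act scX lactB n =
     induced (bal_null scB \<xi> \<zeta> \<Delta> scC act scX lactB n) (\<lambda>(cs, x). {gen (cs, x)})"

end

(*
  All maps are given on generators of free modules, so it suffices to see that they respect the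
  defining relations and to check the para-cyclic identities on generators. For the cyclic tensor
  product this is a Sweedler computation resting on rho(r x) = x0 (x) xi(r) x1 and
  r x0 (x) x1 = x0 (x) zeta(r) x1. For the tensor product over B, faces other than the last and
  degeneracies respect the balancing relation by the Takeuchi condition, the counit axioms and
  coassociativity. The operator w does so because the anti Yetter-Drinfel'd condition puts
  b1_- next to c_n and b1_+ onto x; moving b1_+ across the tensor product and using
  b_- b_+(1) (x) b_+(2) = 1 (x) b makes both disappear. The last face is d_0 w. Finally, w^(n+1)
  sends c (x) x to c . x1 (x) x0 with the diagonal action, which over B equals c (x) x1 x0, that is,
  c (x) x in the stable case.
*)
theory Submission
  imports Defs
begin

section \<open>Linear extension and congruence of formal sums\<close>

text \<open>Every Sweedler formula depends on representatives, so cosets are awkward to compute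
  with. The proof works dually. A map out of a tensor product is a function \<open>F\<close> on
  generators that satisfies the defining relations modulo the span of an arbitrary set
  \<open>N\<close>; faces, degeneracies and rotation act on such functions by precomposition. It
  remains to see that precomposition preserves balancedness and that the values of \<open>F\<close>
  satisfy the identities. Taking \<open>F = gen\<close>, and for \<open>N\<close> the relations
  themselves, gives back the quotient. A function balanced over the bialgebroid is also cyclically
  balanced, because the cyclic relations are the balancing relations for \<open>b = \<xi> r\<close>
  and \<open>b = \<zeta> r\<close>; hence one set of identities serves both quotients. Two points
  are delicate. The identity for \<open>b_-\<close> and \<open>b_+\<close> needs two tensor legs,
  one for the rotated entry and one for the others; in degree 0 only one entry exists, and the image
  \<open>b_- b_+ = \<xi> (\<epsilon> b)\<close> under the counit takes its place. Moreover, the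
  Galois identity peels iterated coproducts at the front and rotation at the back, so
  coassociativity is needed at every position.\<close>

interpretation fs: Modules.module fsmult
  by (rule module_fsmult)

abbreviation supp :: "('s \<Rightarrow>\<^sub>0 'k::zero) \<Rightarrow> 's set" where
  "supp \<equiv> Poly_Mapping.keys"

lemma lookup_fsmult [simp]: "Poly_Mapping.lookup (fsmult k p) s = k * Poly_Mapping.lookup p s"
  by (simp add: fsmult_def map.rep_eq when_def)

lemma keys_fsmult: "supp (fsmult k p) \<subseteq> supp p"
  by (auto simp: in_keys_iff)

lemma keys_diff_subset: "supp (p - q) \<subseteq> supp p \<union> supp (q :: _ \<Rightarrow>\<^sub>0 'k::comm_ring_1)"
  by (auto simp: in_keys_iff lookup_minus)

context Modules.module
begin

text \<open>The support of a sum or multiple can be smaller than expected, so sums are compared over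
  a common finite set of indices.\<close>

lemma lext_superset:
  assumes "finite A" "supp p \<subseteq> A"
  shows "lext scale f p = (\<Sum>s\<in>A. scale (Poly_Mapping.lookup p s) (f s))"
  unfolding lext_def
  by (rule sum.mono_neutral_left) (use assms in \<open>auto simp: in_keys_iff\<close>)

lemma lext_add: "lext scale f (p + q) = lext scale f p + lext scale f q"
proof -
  let ?A = "supp p \<union> supp q"
  have "finite ?A" by simp
  then show ?thesis
    using keys_add[of p q]
    by (simp add: lext_superset[of ?A] lookup_add scale_left_distrib sum.distrib)
qed

lemma lext_fsmult: "lext scale f (fsmult k p) = scale k (lext scale f p)"
  using keys_fsmult[of k p]
  by (simp add: lext_superset[of "supp p"] scale_sum_right)

lemma lext_zero [simp]: "lext scale f 0 = 0"
  by (simp add: lext_def)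

lemma lext_minus: "lext scale f (- p) = - lext scale f p"
  using lext_add[of f p "- p"] by (simp add: eq_neg_iff_add_eq_0 add.commute)

lemma lext_diff: "lext scale f (p - q) = lext scale f p - lext scale f q"
  using lext_add[of f p "- q"] by (simp add: lext_minus)

lemma lext_gen [simp]: "lext scale f (gen s) = f s"
  by (simp add: lext_def)

lemma lext_sum: "lext scale f (\<Sum>i\<in>I. p i) = (\<Sum>i\<in>I. lext scale f (p i))"
  by (induction I rule: infinite_finite_induct) (simp_all add: lext_add)

lemma lext_fun_add: "lext scale (\<lambda>s. f s + g s) p = lext scale f p + lext scale g p"
  by (simp add: lext_def scale_right_distrib sum.distrib)

lemma lext_fun_scale: "lext scale (\<lambda>s. scale k (f s)) p = scale k (lext scale f p)"
  by (simp add: lext_def scale_sum_right mult.commute)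

lemma lext_fun_diff: "lext scale (\<lambda>s. f s - g s) p = lext scale f p - lext scale g p"
  by (simp add: lext_def scale_right_diff_distrib sum_subtractf)

lemma lext_flin: "lext scale f (flin g p) = lext scale (\<lambda>s. lext scale f (g s)) p"
proof -
  have "flin g p = (\<Sum>s\<in>supp p. fsmult (Poly_Mapping.lookup p s) (g s))"
    by (simp add: lext_def)
  then show ?thesis
    by (simp add: lext_sum lext_fsmult lext_def[of scale "\<lambda>s. lext scale f (g s)"])
qed

text \<open>Fubini for formal sums: Sweedler sums over unrelated elements may be exchanged, as an
  equality and without any balancedness.\<close>

lemma lext_commute:
  "lext scale (\<lambda>s. lext scale (f s) q) p = lext scale (\<lambda>t. lext scale (\<lambda>s. f s t) p) q"
proof -
  have "lext scale (\<lambda>s. lext scale (f s) q) p = (\<Sum>s\<in>supp p. \<Sum>t\<in>supp q.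
      scale (Poly_Mapping.lookup p s) (scale (Poly_Mapping.lookup q t) (f s t)))"
    by (simp add: lext_def scale_sum_right)
  also have "\<dots> = (\<Sum>t\<in>supp q. \<Sum>s\<in>supp p.
      scale (Poly_Mapping.lookup q t) (scale (Poly_Mapping.lookup p s) (f s t)))"
    by (subst sum.swap) (simp add: mult.commute)
  finally show ?thesis
    by (simp add: lext_def scale_sum_right)
qed

end

lemma lext_cong:
  "(\<And>s. s \<in> supp p \<Longrightarrow> f s = g s) \<Longrightarrow> lext sc f p = lext sc g p"
  by (simp add: lext_def)

lemma flin_gen_id: "flin gen p = p"
proof (rule poly_mapping_eqI)
  fix s
  have "Poly_Mapping.lookup (flin gen p) s
      = (\<Sum>t\<in>supp p. Poly_Mapping.lookup p t * Poly_Mapping.lookup (gen t) s)"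
    by (simp add: lext_def lookup_sum)
  also have "\<dots> = (\<Sum>t\<in>supp p. if t = s then Poly_Mapping.lookup p t else 0)"
    by (rule sum.cong) (auto simp: lookup_single when_def)
  also have "\<dots> = Poly_Mapping.lookup p s"
    by (auto simp: sum.delta in_keys_iff)
  finally show "Poly_Mapping.lookup (flin gen p) s = Poly_Mapping.lookup p s" .
qed

lemma keys_flin_subset:
  assumes "\<And>s. s \<in> supp p \<Longrightarrow> supp (f s) \<subseteq> G"
  shows "supp (flin f p) \<subseteq> G"
proof -
  have "supp (flin f p)
      \<subseteq> (\<Union>s\<in>supp p. supp (fsmult (Poly_Mapping.lookup p s) (f s)))"
    unfolding lext_def by (rule keys_sum)
  then show ?thesis
    using assms keys_fsmult by fast
qed

lemma subspace_keys: "fs.subspace {p :: 's \<Rightarrow>\<^sub>0 'k::comm_ring_1. supp p \<subseteq> G}"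
proof (rule fs.subspaceI)
  fix x y :: "'s \<Rightarrow>\<^sub>0 'k" and c :: 'k
  assume "x \<in> {p. supp p \<subseteq> G}" "y \<in> {p. supp p \<subseteq> G}"
  then show "x + y \<in> {p. supp p \<subseteq> G}"
    using keys_add[of x y] by auto
next
  fix x :: "'s \<Rightarrow>\<^sub>0 'k" and c :: 'k
  assume "x \<in> {p. supp p \<subseteq> G}"
  then show "fsmult c x \<in> {p. supp p \<subseteq> G}"
    using keys_fsmult[of c x] by auto
qed auto

lemma keys_fspan:
  assumes "\<And>p. p \<in> R \<Longrightarrow> supp p \<subseteq> G" "q \<in> fspan R"
  shows "supp q \<subseteq> G"
  using fs.span_minimal[of R "{p. supp p \<subseteq> G}"] subspace_keys assms by blast

text \<open>
  Instead of in a quotient, computations take place in a free module, up to congruence modulo the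
  span of a set \<open>N\<close> of relations.
\<close>

definition eqmod :: "('t \<Rightarrow>\<^sub>0 'k::comm_ring_1) \<Rightarrow> ('t \<Rightarrow>\<^sub>0 'k) set \<Rightarrow> ('t \<Rightarrow>\<^sub>0 'k) \<Rightarrow> bool"
    ("(_/ \<approx>[_] _)" [51, 0, 51] 50) where
  "x \<approx>[N] y \<longleftrightarrow> x - y \<in> fspan N"

lemma eqmod_refl [simp]: "x \<approx>[N] x"
  by (simp add: eqmod_def fs.span_zero)

lemma eqmod_reflI: "x = y \<Longrightarrow> x \<approx>[N] y"
  by simp

lemma eqmod_sym: "x \<approx>[N] y \<Longrightarrow> y \<approx>[N] x"
  unfolding eqmod_def using fs.span_neg[of "x - y" N] by simp

lemma eqmod_trans [trans]: "x \<approx>[N] y \<Longrightarrow> y \<approx>[N] z \<Longrightarrow> x \<approx>[N] z"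
  unfolding eqmod_def using fs.span_add[of "x - y" N "y - z"] by simp

lemma eqmod_add: "x \<approx>[N] y \<Longrightarrow> x' \<approx>[N] y' \<Longrightarrow> x + x' \<approx>[N] y + y'"
  unfolding eqmod_def using fs.span_add[of "x - y" N "x' - y'"] by (simp add: algebra_simps)

lemma eqmod_diff: "x \<approx>[N] y \<Longrightarrow> x' \<approx>[N] y' \<Longrightarrow> x - x' \<approx>[N] y - y'"
  unfolding eqmod_def using fs.span_diff[of "x - y" N "x' - y'"] by (simp add: algebra_simps)

lemma eqmod_fsmult: "x \<approx>[N] y \<Longrightarrow> fsmult k x \<approx>[N] fsmult k y"
  unfolding eqmod_def using fs.span_scale[of "x - y" N k] by (simp add: fs.scale_right_diff_distrib)

lemma eqmod_zero_iff: "x \<approx>[N] 0 \<longleftrightarrow> x \<in> fspan N"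
  by (simp add: eqmod_def)

lemma eqmod_flin:
  assumes "\<And>s. s \<in> supp p \<Longrightarrow> f s \<approx>[N] g s"
  shows "flin f p \<approx>[N] flin g p"
proof -
  have "flin f p - flin g p = flin (\<lambda>s. f s - g s) p"
    by (simp add: fs.lext_fun_diff)
  also have "\<dots> \<in> fspan N"
    unfolding lext_def using assms by (intro fs.span_sum fs.span_scale) (auto simp: eqmod_def)
  finally show ?thesis
    by (simp add: eqmod_def)
qed

lemma flin_span:
  assumes "\<And>r. r \<in> R \<Longrightarrow> flin f r \<in> fspan N" "p \<in> fspan R"
  shows "flin f p \<in> fspan N"
proof -
  have "fs.subspace {p. flin f p \<in> fspan N}"
    by (rule fs.subspaceI)
      (auto simp: fs.lext_add fs.lext_fsmult fs.span_zero intro: fs.span_add fs.span_scale)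
  then show ?thesis
    using fs.span_minimal[of R "{p. flin f p \<in> fspan N}"] assms by blast
qed

lemma eqmod_flin_arg:
  assumes "\<And>r. r \<in> R \<Longrightarrow> flin f r \<approx>[N] 0" "p \<approx>[R] q"
  shows "flin f p \<approx>[N] flin f q"
  using flin_span[of R f N "p - q"] assms
  unfolding eqmod_def by (simp add: fs.lext_diff)

text \<open>The basic function \<open>gen\<close> is not additive; it becomes linear only modulo the
  slot relations. Linearity is therefore always meant up to congruence.\<close>

definition linmod :: "('t \<Rightarrow>\<^sub>0 'k::comm_ring_1) set \<Rightarrow> ('k \<Rightarrow> 'm \<Rightarrow> 'm) \<Rightarrow> ('m::ab_group_add \<Rightarrow> ('t \<Rightarrow>\<^sub>0 'k)) \<Rightarrow> bool"
  where "linmod N sc g \<longleftrightarrow> (\<forall>a b. g (a + b) \<approx>[N] g a + g b) \<and> (\<forall>k a. g (sc k a) \<approx>[N] fsmult k (g a))"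

lemma linmodI:
  "(\<And>a b. g (a + b) \<approx>[N] g a + g b) \<Longrightarrow> (\<And>k a. g (sc k a) \<approx>[N] fsmult k (g a)) \<Longrightarrow> linmod N sc g"
  by (simp add: linmod_def)

lemma linmod_add: "linmod N sc g \<Longrightarrow> g (a + b) \<approx>[N] g a + g b"
  by (simp add: linmod_def)

lemma linmod_scale: "linmod N sc g \<Longrightarrow> g (sc k a) \<approx>[N] fsmult k (g a)"
  by (simp add: linmod_def)

lemma linmod_eqmod:
  assumes "linmod N sc g" "\<And>m. f m \<approx>[N] g m"
  shows "linmod N sc f"
proof (rule linmodI)
  show "f (a + b) \<approx>[N] f a + f b" for a b
    using assms by (meson eqmod_add eqmod_sym eqmod_trans linmod_add)
  show "f (sc k a) \<approx>[N] fsmult k (f a)" for k a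
    using assms by (meson eqmod_fsmult eqmod_sym eqmod_trans linmod_scale)
qed

lemma linmod_flin:
  assumes "\<And>s. s \<in> supp p \<Longrightarrow> linmod N sc (\<lambda>m. f m s)"
  shows "linmod N sc (\<lambda>m. flin (f m) p)"
proof (rule linmodI)
  show "flin (f (a + b)) p \<approx>[N] flin (f a) p + flin (f b) p" for a b
    unfolding fs.lext_fun_add[symmetric] using linmod_add[OF assms] by (rule eqmod_flin)
  show "flin (f (sc k a)) p \<approx>[N] fsmult k (flin (f a) p)" for k a
    unfolding fs.lext_fun_scale[symmetric] using linmod_scale[OF assms] by (rule eqmod_flin)
qed

lemma linmod_comp:
  assumes "linmod N sc g" "\<And>a b. h (a + b) = h a + h b" "\<And>k a. h (sc' k a) = sc k (h a)"
  shows "linmod N sc' (\<lambda>m. g (h m))"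
  using assms by (simp add: linmod_def)

lemma linmod_zero:
  assumes "linmod N sc g"
  shows "g 0 \<approx>[N] 0"
proof -
  have "g 0 \<approx>[N] g 0 + g 0"
    using linmod_add[OF assms, of 0 0] by simp
  from eqmod_diff[OF this eqmod_refl[of "g 0"]] show ?thesis
    by (simp add: eqmod_sym)
qed

text \<open>The counit axioms and stability are equations inside a module. Through this lemma they
  become congruences of formal sums.\<close>

lemma linmod_lext:
  assumes g: "linmod N sc g"
  shows "g (lext sc h p) \<approx>[N] flin (\<lambda>s. g (h s)) p"
proof -
  have "g (\<Sum>s\<in>A. sc (c s) (h s)) \<approx>[N] (\<Sum>s\<in>A. fsmult (c s) (g (h s)))" if "finite A" for A c
    using that
  proof induction
    case empty
    show ?case by (simp add: linmod_zero[OF g])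
  next
    case (insert x F)
    have "g (sc (c x) (h x) + (\<Sum>s\<in>F. sc (c s) (h s)))
        \<approx>[N] fsmult (c x) (g (h x)) + (\<Sum>s\<in>F. fsmult (c s) (g (h s)))"
      using linmod_add[OF g] linmod_scale[OF g] insert.IH by (meson eqmod_add eqmod_trans)
    then show ?case
      using insert.hyps by simp
  qed
  then show ?thesis
    by (simp add: lext_def)
qed

lemma eqmod_diff_zero: "x - y \<approx>[N] 0 \<longleftrightarrow> x \<approx>[N] y"
  by (simp add: eqmod_def)

lemma ball_Collect2: "(\<forall>p\<in>{F a b |a b. True}. P p) \<longleftrightarrow> (\<forall>a b. P (F a b))"
  by blast

lemma linmod_iff_slot_rels:
  "linmod N sc (\<lambda>m. f (h m)) \<longleftrightarrow> (\<forall>p\<in>slot_rels sc h. flin f p \<approx>[N] 0)"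
proof -
  have "f (h (a + b)) - f (h a) - f (h b) \<approx>[N] 0 \<longleftrightarrow> f (h (a + b)) \<approx>[N] f (h a) + f (h b)" for a b
    by (simp add: eqmod_def diff_diff_add)
  then show ?thesis
    unfolding linmod_def slot_rels_def ball_Un ball_Collect2
    by (simp add: fs.lext_diff fs.lext_fsmult eqmod_diff_zero[of "f (h (sc _ _))"])
qed

section \<open>Tensorial functions on lists\<close>

text \<open>The universal property of the tensor power: \<open>f\<close> induces a map from it to
  the free module modulo \<open>N\<close>.\<close>

definition tens ::
  "('t \<Rightarrow>\<^sub>0 'k) set \<Rightarrow> ('k \<Rightarrow> 'm \<Rightarrow> 'm) \<Rightarrow> ('r \<Rightarrow> 'm \<Rightarrow> 'm) \<Rightarrow> ('m \<Rightarrow> 'r \<Rightarrow> 'm) \<Rightarrow> nat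
     \<Rightarrow> ('m::ab_group_add list \<Rightarrow> ('t \<Rightarrow>\<^sub>0 'k::comm_ring_1)) \<Rightarrow> bool" where
  "tens N sc lact ract n f \<longleftrightarrow> (\<forall>t\<in>tpow_rels sc lact ract n. flin f t \<approx>[N] 0)"

lemma tens_iff:
  fixes f :: "'m::ab_group_add list \<Rightarrow> ('t \<Rightarrow>\<^sub>0 'k::comm_ring_1)"
  shows "tens N sc lact ract n f \<longleftrightarrow>
     (\<forall>us vs. length us + length vs + 1 = n \<longrightarrow> linmod N sc (\<lambda>m. f (us @ m # vs)))
   \<and> (\<forall>us vs a b r. length us + length vs + 2 = n \<longrightarrow>
        f (us @ ract a r # b # vs) \<approx>[N] f (us @ a # lact r b # vs))"
proof -
  have "(\<forall>p\<in>\<Union> {slot_rels sc (\<lambda>m. us @ m # vs) |us vs. length us + length vs + 1 = n}. flin f p \<approx>[N] 0)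
      \<longleftrightarrow> (\<forall>us vs. length us + length vs + 1 = n \<longrightarrow> linmod N sc (\<lambda>m. f (us @ m # vs)))"
    by (subst linmod_iff_slot_rels[of N sc f]) blast
  moreover have "(\<forall>p\<in>{gen (us @ ract a r # b # vs) - gen (us @ a # lact r b # vs) |us vs a b r.
          length us + length vs + 2 = n}. flin f p \<approx>[N] 0)
     \<longleftrightarrow> (\<forall>us vs a b r. length us + length vs + 2 = n \<longrightarrow>
        flin f (gen (us @ ract a r # b # vs) - gen (us @ a # lact r b # vs)) \<approx>[N] 0)"
    by blast
  ultimately show ?thesis
    by (simp add: tens_def tpow_rels_def ball_Un fs.lext_diff eqmod_diff_zero)
qed

lemma tens_cong:
  fixes f :: "'m::ab_group_add list \<Rightarrow> ('t \<Rightarrow>\<^sub>0 'k::comm_ring_1)"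
  assumes "tens N sc lact ract n g" "\<And>l. length l = n \<Longrightarrow> f l \<approx>[N] g l"
  shows "tens N sc lact ract n f"
  unfolding tens_iff
proof (intro conjI allI impI)
  fix us vs :: "'m list" assume "length us + length vs + 1 = n"
  then show "linmod N sc (\<lambda>m. f (us @ m # vs))"
    using assms(1) by (intro linmod_eqmod[OF _ assms(2)]) (auto simp: tens_iff)
next
  fix us vs :: "'m list" and a b r assume l: "length us + length vs + 2 = n"
  have "f (us @ ract a r # b # vs) \<approx>[N] g (us @ ract a r # b # vs)"
    using l by (intro assms(2)) simp
  also have "\<dots> \<approx>[N] g (us @ a # lact r b # vs)"
    using assms(1) l by (simp add: tens_iff)
  also have "\<dots> \<approx>[N] f (us @ a # lact r b # vs)"
    using l by (intro eqmod_sym[OF assms(2)]) simp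
  finally show "f (us @ ract a r # b # vs) \<approx>[N] f (us @ a # lact r b # vs)" .
qed

lemma tens_Suc_0: "tens N sc lact ract (Suc 0) f \<longleftrightarrow> linmod N sc (\<lambda>m. f [m])"
  by (auto simp: tens_iff)

text \<open>The relations are sorted into those that involve the first entry and those of the tail.
  Together with \<open>tens_Suc_0\<close> this allows induction along the list.\<close>

lemma tens_Suc_Suc:
  fixes f :: "'m::ab_group_add list \<Rightarrow> ('t \<Rightarrow>\<^sub>0 'k::comm_ring_1)"
  shows "tens N sc lact ract (Suc (Suc n)) f \<longleftrightarrow>
     (\<forall>l. length l = Suc n \<longrightarrow> linmod N sc (\<lambda>m. f (m # l)))
   \<and> (\<forall>a b r l. length l = n \<longrightarrow> f (ract a r # b # l) \<approx>[N] f (a # lact r b # l))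
   \<and> (\<forall>m. tens N sc lact ract (Suc n) (\<lambda>l. f (m # l)))"
proof -
  have nil_or_Cons: "(\<forall>us. P us) \<longleftrightarrow> P [] \<and> (\<forall>u us. P (u # us))" for P :: "'m list \<Rightarrow> bool"
    by (metis list.exhaust)
  show ?thesis
    unfolding tens_iff
    by (subst (1) nil_or_Cons, subst (3) nil_or_Cons) (auto simp: all_conj_distrib)
qed

lemma tens_2:
  "tens N sc lact ract 2 f \<longleftrightarrow>
     (\<forall>b. linmod N sc (\<lambda>a. f [a, b])) \<and> (\<forall>a. linmod N sc (\<lambda>b. f [a, b]))
   \<and> (\<forall>a b r. f [ract a r, b] \<approx>[N] f [a, lact r b])"
  by (auto simp: numeral_2_eq_2 tens_Suc_Suc tens_Suc_0 length_Suc_conv)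

lemma tens_3:
  "tens N sc lact ract 3 f \<longleftrightarrow>
     (\<forall>b c. linmod N sc (\<lambda>a. f [a, b, c])) \<and> (\<forall>a c. linmod N sc (\<lambda>b. f [a, b, c]))
   \<and> (\<forall>a b. linmod N sc (\<lambda>c. f [a, b, c]))
   \<and> (\<forall>a b c r. f [ract a r, b, c] \<approx>[N] f [a, lact r b, c])
   \<and> (\<forall>a b c r. f [a, ract b r, c] \<approx>[N] f [a, b, lact r c])"
  by (auto simp: numeral_3_eq_3 tens_Suc_Suc tens_Suc_0 length_Suc_conv)

lemma tens_eqmod:
  assumes "tens N sc lact ract n f" "p \<approx>[tpow_rels sc lact ract n] q"
  shows "flin f p \<approx>[N] flin f q"
  using assms by (intro eqmod_flin_arg[of "tpow_rels sc lact ract n"]) (auto simp: tens_def)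

text \<open>The universal example, through which statements about all balanced functions turn into
  statements about the tensor power itself.\<close>

lemma tens_gen: "tens (tpow_rels sc lact ract n) sc lact ract n gen"
  by (simp add: tens_def flin_gen_id eqmod_zero_iff fs.span_base)

lemma keys_gen_diff:
  "s \<in> G \<Longrightarrow> t \<in> G \<Longrightarrow> supp (gen s - gen t :: 's \<Rightarrow>\<^sub>0 'k::comm_ring_1) \<subseteq> G"
  using keys_diff_subset[of "gen s" "gen t"] by auto

lemma keys_slot_rels:
  fixes p :: "'s \<Rightarrow>\<^sub>0 'k::comm_ring_1"
  assumes "p \<in> slot_rels sc h" "\<And>m. h m \<in> G"
  shows "supp p \<subseteq> G"
proof -
  have "supp (fsmult k (gen (h a)) :: 's \<Rightarrow>\<^sub>0 'k) \<subseteq> G" for k a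
    using keys_fsmult[of k "gen (h a)"] assms(2) by auto
  moreover have "supp (x - y :: 's \<Rightarrow>\<^sub>0 'k) \<subseteq> G"
    if "supp x \<subseteq> G" "supp y \<subseteq> G" for x y
    using that keys_diff_subset[of x y] by blast
  moreover have "supp (gen (h a) :: 's \<Rightarrow>\<^sub>0 'k) \<subseteq> G" for a
    using assms(2) by simp
  ultimately show ?thesis
    using assms(1) unfolding slot_rels_def by blast
qed

lemma keys_tpow_rels:
  fixes p :: "'m::ab_group_add list \<Rightarrow>\<^sub>0 'k::comm_ring_1"
  assumes "p \<in> tpow_rels sc lact ract n"
  shows "supp p \<subseteq> {ms. length ms = n}"
proof -
  have "supp p \<subseteq> {ms. length ms = n}"
    if "p \<in> slot_rels sc (\<lambda>m. us @ m # vs)" "length us + length vs + 1 = n" for us vs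
    using that by (intro keys_slot_rels[OF that(1)]) simp
  moreover have "supp (gen (us @ ract a r # b # vs) - gen (us @ a # lact r b # vs) :: 'm list \<Rightarrow>\<^sub>0 'k)
      \<subseteq> {ms. length ms = n}" if "length us + length vs + 2 = n" for us vs a b r
    using that by (intro keys_gen_diff) simp_all
  ultimately show ?thesis
    using assms unfolding tpow_rels_def by blast
qed


section \<open>Quotients of free modules\<close>

lemma mem_coset_iff: "w \<in> v +o fspan R \<longleftrightarrow> w \<approx>[R] v"
  by (auto simp: elt_set_plus_def eqmod_def intro: bexI[of _ "w - v"])

lemma coset_eq_iff: "v +o fspan R = w +o fspan R \<longleftrightarrow> v \<approx>[R] w"
proof
  assume "v +o fspan R = w +o fspan R"
  moreover have "v \<in> v +o fspan R" by (simp add: mem_coset_iff)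
  ultimately show "v \<approx>[R] w" by (simp add: mem_coset_iff)
next
  assume "v \<approx>[R] w"
  then show "v +o fspan R = w +o fspan R"
    by (auto simp: mem_coset_iff) (blast intro: eqmod_trans eqmod_sym)+
qed

lemma coset_add: "(v +o fspan R) + (w +o fspan R) = (v + w) +o fspan R"
proof (intro equalityI subsetI)
  fix x assume "x \<in> (v +o fspan R) + (w +o fspan R)"
  then show "x \<in> (v + w) +o fspan R"
    by (auto simp: set_plus_def mem_coset_iff intro: eqmod_add)
next
  fix x assume "x \<in> (v + w) +o fspan R"
  then have "x - w \<in> v +o fspan R" "w \<in> w +o fspan R"
    by (auto simp: mem_coset_iff eqmod_def algebra_simps)
  then show "x \<in> (v +o fspan R) + (w +o fspan R)"
    by (metis diff_add_cancel set_plus_intro)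
qed

lemma zero_coset: "(0 :: 's \<Rightarrow>\<^sub>0 'k::comm_ring_1) +o fspan R = fspan R"
  by (auto simp: elt_set_plus_def)

lemma coset_add_span: "(v +o fspan R) + fspan R = v +o fspan R"
  using coset_add[of v R 0] by (simp add: zero_coset)

lemma coset_smult: "fsmult k ` (v +o fspan R) + fspan R = fsmult k v +o fspan R"
proof (intro equalityI subsetI)
  fix x assume "x \<in> fsmult k ` (v +o fspan R) + fspan R"
  then obtain w u where "x = fsmult k w + u" "w \<approx>[R] v" "u \<approx>[R] 0"
    by (auto simp: set_plus_def mem_coset_iff eqmod_zero_iff)
  then show "x \<in> fsmult k v +o fspan R"
    using eqmod_add[OF eqmod_fsmult, of w R v u 0 k] by (simp add: mem_coset_iff)
next
  fix x assume "x \<in> fsmult k v +o fspan R"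
  then have "x - fsmult k v \<in> fspan R"
    by (simp add: mem_coset_iff eqmod_def)
  moreover have "fsmult k v \<in> fsmult k ` (v +o fspan R)"
    by (simp add: mem_coset_iff)
  ultimately show "x \<in> fsmult k ` (v +o fspan R) + fspan R"
    by (metis add.commute diff_add_cancel set_plus_intro)
qed

lemma carrier_quot_modE:
  assumes "A \<in> carrier (quot_mod G N)"
  obtains v where "A = v +o N" "supp v \<subseteq> G"
  using assms by (auto simp: quot_mod_def)

lemma coset_in_carrier: "supp v \<subseteq> G \<Longrightarrow> v +o N \<in> carrier (quot_mod G N)"
  by (auto simp: quot_mod_def)

lemma quot_mod_simps [simp]:
  "\<zero>\<^bsub>quot_mod G N\<^esub> = N"
  "A \<oplus>\<^bsub>quot_mod G N\<^esub> B = A + B"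
  "k \<odot>\<^bsub>quot_mod G N\<^esub> A = fsmult k ` A + N"
  by (simp_all add: quot_mod_def)

lemma module_quot_mod: "Module.module coeff_ring (quot_mod G (fspan (R :: ('s \<Rightarrow>\<^sub>0 'k::comm_ring_1) set)))"
proof -
  let ?Q = "quot_mod G (fspan R)"
  have cring: "cring (coeff_ring :: 'k ring)"
  proof (intro cringI abelian_groupI comm_monoidI)
    show "\<exists>y\<in>carrier coeff_ring. y \<oplus>\<^bsub>coeff_ring\<^esub> x = \<zero>\<^bsub>coeff_ring\<^esub>" for x :: 'k
      by (rule bexI[of _ "- x"]) (auto simp: coeff_ring_def)
  qed (auto simp: coeff_ring_def algebra_simps)
  have keys_plus: "supp (v + w) \<subseteq> G"
    if "supp v \<subseteq> G" "supp w \<subseteq> G" for v w :: "'s \<Rightarrow>\<^sub>0 'k"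
    using that keys_add[of v w] by blast
  have keys_smult: "supp (fsmult k v) \<subseteq> G"
    if "supp v \<subseteq> G" for k and v :: "'s \<Rightarrow>\<^sub>0 'k"
    using that keys_fsmult[of k v] by blast
  have ab: "abelian_group ?Q"
  proof (rule abelian_groupI)
    show "x \<oplus>\<^bsub>?Q\<^esub> y \<in> carrier ?Q" if "x \<in> carrier ?Q" "y \<in> carrier ?Q" for x y
      using that by (elim carrier_quot_modE) (simp add: coset_add coset_in_carrier keys_plus)
    show "\<zero>\<^bsub>?Q\<^esub> \<in> carrier ?Q"
      using coset_in_carrier[of 0 G "fspan R"] by (simp add: zero_coset)
    show "x \<oplus>\<^bsub>?Q\<^esub> y \<oplus>\<^bsub>?Q\<^esub> z = x \<oplus>\<^bsub>?Q\<^esub> (y \<oplus>\<^bsub>?Q\<^esub> z)" for x y z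
      by (simp add: add.assoc)
    show "x \<oplus>\<^bsub>?Q\<^esub> y = y \<oplus>\<^bsub>?Q\<^esub> x" for x y
      by (simp add: add.commute)
    show "\<zero>\<^bsub>?Q\<^esub> \<oplus>\<^bsub>?Q\<^esub> x = x" if "x \<in> carrier ?Q" for x
      using that coset_add[of 0 R] by (elim carrier_quot_modE) (simp add: zero_coset)
    show "\<exists>y\<in>carrier ?Q. y \<oplus>\<^bsub>?Q\<^esub> x = \<zero>\<^bsub>?Q\<^esub>" if x: "x \<in> carrier ?Q" for x
    proof -
      obtain v where v: "x = v +o fspan R" "supp v \<subseteq> G"
        using carrier_quot_modE[OF x] .
      have "fsmult (- 1) v +o fspan R \<in> carrier ?Q"
        by (intro coset_in_carrier keys_smult v)
      moreover have "(fsmult (- 1) v +o fspan R) \<oplus>\<^bsub>?Q\<^esub> x = \<zero>\<^bsub>?Q\<^esub>"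
        by (simp add: v coset_add zero_coset)
      ultimately show ?thesis by blast
    qed
  qed
  show ?thesis
  proof (rule moduleI[OF cring ab])
    show "a \<odot>\<^bsub>?Q\<^esub> x \<in> carrier ?Q" if "x \<in> carrier ?Q" for a x
      using that by (elim carrier_quot_modE) (simp add: coset_smult coset_in_carrier keys_smult)
    show "(a \<oplus>\<^bsub>coeff_ring\<^esub> b) \<odot>\<^bsub>?Q\<^esub> x = a \<odot>\<^bsub>?Q\<^esub> x \<oplus>\<^bsub>?Q\<^esub> b \<odot>\<^bsub>?Q\<^esub> x" if "x \<in> carrier ?Q" for a b x
      using that by (elim carrier_quot_modE)
        (simp add: coset_smult coset_add coeff_ring_def, simp add: fs.scale_left_distrib)
    show "a \<odot>\<^bsub>?Q\<^esub> (x \<oplus>\<^bsub>?Q\<^esub> y) = a \<odot>\<^bsub>?Q\<^esub> x \<oplus>\<^bsub>?Q\<^esub> a \<odot>\<^bsub>?Q\<^esub> y"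
      if "x \<in> carrier ?Q" "y \<in> carrier ?Q" for a x y
      using that by (elim carrier_quot_modE) (simp add: coset_smult coset_add fs.scale_right_distrib)
    show "(a \<otimes>\<^bsub>coeff_ring\<^esub> b) \<odot>\<^bsub>?Q\<^esub> x = a \<odot>\<^bsub>?Q\<^esub> (b \<odot>\<^bsub>?Q\<^esub> x)" if "x \<in> carrier ?Q" for a b x
      using that by (elim carrier_quot_modE) (simp add: coset_smult coeff_ring_def)
    show "\<one>\<^bsub>coeff_ring\<^esub> \<odot>\<^bsub>?Q\<^esub> x = x" if "x \<in> carrier ?Q" for x
      using that by (elim carrier_quot_modE) (simp add: coset_add_span coeff_ring_def)
  qed
qed

text \<open>A formula \<open>F\<close> with many admissible values induces a map once these values
  agree modulo \<open>N\<close> and one choice \<open>f\<close> of them kills the relations; the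
  union of cosets in \<open>induced\<close> then collapses to a single one.\<close>

lemma induced_coset:
  fixes R :: "('s \<Rightarrow>\<^sub>0 'k::comm_ring_1) set"
  assumes v: "supp v \<subseteq> G"
    and R: "\<And>r. r \<in> R \<Longrightarrow> supp r \<subseteq> G"
    and f: "\<And>s. s \<in> G \<Longrightarrow> f s \<in> F s"
    and F: "\<And>s y. s \<in> G \<Longrightarrow> y \<in> F s \<Longrightarrow> y \<approx>[N] f s"
    and ker: "\<And>r. r \<in> R \<Longrightarrow> flin f r \<approx>[N] 0"
  shows "induced (fspan N) F (v +o fspan R) = flin f v +o fspan N"
proof (intro equalityI subsetI)
  fix x assume "x \<in> induced (fspan N) F (v +o fspan R)"
  then obtain h w m where x: "x = flin h w + m" and w: "w \<approx>[R] v" and m: "m \<approx>[N] 0"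
    and h: "\<forall>s\<in>supp w. h s \<in> F s"
    unfolding induced_def by (auto simp: mem_coset_iff eqmod_zero_iff)
  \<comment> \<open>Another representative \<open>w\<close> of the coset differs from
    \<open>v\<close> by relations, so it still lives on \<open>G\<close>, the only place where the
    values in \<open>F\<close> are controlled.\<close>
  have "supp (w - v) \<subseteq> G"
    using keys_fspan[OF R, where q = "w - v"] w by (simp add: eqmod_def)
  then have "supp w \<subseteq> G"
    using keys_add[of "w - v" v] v by auto
  then have "flin h w \<approx>[N] flin f w"
    using F h by (intro eqmod_flin) auto
  also have "\<dots> \<approx>[N] flin f v"
    using ker w by (rule eqmod_flin_arg)
  finally show "x \<in> flin f v +o fspan N"
    using eqmod_add[OF _ m] by (fastforce simp: x mem_coset_iff)
next
  fix x assume "x \<in> flin f v +o fspan N"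
  then have "x - flin f v \<in> fspan N" and "x = flin f v + (x - flin f v)"
    by (simp_all add: mem_coset_iff eqmod_def)
  moreover have "v \<in> v +o fspan R"
    by (simp add: mem_coset_iff)
  moreover have "\<forall>s\<in>supp v. f s \<in> F s"
    using f v by blast
  ultimately show "x \<in> induced (fspan N) F (v +o fspan R)"
    unfolding induced_def by blast
qed

lemma module_maps_quot_mod:
  assumes h: "\<And>v. supp v \<subseteq> G \<Longrightarrow> h (v +o fspan R) = flin f v +o fspan N"
    and f: "\<And>s. s \<in> G \<Longrightarrow> supp (f s) \<subseteq> G'"
  shows "h \<in> module_maps (quot_mod G (fspan R)) (quot_mod G' (fspan N))"
proof -
  have h_in: "h A \<in> carrier (quot_mod G' (fspan N))" if "A \<in> carrier (quot_mod G (fspan R))" for A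
    using carrier_quot_modE[OF that] f by (metis coset_in_carrier h keys_flin_subset subsetD)
  have h_add: "h (A + B) = h A + h B"
    if AB: "A \<in> carrier (quot_mod G (fspan R))" "B \<in> carrier (quot_mod G (fspan R))" for A B
  proof -
    obtain v w where "A = v +o fspan R" "B = w +o fspan R"
      and vw: "supp v \<subseteq> G" "supp w \<subseteq> G"
      using AB by (elim carrier_quot_modE)
    moreover have "supp (v + w) \<subseteq> G"
      using vw keys_add[of v w] by blast
    ultimately show ?thesis
      by (simp add: coset_add h fs.lext_add)
  qed
  have h_scale: "h (fsmult k ` A + fspan R) = fsmult k ` h A + fspan N"
    if A: "A \<in> carrier (quot_mod G (fspan R))" for k A
  proof -
    obtain v where "A = v +o fspan R" and v: "supp v \<subseteq> G"
      using A by (elim carrier_quot_modE)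
    moreover have "supp (fsmult k v) \<subseteq> G"
      using v keys_fsmult[of k v] by blast
    ultimately show ?thesis
      by (simp add: coset_smult h fs.lext_fsmult)
  qed
  show ?thesis
    unfolding module_maps_def using h_in h_add h_scale by auto
qed

lemma flin_flin_eqmod:
  assumes "\<And>s. s \<in> G \<Longrightarrow> flin f (g s) \<approx>[N] flin f' (g' s)" "supp v \<subseteq> G"
  shows "flin f (flin g v) \<approx>[N] flin f' (flin g' v)"
  unfolding fs.lext_flin using assms by (intro eqmod_flin) auto

lemma flin_flin_eqmod_id:
  assumes "\<And>s. s \<in> G \<Longrightarrow> flin f (g s) \<approx>[N] gen s" "supp v \<subseteq> G"
  shows "flin f (flin g v) \<approx>[N] v"
proof -
  have "flin f (flin g v) \<approx>[N] flin gen v"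
    unfolding fs.lext_flin using assms by (intro eqmod_flin) auto
  then show ?thesis
    by (simp add: flin_gen_id)
qed

text \<open>Well-definedness of the structure maps is contained in \<open>D\<close>,
  \<open>S\<close> and \<open>W\<close>. All else is additive, so that the para-cyclic identities
  need only be tested on single generators.\<close>

lemma para_cyclic_module_presented:
  fixes G :: "nat \<Rightarrow> 's set" and R :: "nat \<Rightarrow> ('s \<Rightarrow>\<^sub>0 'k::comm_ring_1) set"
  assumes D: "\<And>n k v. k \<le> Suc n \<Longrightarrow> supp v \<subseteq> G (Suc n) \<Longrightarrow>
      D (Suc n) k (v +o fspan (R (Suc n))) = flin (dg (Suc n) k) v +o fspan (R n)"
    and S: "\<And>n k v. k \<le> n \<Longrightarrow> supp v \<subseteq> G n \<Longrightarrow>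
      S n k (v +o fspan (R n)) = flin (sg n k) v +o fspan (R (Suc n))"
    and W: "\<And>n v. supp v \<subseteq> G n \<Longrightarrow> W n (v +o fspan (R n)) = flin (wg n) v +o fspan (R n)"
    and dk: "\<And>n k s. k \<le> Suc n \<Longrightarrow> s \<in> G (Suc n) \<Longrightarrow> supp (dg (Suc n) k s) \<subseteq> G n"
    and sk: "\<And>n k s. k \<le> n \<Longrightarrow> s \<in> G n \<Longrightarrow> supp (sg n k s) \<subseteq> G (Suc n)"
    and wk: "\<And>n s. s \<in> G n \<Longrightarrow> supp (wg n s) \<subseteq> G n"
    and dd: "\<And>n i j s. i < j \<Longrightarrow> j \<le> n + 2 \<Longrightarrow> s \<in> G (Suc (Suc n)) \<Longrightarrow>
      flin (dg (Suc n) i) (dg (Suc (Suc n)) j s) \<approx>[R n] flin (dg (Suc n) (j - 1)) (dg (Suc (Suc n)) i s)"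
    and ss: "\<And>n i j s. i \<le> j \<Longrightarrow> j \<le> n \<Longrightarrow> s \<in> G n \<Longrightarrow>
      flin (sg (Suc n) i) (sg n j s) \<approx>[R (Suc (Suc n))] flin (sg (Suc n) (Suc j)) (sg n i s)"
    and ds_less: "\<And>n i j s. i < j \<Longrightarrow> j \<le> n + 1 \<Longrightarrow> s \<in> G (Suc n) \<Longrightarrow>
      flin (dg (Suc (Suc n)) i) (sg (Suc n) j s) \<approx>[R (Suc n)] flin (sg n (j - 1)) (dg (Suc n) i s)"
    and ds_same: "\<And>n j s. j \<le> n \<Longrightarrow> s \<in> G n \<Longrightarrow> flin (dg (Suc n) j) (sg n j s) \<approx>[R n] gen s"
    and ds_next: "\<And>n j s. j \<le> n \<Longrightarrow> s \<in> G n \<Longrightarrow> flin (dg (Suc n) (Suc j)) (sg n j s) \<approx>[R n] gen s"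
    and ds_greater: "\<And>n i j s. j + 1 < i \<Longrightarrow> i \<le> n + 2 \<Longrightarrow> s \<in> G (Suc n) \<Longrightarrow>
      flin (dg (Suc (Suc n)) i) (sg (Suc n) j s) \<approx>[R (Suc n)] flin (sg n j) (dg (Suc n) (i - 1) s)"
    and dw0: "\<And>n s. s \<in> G (Suc n) \<Longrightarrow>
      flin (dg (Suc n) 0) (wg (Suc n) s) \<approx>[R n] dg (Suc n) (Suc n) s"
    and dw: "\<And>n k s. k \<le> n \<Longrightarrow> s \<in> G (Suc n) \<Longrightarrow>
      flin (dg (Suc n) (Suc k)) (wg (Suc n) s) \<approx>[R n] flin (wg n) (dg (Suc n) k s)"
    and sw0: "\<And>n s. s \<in> G n \<Longrightarrow>
      flin (sg n 0) (wg n s) \<approx>[R (Suc n)] flin (wg (Suc n)) (flin (wg (Suc n)) (sg n n s))"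
    and sw: "\<And>n k s. Suc k \<le> n \<Longrightarrow> s \<in> G n \<Longrightarrow>
      flin (sg n (Suc k)) (wg n s) \<approx>[R (Suc n)] flin (wg (Suc n)) (sg n k s)"
  shows "para_cyclic_module (\<lambda>n. quot_mod (G n) (fspan (R n))) D S W"
proof -
  have dkf: "supp (flin (dg (Suc n) k) v) \<subseteq> G n"
    if "k \<le> Suc n" "supp v \<subseteq> G (Suc n)" for n k v
    using that by (intro keys_flin_subset dk) auto
  have skf: "supp (flin (sg n k) v) \<subseteq> G (Suc n)"
    if "k \<le> n" "supp v \<subseteq> G n" for n k v
    using that by (intro keys_flin_subset sk) auto
  have wkf: "supp (flin (wg n) v) \<subseteq> G n"
    if "supp v \<subseteq> G n" for n v
    using that by (intro keys_flin_subset wk) auto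
  note maps = D S W dkf skf wkf coset_eq_iff
  show ?thesis
  proof (intro para_cyclic_module.intro simplicial_module.intro para_cyclic_module_axioms.intro, goal_cases)
    case (1 n) show ?case by (rule module_quot_mod)
  next
    case (2 k n) then show ?case by (intro module_maps_quot_mod[where f = "dg (Suc n) k"] D dk)
  next
    case (3 k n) then show ?case by (intro module_maps_quot_mod[where f = "sg n k"] S sk)
  next
    case (4 i j n z)
    from carrier_quot_modE[OF 4(3)] obtain v where "z = v +o fspan (R (n + 2))" "supp v \<subseteq> G (n + 2)" .
    with 4 show ?case
      by (simp add: maps) (rule flin_flin_eqmod[OF dd[unfolded One_nat_def]], auto)
  next
    case (5 i j n z)
    from carrier_quot_modE[OF 5(3)] obtain v where "z = v +o fspan (R n)" "supp v \<subseteq> G n" .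
    with 5 show ?case
      by (simp add: maps) (rule flin_flin_eqmod[OF ss], auto)
  next
    case (6 i j n z)
    from carrier_quot_modE[OF 6(3)] obtain v where "z = v +o fspan (R (n + 1))" "supp v \<subseteq> G (n + 1)" .
    with 6 show ?case
      by (simp add: maps) (rule flin_flin_eqmod[OF ds_less[unfolded One_nat_def]], auto)
  next
    case (7 j n z)
    from carrier_quot_modE[OF 7(2)] obtain v where "z = v +o fspan (R n)" "supp v \<subseteq> G n" .
    with 7 show ?case
      by (simp add: maps) (rule flin_flin_eqmod_id[OF ds_same], auto)
  next
    case (8 j n z)
    from carrier_quot_modE[OF 8(2)] obtain v where "z = v +o fspan (R n)" "supp v \<subseteq> G n" .
    with 8 show ?case
      by (simp add: maps) (rule flin_flin_eqmod_id[OF ds_next], auto)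
  next
    case (9 j i n z)
    from carrier_quot_modE[OF 9(3)] obtain v where "z = v +o fspan (R (n + 1))" "supp v \<subseteq> G (n + 1)" .
    with 9 show ?case
      by (simp add: maps) (rule flin_flin_eqmod[OF ds_greater[unfolded One_nat_def]], auto)
  next
    case (10 n) show ?case by (intro module_maps_quot_mod[where f = "wg n"] W wk)
  next
    case (11 n z)
    then obtain m where n: "n = Suc m" by (cases n) auto
    from carrier_quot_modE[OF 11(2)] obtain v where v: "z = v +o fspan (R n)" "supp v \<subseteq> G n" .
    have "flin (dg (Suc m) 0) (flin (wg (Suc m)) v) \<approx>[R m] flin (dg (Suc m) (Suc m)) v"
      unfolding fs.lext_flin using v n dw0 by (intro eqmod_flin) auto
    with v n show ?case
      by (simp add: maps)
  next
    case (12 k n z)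
    then obtain m j where n: "n = Suc m" "k = Suc j" by (cases n; cases k) auto
    from carrier_quot_modE[OF 12(3)] obtain v where "z = v +o fspan (R n)" "supp v \<subseteq> G n" .
    with 12 n show ?case
      by (simp add: maps) (rule flin_flin_eqmod[OF dw], auto)
  next
    case (13 z n)
    from carrier_quot_modE[OF 13(1)] obtain v where v: "z = v +o fspan (R n)" "supp v \<subseteq> G n" .
    \<comment> \<open>Three maps are composed on the right; the inner two are merged into one map on
      generators, so that \<open>flin_flin_eqmod\<close> applies to a composite of two.\<close>
    have "flin (sg n 0) (flin (wg n) v)
        \<approx>[R (Suc n)] flin (wg (Suc n)) (flin (\<lambda>s. flin (wg (Suc n)) (sg n n s)) v)"
      using v sw0 by (intro flin_flin_eqmod[where G = "G n"]) auto
    then have "flin (sg n 0) (flin (wg n) v)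
        \<approx>[R (Suc n)] flin (wg (Suc n)) (flin (wg (Suc n)) (flin (sg n n) v))"
      by (simp only: fs.lext_flin)
    with v show ?case
      by (simp add: maps)
  next
    case (14 k n z)
    then obtain m j where n: "n = Suc m" "k = Suc j" by (cases n; cases k) auto
    from carrier_quot_modE[OF 14(3)] obtain v where "z = v +o fspan (R n)" "supp v \<subseteq> G n" .
    with 14 n show ?case
      by (simp add: maps) (rule flin_flin_eqmod[OF sw], auto)
  qed
qed

lemma induced_memI:
  assumes "v \<in> A" "\<And>s. s \<in> supp v \<Longrightarrow> f s \<in> F s"
  shows "flin f v \<in> induced (fspan N) F A"
  unfolding induced_def mem_Collect_eq
  by (rule exI[of _ f], rule exI[of _ v], rule exI[of _ 0]) (simp add: assms fs.span_zero)

lemma induced_memE: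
  assumes "y \<in> induced (fspan N) F A"
  obtains f v x where "y = flin f v + x" "v \<in> A" "x \<approx>[N] 0" "\<forall>s\<in>supp v. f s \<in> F s"
  using assms unfolding induced_def mem_Collect_eq eqmod_zero_iff[symmetric] by metis

section \<open>Sweedler calculus in a coring\<close>

context coring
begin

text \<open>
  Sweedler sums are evaluated on a fixed representative of the coproduct. Up to congruence modulo
  \<open>N\<close>, the value \<open>sweedler m f\<close> is independent of it only for \<open>f\<close> balanced modulo \<open>N\<close> (\<open>bil N f\<close> below).
\<close>

definition coprod_rep :: "'m \<Rightarrow> ('m list \<Rightarrow>\<^sub>0 'k)" where
  "coprod_rep m = (SOME p. p \<in> \<Delta> m)"

abbreviation rels where "rels n \<equiv> tpow_rels sc lact ract n"

abbreviation tensor where "tensor N n f \<equiv> tens N sc lact ract n f"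

lemma coprod_coset: "\<Delta> m = coprod_rep m +o fspan (rels 2)" and keys_coprod_rep: "supp (coprod_rep m) \<subseteq> {ms. length ms = 2}"
proof -
  obtain p where p: "\<Delta> m = p +o fspan (rels 2)" "supp p \<subseteq> {ms. length ms = 2}"
    using carrier_quot_modE[OF coprod_closed[of m, unfolded tpow_def]] .
  then have "\<exists>p. p \<in> \<Delta> m"
    by (auto simp: mem_coset_iff intro: eqmod_refl)
  then have coprod_rep: "coprod_rep m \<in> \<Delta> m"
    unfolding coprod_rep_def by (rule someI_ex)
  then have "coprod_rep m \<approx>[rels 2] p"
    by (simp add: p mem_coset_iff)
  then show "\<Delta> m = coprod_rep m +o fspan (rels 2)"
    by (simp add: p coset_eq_iff eqmod_sym)
  have "supp (coprod_rep m - p) \<subseteq> {ms. length ms = 2}"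
    using \<open>coprod_rep m \<approx>[rels 2] p\<close> keys_fspan[of "rels 2", OF keys_tpow_rels] by (simp add: eqmod_def)
  with p show "supp (coprod_rep m) \<subseteq> {ms. length ms = 2}"
    using keys_add[of "coprod_rep m - p" p] by auto
qed

lemma coprod_rep_in: "coprod_rep m \<in> \<Delta> m"
  by (simp add: coprod_coset mem_coset_iff)

lemma in_coprod: "p \<in> \<Delta> m \<longleftrightarrow> p \<approx>[rels 2] coprod_rep m"
  by (simp add: coprod_coset mem_coset_iff)

lemma keys_coprod:
  assumes "p \<in> \<Delta> m"
  shows "supp p \<subseteq> {ms. length ms = 2}"
proof -
  have "supp (p - coprod_rep m) \<subseteq> {ms. length ms = 2}"
    using assms keys_fspan[of "rels 2", OF keys_tpow_rels] by (simp add: in_coprod eqmod_def)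
  then show ?thesis
    using keys_add[of "p - coprod_rep m" "coprod_rep m"] keys_coprod_rep[of m] by auto
qed

definition sweedler :: "'m \<Rightarrow> ('m \<Rightarrow> 'm \<Rightarrow> ('t \<Rightarrow>\<^sub>0 'k)) \<Rightarrow> ('t \<Rightarrow>\<^sub>0 'k)" where
  "sweedler m f = flin (\<lambda>ms. f (ms ! 0) (ms ! 1)) (coprod_rep m)"

definition bil :: "('t \<Rightarrow>\<^sub>0 'k) set \<Rightarrow> ('m \<Rightarrow> 'm \<Rightarrow> ('t \<Rightarrow>\<^sub>0 'k)) \<Rightarrow> bool" where
  "bil N f \<longleftrightarrow> (\<forall>v. linmod N sc (\<lambda>u. f u v)) \<and> (\<forall>u. linmod N sc (f u))
     \<and> (\<forall>u v r. f (ract u r) v \<approx>[N] f u (lact r v))"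

lemma bilI:
  "(\<And>v. linmod N sc (\<lambda>u. f u v)) \<Longrightarrow> (\<And>u. linmod N sc (f u))
     \<Longrightarrow> (\<And>u v r. f (ract u r) v \<approx>[N] f u (lact r v)) \<Longrightarrow> bil N f"
  by (simp add: bil_def)

lemma bil_tensor: "bil N f \<longleftrightarrow> tensor N 2 (\<lambda>ms. f (ms ! 0) (ms ! 1))"
  by (auto simp: bil_def tens_2)

lemma sweedler_eqI:
  assumes "bil N f" "p \<in> \<Delta> m"
  shows "flin (\<lambda>ms. f (ms ! 0) (ms ! 1)) p \<approx>[N] sweedler m f"
  using assms unfolding bil_tensor in_coprod sweedler_def by (rule tens_eqmod)

lemma sweedler_cong: "(\<And>u v. f u v \<approx>[N] g u v) \<Longrightarrow> sweedler m f \<approx>[N] sweedler m g"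
  unfolding sweedler_def by (rule eqmod_flin)

lemma flin_sweedler: "flin F (sweedler m g) = sweedler m (\<lambda>u v. flin F (g u v))"
  by (simp add: sweedler_def fs.lext_flin)

lemma sweedler_lact:
  assumes "bil N f"
  shows "sweedler (lact r m) f \<approx>[N] sweedler m (\<lambda>u v. f (lact r u) v)"
  using sweedler_eqI[OF assms coprod_lact[OF coprod_rep_in]]
  by - (rule eqmod_sym, simp add: sweedler_def fs.lext_flin)

lemma sweedler_ract:
  assumes "bil N f"
  shows "sweedler (ract m r) f \<approx>[N] sweedler m (\<lambda>u v. f u (ract v r))"
  using sweedler_eqI[OF assms coprod_ract[OF coprod_rep_in]]
  by - (rule eqmod_sym, simp add: sweedler_def fs.lext_flin)

lemma linmod_sweedler_arg:
  assumes f: "bil N f"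
  shows "linmod N sc (\<lambda>m. sweedler m f)"
proof (rule linmodI)
  fix a b
  have "coprod_rep a + coprod_rep b \<in> \<Delta> (a + b)"
    by (simp add: coprod_add coprod_rep_in set_plus_intro)
  from sweedler_eqI[OF f this] show "sweedler (a + b) f \<approx>[N] sweedler a f + sweedler b f"
    by - (rule eqmod_sym, simp add: sweedler_def fs.lext_add)
next
  fix k a
  \<comment> \<open>Scaling by \<open>k\<close> is the action of the scalar \<open>scR k 1\<close>
    of \<open>R\<close>, so linearity of the coproduct over the ground ring is a case of its left
    linearity over \<open>R\<close>.\<close>
  have sc: "sc k m = lact (scR k 1) m" for m
    by (simp add: left.lact_sc_left left.lact_one)
  have "sweedler (sc k a) f \<approx>[N] sweedler a (\<lambda>u v. f (sc k u) v)"
    unfolding sc by (rule sweedler_lact[OF f])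
  also have "\<dots> \<approx>[N] sweedler a (\<lambda>u v. fsmult k (f u v))"
    using f by (intro sweedler_cong linmod_scale) (simp add: bil_def)
  finally show "sweedler (sc k a) f \<approx>[N] fsmult k (sweedler a f)"
    by (simp add: sweedler_def fs.lext_fun_scale)
qed

lemma linmod_sweedler:
  "(\<And>u v. linmod N sc' (\<lambda>x. f x u v)) \<Longrightarrow> linmod N sc' (\<lambda>x. sweedler m (f x))"
  unfolding sweedler_def by (rule linmod_flin)

lemma counit_sc: "\<epsilon> (sc k m) = scR k (\<epsilon> m)"
  using counit_lact[of "scR k 1" m]
  by (simp add: left.lact_sc_left left.lact_one left.A.sc_mult_left)

lemma sweedler_counit_left:
  assumes "linmod N sc h"
  shows "sweedler m (\<lambda>u v. h (lact (\<epsilon> u) v)) \<approx>[N] h m"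
  using linmod_lext[OF assms, of "\<lambda>ms. lact (\<epsilon> (ms ! 0)) (ms ! 1)" "coprod_rep m"]
  by - (rule eqmod_sym, simp add: sweedler_def counit_left[OF coprod_rep_in] del: One_nat_def)

lemma sweedler_counit_right:
  assumes "linmod N sc h"
  shows "sweedler m (\<lambda>u v. h (ract u (\<epsilon> v))) \<approx>[N] h m"
  using linmod_lext[OF assms, of "\<lambda>ms. ract (ms ! 0) (\<epsilon> (ms ! 1))" "coprod_rep m"]
  by - (rule eqmod_sym, simp add: sweedler_def counit_right[OF coprod_rep_in] del: One_nat_def)

lemma flin_list2:
  assumes "supp p \<subseteq> {ms. length ms = 2}"
  shows "flin F p = flin (\<lambda>ms. F [ms ! 0, ms ! 1]) p"
proof (rule lext_cong)
  fix s assume "s \<in> supp p"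
  then have "length s = 2" using assms by auto
  then have "s = [s ! 0, s ! 1]"
    by (auto simp: numeral_2_eq_2 length_Suc_conv)
  then show "F s = F [s ! 0, s ! 1]" by simp
qed

definition tril :: "('t \<Rightarrow>\<^sub>0 'k) set \<Rightarrow> ('m \<Rightarrow> 'm \<Rightarrow> 'm \<Rightarrow> ('t \<Rightarrow>\<^sub>0 'k)) \<Rightarrow> bool" where
  "tril N f \<longleftrightarrow> (\<forall>v w. linmod N sc (\<lambda>u. f u v w)) \<and> (\<forall>u w. linmod N sc (\<lambda>v. f u v w))
     \<and> (\<forall>u v. linmod N sc (f u v))
     \<and> (\<forall>u v w r. f (ract u r) v w \<approx>[N] f u (lact r v) w)
     \<and> (\<forall>u v w r. f u (ract v r) w \<approx>[N] f u v (lact r w))"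

lemma trilI:
  assumes "\<And>v w. linmod N sc (\<lambda>u. f u v w)" "\<And>u w. linmod N sc (\<lambda>v. f u v w)"
    "\<And>u v. linmod N sc (f u v)"
    "\<And>u v w r. f (ract u r) v w \<approx>[N] f u (lact r v) w"
    "\<And>u v w r. f u (ract v r) w \<approx>[N] f u v (lact r w)"
  shows "tril N f"
  using assms by (simp add: tril_def)

lemma tril_bil_right: "tril N f \<Longrightarrow> bil N (f u)"
  by (simp add: tril_def bil_def)

lemma bil_sweedler_right:
  assumes "tril N f"
  shows "bil N (\<lambda>u v. sweedler v (f u))"
proof (rule bilI)
  show "linmod N sc (\<lambda>u. sweedler v (f u))" for v
    using assms by (intro linmod_sweedler) (simp add: tril_def)
  show "linmod N sc (\<lambda>v. sweedler v (f u))" for u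
    using assms by (intro linmod_sweedler_arg tril_bil_right)
  fix u v r
  have "sweedler v (f (ract u r)) \<approx>[N] sweedler v (\<lambda>p q. f u (lact r p) q)"
    using assms by (intro sweedler_cong) (simp add: tril_def)
  also have "\<dots> \<approx>[N] sweedler (lact r v) (f u)"
    using assms by (intro eqmod_sym[OF sweedler_lact] tril_bil_right)
  finally show "sweedler v (f (ract u r)) \<approx>[N] sweedler (lact r v) (f u)" .
qed

text \<open>The axiom \<open>coassoc\<close> equates two sets of formal sums. A member of the left
  set, built from the fixed representatives, is recognized as a member of the right set, built from
  unknown ones; balancedness of \<open>f\<close> in all three slots removes that ambiguity.\<close>

lemma sweedler_coassoc:
  assumes f: "tril N f"
  shows "sweedler m (\<lambda>u v. sweedler u (\<lambda>p q. f p q v)) \<approx>[N] sweedler m (\<lambda>u v. sweedler v (f u))"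
proof -
  let ?F = "\<lambda>ms. f (ms ! 0) (ms ! 1) (ms ! 2)"
  let ?s = "\<lambda>ms. flin (\<lambda>ds. gen (take 0 ms @ ds @ drop (Suc 0) ms)) (coprod_rep (ms ! 0)) :: 'm list \<Rightarrow>\<^sub>0 'k"
  have F: "tensor N 3 ?F"
    using f by (simp add: tens_3 tril_def)
  have s: "flin ?F (?s ms) = sweedler (ms ! 0) (\<lambda>p q. f p q (ms ! 1))" if len: "length ms = 2" for ms
  proof -
    obtain x y where "ms = [x, y]"
      using len by (auto simp: numeral_2_eq_2 length_Suc_conv)
    then show ?thesis
      by (subst fs.lext_flin, subst flin_list2[OF keys_coprod_rep])
        (simp add: sweedler_def numeral_2_eq_2)
  qed
  \<comment> \<open>The member to be followed from one side of the axiom to the other.\<close>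
  have "flin ?s (coprod_rep m) \<in> induced (fspan (rels 3)) (split_at \<Delta> 0) (\<Delta> m)"
    by (rule induced_memI[OF coprod_rep_in]) (unfold split_at_def, intro imageI coprod_rep_in)
  then have "flin ?s (coprod_rep m) \<in> induced (fspan (rels 3)) (split_at \<Delta> 1) (\<Delta> m)"
    by (simp add: coassoc)
  then obtain h w x where eq: "flin ?s (coprod_rep m) = flin h w + x" and w: "w \<in> \<Delta> m" and x: "x \<approx>[rels 3] 0"
    and h: "\<forall>s\<in>supp w. h s \<in> split_at \<Delta> 1 s"
    by (rule induced_memE)
  have hs: "flin ?F (h ms) \<approx>[N] sweedler (ms ! 1) (f (ms ! 0))" if ms: "ms \<in> supp w" for ms
  proof -
    have len: "length ms = 2" using keys_coprod[OF w] ms by auto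
    obtain d where d: "d \<in> \<Delta> (ms ! 1)" "h ms = flin (\<lambda>ds. gen (take 1 ms @ ds @ drop (Suc 1) ms)) d"
      using h ms by (auto simp: split_at_def)
    have "take (Suc 0) ms = [ms ! 0]"
      using len by (auto simp: numeral_2_eq_2 length_Suc_conv)
    then have "flin ?F (h ms) = flin (\<lambda>ds. f (ms ! 0) (ds ! 0) (ds ! 1)) d"
      unfolding d(2) using len
      by (subst fs.lext_flin, subst flin_list2[OF keys_coprod[OF d(1)]]) (simp add: numeral_2_eq_2)
    also have "\<dots> \<approx>[N] sweedler (ms ! 1) (f (ms ! 0))"
      using f d(1) by (intro sweedler_eqI tril_bil_right)
    finally show ?thesis .
  qed
  have "sweedler m (\<lambda>u v. sweedler u (\<lambda>p q. f p q v)) = flin ?F (flin ?s (coprod_rep m))"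
    unfolding sweedler_def[of m]
    by (subst fs.lext_flin, rule lext_cong, rule s[symmetric]) (use keys_coprod_rep[of m] in auto)
  also have "\<dots> = flin ?F (flin h w) + flin ?F x"
    unfolding eq by (rule fs.lext_add)
  also have "\<dots> \<approx>[N] flin ?F (flin h w) + 0"
    using tens_eqmod[OF F x] by (intro eqmod_add) auto
  also have "\<dots> \<approx>[N] flin (\<lambda>ms. sweedler (ms ! 1) (f (ms ! 0))) w"
    unfolding fs.lext_flin using hs by (simp add: eqmod_flin)
  also have "\<dots> \<approx>[N] sweedler m (\<lambda>u v. sweedler v (f u))"
    using bil_sweedler_right[OF f] w by (rule sweedler_eqI)
  finally show ?thesis .
qed

end

section \<open>Sweedler calculus in a bialgebroid: coproducts of scalars, the Takeuchi condition and
  the counit\<close>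

context k_algebra
begin

lemma linmod_mult_left: "linmod N sc g \<Longrightarrow> linmod N sc (\<lambda>b. g (a * b))"
  by (rule linmod_comp[where sc = sc]) (auto simp: distrib_left sc_mult_right)

lemma linmod_mult_right: "linmod N sc g \<Longrightarrow> linmod N sc (\<lambda>b. g (b * a))"
  by (rule linmod_comp[where sc = sc]) (auto simp: distrib_right sc_mult_left)

end

context right_bialgebroid
begin

lemma sweedler_one:
  assumes "bil N f"
  shows "sweedler 1 f \<approx>[N] f 1 1"
  using sweedler_eqI[OF assms coprod_one] by - (rule eqmod_sym, simp)

text \<open>Since \<open>\<zeta> r = 1 * \<zeta> r\<close> is the left action of \<open>r\<close> on
  the unit, left linearity of the coproduct leaves the second leg equal to 1. For
  \<open>\<xi> r\<close> it is right linearity that leaves the first leg equal to 1.\<close>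

lemma sweedler_zeta:
  assumes "bil N f"
  shows "sweedler (\<zeta> r) f \<approx>[N] f (\<zeta> r) 1"
  using sweedler_eqI[OF assms coprod_lact[OF coprod_one, of r]] by - (rule eqmod_sym, simp)

lemma sweedler_xi:
  assumes "bil N f"
  shows "sweedler (\<xi> r) f \<approx>[N] f 1 (\<xi> r)"
  using sweedler_eqI[OF assms coprod_ract[OF coprod_one, of r]] by - (rule eqmod_sym, simp)

lemma sweedler_takeuchi:
  assumes "bil N f"
  shows "sweedler b (\<lambda>u v. f (\<xi> r * u) v) \<approx>[N] sweedler b (\<lambda>u v. f u (\<zeta> r * v))"
proof -
  have "flin (\<lambda>bs. gen [\<xi> r * bs ! 0, bs ! 1]) (coprod_rep b)
      \<approx>[rels 2] flin (\<lambda>bs. gen [bs ! 0, \<zeta> r * bs ! 1]) (coprod_rep b)"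
    using takeuchi[OF coprod_rep_in] by (simp add: eqmod_def)
  from tens_eqmod[OF assms[unfolded bil_tensor] this] show ?thesis
    by (simp add: sweedler_def fs.lext_flin)
qed

lemma counit_zeta: "\<epsilon> (\<zeta> r) = r"
  using counit_lact[where r = r and m = 1] by (simp add: counit_one)

lemma counit_zeta_mult: "\<epsilon> (\<zeta> r * b) = \<epsilon> (\<xi> r * b)"
  using counit_mult[of "\<zeta> r" b] by (simp add: counit_zeta)

text \<open>The Takeuchi condition moves \<open>\<xi> r\<close> from the first leg to the second,
  where it becomes a left factor \<open>\<zeta> r\<close>; what remains is the left counit
  axiom.\<close>

lemma sweedler_counit_left_xi:
  assumes "linmod N scB h"
  shows "sweedler b (\<lambda>u v. h (v * \<zeta> (\<epsilon> (\<xi> r * u)))) \<approx>[N] h (\<zeta> r * b)"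
proof -
  have lin: "linmod N scB (\<lambda>u. h (v * \<zeta> (\<epsilon> u)))" for v
    by (rule linmod_comp[OF assms])
      (simp_all add: counit_add zeta_add distrib_left counit_sc zeta_sc B.sc_mult_right)
  have "bil N (\<lambda>u v. h (v * \<zeta> (\<epsilon> u)))"
  proof (rule bilI)
    show "linmod N scB (\<lambda>v. h (v * \<zeta> (\<epsilon> u)))" for u
      by (rule B.linmod_mult_right[OF assms])
  qed (auto simp: lin counit_ract zeta_mult mult.assoc)
  from sweedler_takeuchi[OF this]
  have "sweedler b (\<lambda>u v. h (v * \<zeta> (\<epsilon> (\<xi> r * u)))) \<approx>[N] sweedler b (\<lambda>u v. h (\<zeta> r * (v * \<zeta> (\<epsilon> u))))"
    by (simp add: mult.assoc)
  also have "\<dots> \<approx>[N] h (\<zeta> r * b)"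
    using sweedler_counit_left[OF B.linmod_mult_left[OF assms]] .
  finally show ?thesis .
qed

text \<open>Under the counit \<open>\<xi> r\<close> and \<open>\<zeta> r\<close> agree as left
  factors, so the Takeuchi condition can be read in the opposite direction before the right counit
  axiom is applied.\<close>

lemma sweedler_counit_right_xi:
  assumes "linmod N scB h"
  shows "sweedler b (\<lambda>u v. h (u * \<xi> (\<epsilon> (\<xi> r * v)))) \<approx>[N] h (\<xi> r * b)"
proof -
  have lin: "linmod N scB (\<lambda>v. h (u * \<xi> (\<epsilon> v)))" for u
    by (rule linmod_comp[OF assms])
      (simp_all add: counit_add xi_add distrib_left counit_sc xi_sc B.sc_mult_right)
  have "bil N (\<lambda>u v. h (u * \<xi> (\<epsilon> v)))"
  proof (rule bilI)
    show "linmod N scB (\<lambda>u. h (u * \<xi> (\<epsilon> v)))" for v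
      by (rule B.linmod_mult_right[OF assms])
  qed (auto simp: lin counit_lact xi_mult mult.assoc)
  from eqmod_sym[OF sweedler_takeuchi[OF this]]
  have "sweedler b (\<lambda>u v. h (u * \<xi> (\<epsilon> (\<xi> r * v)))) \<approx>[N] sweedler b (\<lambda>u v. h (\<xi> r * (u * \<xi> (\<epsilon> v))))"
    by (simp add: mult.assoc counit_zeta_mult)
  also have "\<dots> \<approx>[N] h (\<xi> r * b)"
    using sweedler_counit_right[OF B.linmod_mult_left[OF assms]] .
  finally show ?thesis .
qed

end

section \<open>Coproduct and counit applied in one slot of a tensor power\<close>

lemma tens_flin:
  fixes f :: "'s \<Rightarrow> 'm::ab_group_add list \<Rightarrow> ('t \<Rightarrow>\<^sub>0 'k::comm_ring_1)"
  assumes "\<And>s. s \<in> supp p \<Longrightarrow> tens N sc lact ract n (f s)"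
  shows "tens N sc lact ract n (\<lambda>l. flin (\<lambda>s. f s l) p)"
  unfolding tens_iff
proof (intro conjI allI impI)
  fix us vs :: "'m list" assume "length us + length vs + 1 = n"
  then show "linmod N sc (\<lambda>m. flin (\<lambda>s. f s (us @ m # vs)) p)"
    using assms by (intro linmod_flin) (simp add: tens_iff)
next
  fix us vs :: "'m list" and a b r assume "length us + length vs + 2 = n"
  then show "flin (\<lambda>s. f s (us @ ract a r # b # vs)) p \<approx>[N] flin (\<lambda>s. f s (us @ a # lact r b # vs)) p"
    using assms by (intro eqmod_flin) (simp add: tens_iff)
qed

context coring
begin

text \<open>Precomposition of \<open>F\<close> with the coproduct in slot \<open>k\<close>:
  functions are pulled back, whereas \<open>split_at\<close> pushes lists forward.\<close>

definition split_fun :: "nat \<Rightarrow> ('m list \<Rightarrow> ('t \<Rightarrow>\<^sub>0 'k)) \<Rightarrow> 'm list \<Rightarrow> ('t \<Rightarrow>\<^sub>0 'k)" where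
  "split_fun k F l = sweedler (l ! k) (\<lambda>u v. F (take k l @ u # v # drop (Suc k) l))"

definition absorb :: "nat \<Rightarrow> 'm list \<Rightarrow> 'm list" where
  "absorb k l = take k l @ lact (\<epsilon> (l ! k)) (l ! Suc k) # drop (Suc (Suc k)) l"

lemma split_fun_0: "split_fun 0 F (m # l) = sweedler m (\<lambda>u v. F (u # v # l))"
  by (simp add: split_fun_def)

lemma split_fun_Suc: "split_fun (Suc k) F (m # l) = split_fun k (\<lambda>l. F (m # l)) l"
  by (simp add: split_fun_def)

lemma absorb_0: "absorb 0 (a # b # l) = lact (\<epsilon> a) b # l"
  by (simp add: absorb_def)

lemma absorb_Suc: "absorb (Suc k) (m # l) = m # absorb k l"
  by (simp add: absorb_def)

lemma tensor_bil:
  assumes "tensor N (Suc (Suc n)) F" "length l = n"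
  shows "bil N (\<lambda>u v. F (u # v # l))"
proof (cases n)
  case 0
  then show ?thesis using assms by (simp add: bil_def tens_Suc_Suc tens_Suc_0)
next
  case (Suc n')
  then show ?thesis using assms by (simp add: bil_def tens_Suc_Suc)
qed

lemma tensor_sweedler:
  "(\<And>u v. tensor N n (f u v)) \<Longrightarrow> tensor N n (\<lambda>l. sweedler m (\<lambda>u v. f u v l))"
  unfolding sweedler_def by (rule tens_flin)

lemma tensor_split_fun_0:
  assumes "tensor N (Suc (Suc n)) F"
  shows "tensor N (Suc n) (split_fun 0 F)"
proof (cases n)
  case 0
  then show ?thesis
    using linmod_sweedler_arg[OF tensor_bil[OF assms, of "[]"]] by (simp add: tens_Suc_0 split_fun_0)
next
  case (Suc n')
  have "split_fun 0 F (ract a r # b # l) \<approx>[N] split_fun 0 F (a # lact r b # l)" if l: "length l = n'" for a b r l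
  proof -
    have "split_fun 0 F (ract a r # b # l) \<approx>[N] sweedler a (\<lambda>u v. F (u # ract v r # b # l))"
      unfolding split_fun_0 using l Suc by (intro sweedler_ract tensor_bil[OF assms]) simp
    also have "\<dots> \<approx>[N] sweedler a (\<lambda>u v. F (u # v # lact r b # l))"
      using assms l Suc by (intro sweedler_cong) (simp add: tens_Suc_Suc)
    finally show ?thesis by (simp add: split_fun_0)
  qed
  moreover have "linmod N sc (\<lambda>m. split_fun 0 F (m # l))" if "length l = n" for l
    using linmod_sweedler_arg[OF tensor_bil[OF assms that]] by (simp add: split_fun_0)
  moreover have "tensor N n (\<lambda>l. split_fun 0 F (m # l))" for m
    unfolding split_fun_0 using assms Suc by (intro tensor_sweedler) (simp add: tens_Suc_Suc)
  ultimately show ?thesis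
    by (simp add: Suc tens_Suc_Suc)
qed

text \<open>At the boundary to the left of the split entry, balance is left linearity of the
  coproduct; at the boundary to its right it is right linearity, treated in
  \<open>tensor_split_fun_0\<close>. Elsewhere the relations are those of \<open>F\<close>.\<close>

lemma tensor_split_fun:
  assumes "tensor N (Suc (Suc n)) F" "k \<le> n"
  shows "tensor N (Suc n) (split_fun k F)"
  using assms
proof (induction k arbitrary: n F)
  case 0
  then show ?case by (simp add: tensor_split_fun_0)
next
  case (Suc k)
  then obtain n' where n: "n = Suc n'" by (cases n) auto
  have F: "tensor N (Suc (Suc n')) (\<lambda>l. F (m # l))" for m
    using Suc.prems(1) by (simp add: n tens_Suc_Suc)
  have "linmod N sc (\<lambda>m. split_fun (Suc k) F (m # l))" if "length l = Suc n'" for l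
    unfolding split_fun_Suc unfolding split_fun_def
    by (rule linmod_sweedler) (use that Suc.prems in \<open>simp add: n tens_Suc_Suc\<close>)
  moreover have "split_fun (Suc k) F (ract a r # b # l) \<approx>[N] split_fun (Suc k) F (a # lact r b # l)"
    if l: "length l = n'" for a b r l
  proof (cases k)
    case 0
    have "split_fun (Suc k) F (ract a r # b # l) \<approx>[N] sweedler b (\<lambda>u v. F (a # lact r u # v # l))"
      unfolding 0 split_fun_Suc split_fun_0 using Suc.prems(1) l
      by (intro sweedler_cong) (simp add: n tens_Suc_Suc)
    also have "\<dots> \<approx>[N] sweedler (lact r b) (\<lambda>u v. F (a # u # v # l))"
      by (rule eqmod_sym[OF sweedler_lact[OF tensor_bil[OF F l]]])
    finally show ?thesis
      by (simp add: 0 split_fun_Suc split_fun_0)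
  next
    case k: (Suc k')
    show ?thesis
      unfolding split_fun_Suc k unfolding split_fun_def
      using Suc.prems l k by (intro sweedler_cong) (simp add: n tens_Suc_Suc)
  qed
  moreover have "tensor N (Suc n') (\<lambda>l. split_fun (Suc k) F (m # l))" for m
    unfolding split_fun_Suc using Suc.prems(2) F by (intro Suc.IH) (simp_all add: n)
  ultimately show ?case
    by (simp add: n tens_Suc_Suc)
qed

text \<open>The left action on the first factor commutes with its right action, which is the one
  involved in the tensor sign behind it.\<close>

lemma tensor_lact_hd:
  assumes "tensor N (Suc n) F"
  shows "tensor N (Suc n) (\<lambda>l. F (lact r (hd l) # tl l))"
proof -
  have lin: "linmod N sc (\<lambda>m. f (lact r m))" if "linmod N sc f" for f
    by (rule linmod_comp[OF that]) (simp_all add: left.lact_add_right left.lact_sc_right)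
  show ?thesis
  proof (cases n)
    case 0
    then show ?thesis
      using lin[of "\<lambda>m. F [m]"] assms by (simp add: tens_Suc_0)
  next
    case (Suc n')
    have "linmod N sc (\<lambda>m. F (lact r m # l))" if "length l = Suc n'" for l
      using lin[of "\<lambda>m. F (m # l)"] assms that by (simp add: Suc tens_Suc_Suc)
    then show ?thesis
      using assms by (simp add: Suc tens_Suc_Suc lact_ract[symmetric])
  qed
qed

text \<open>Three boundaries matter: in front of the absorbed entry the counit is left linear,
  behind it the counit is right linear, and behind the entry that receives the scalar
  \<open>tensor_lact_hd\<close> applies.\<close>

lemma tensor_absorb:
  assumes "tensor N (Suc n) F" "k \<le> n"
  shows "tensor N (Suc (Suc n)) (\<lambda>l. F (absorb k l))"
  using assms
proof (induction k arbitrary: n F)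
  case 0
  have lin: "linmod N sc (\<lambda>a. f (lact (\<epsilon> a) b))" if "linmod N sc f" for f b
    by (rule linmod_comp[OF that]) (simp_all add: counit_add counit_sc left.lact_add_left left.lact_sc_left)
  have F: "linmod N sc (\<lambda>m. F (m # l))" if "length l = n" for l
    using 0 that by (cases n) (auto simp: tens_Suc_0 tens_Suc_Suc)
  have "linmod N sc (\<lambda>m. F (absorb 0 (m # l)))" if "length l = Suc n" for l
    using that lin[OF F] by (cases l) (auto simp: absorb_0)
  moreover have "tensor N (Suc n) (\<lambda>l. F (absorb 0 (m # l)))" for m
  proof (rule tens_cong[OF tensor_lact_hd[OF 0(1), of "\<epsilon> m"]])
    show "F (absorb 0 (m # l)) \<approx>[N] F (lact (\<epsilon> m) (hd l) # tl l)" if "length l = Suc n" for l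
      using that by (cases l) (auto simp: absorb_0)
  qed
  ultimately show ?case
    by (simp add: tens_Suc_Suc absorb_0 counit_ract left.lact_mult)
next
  case (Suc k)
  then obtain n' where n: "n = Suc n'" by (cases n) auto
  have F: "tensor N (Suc n') (\<lambda>l. F (m # l))" for m
    using Suc.prems(1) by (simp add: n tens_Suc_Suc)
  have "linmod N sc (\<lambda>m. F (absorb (Suc k) (m # l)))" if "length l = Suc n" for l
    unfolding absorb_Suc unfolding absorb_def using that Suc.prems by (simp add: n tens_Suc_Suc)
  moreover have "F (absorb (Suc k) (ract a r # b # l)) \<approx>[N] F (absorb (Suc k) (a # lact r b # l))"
    if l: "length l = n" for a b r l
  proof (cases k)
    case 0
    obtain c l' where "l = c # l'" using l n by (cases l) auto
    then show ?thesis
      using Suc.prems(1) l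
      by (simp add: n 0 absorb_Suc absorb_0 tens_Suc_Suc counit_lact left.lact_mult)
  next
    case k: (Suc k')
    show ?thesis
      unfolding absorb_Suc k unfolding absorb_def
      using Suc.prems l k by (simp add: n tens_Suc_Suc)
  qed
  moreover have "tensor N (Suc n) (\<lambda>l. F (absorb (Suc k) (m # l)))" for m
    unfolding absorb_Suc n using Suc.prems(2) F by (intro Suc.IH) (simp_all add: n)
  ultimately show ?case
    by (simp add: tens_Suc_Suc)
qed

end

context coring
begin

text \<open>The bridge between the set-valued \<open>split_at\<close> and the calculus with fixed
  representatives.\<close>

lemma split_at_eqmod:
  assumes "length l = Suc n" "k \<le> n" "tensor N (Suc (Suc n)) F"
    "y \<in> split_at \<Delta> k l"
  shows "flin F y \<approx>[N] split_fun k F l"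
proof -
  obtain p where p: "p \<in> \<Delta> (l ! k)" and y: "y = flin (\<lambda>ds. gen (take k l @ ds @ drop (Suc k) l)) p"
    using assms(4) by (auto simp: split_at_def)
  have "bil N (\<lambda>u v. F (take k l @ u # v # drop (Suc k) l))"
  proof (rule bilI)
    show "linmod N sc (\<lambda>u. F (take k l @ u # v # drop (Suc k) l))" for v
      using assms(1-3) by (simp add: tens_iff)
    have "linmod N sc (\<lambda>v. F ((take k l @ [u]) @ v # drop (Suc k) l))" for u
      using assms(1,2) assms(3)[unfolded tens_iff, THEN conjunct1, rule_format, of "take k l @ [u]" "drop (Suc k) l"]
      by simp
    then show "linmod N sc (\<lambda>v. F (take k l @ u # v # drop (Suc k) l))" for u
      by simp
    show "F (take k l @ ract u r # v # drop (Suc k) l) \<approx>[N] F (take k l @ u # lact r v # drop (Suc k) l)" for u v r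
      using assms(1-3) by (simp add: tens_iff)
  qed
  from sweedler_eqI[OF this p] show ?thesis
    unfolding y split_fun_def
    by (subst fs.lext_flin, subst flin_list2[OF keys_coprod[OF p]]) simp
qed

lemma split_at_memI:
  "flin (\<lambda>ds. gen (take k l @ ds @ drop (Suc k) l)) (coprod_rep (l ! k)) \<in> split_at \<Delta> k l"
  unfolding split_at_def by (rule imageI[OF coprod_rep_in])

end

section \<open>Iterated coproducts\<close>

context right_bialgebroid
begin

text \<open>Nested to the right, in contrast to \<open>iter_coprod\<close>, which keeps splitting
  the first entry. Prepending entries suits inductions along the list; the two are compared in
  \<open>iter_coprod_coset\<close>.\<close>

primrec coprods :: "nat \<Rightarrow> 'b \<Rightarrow> ('b list \<Rightarrow>\<^sub>0 'k)" where
  "coprods 0 b = gen [b]"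
| "coprods (Suc n) b = sweedler b (\<lambda>u v. flin (\<lambda>l. gen (u # l)) (coprods n v))"

lemma flin_coprods_Suc: "flin F (coprods (Suc n) b) = sweedler b (\<lambda>u v. flin (\<lambda>l. F (u # l)) (coprods n v))"
  by (simp add: flin_sweedler fs.lext_flin)

lemma keys_coprods: "supp (coprods n b) \<subseteq> {l. length l = Suc n}"
proof (induction n arbitrary: b)
  case (Suc n)
  show ?case
    unfolding coprods.simps sweedler_def
    by (intro keys_flin_subset) (use Suc in auto)
qed simp

lemma length_coprods: "l \<in> supp (coprods n b) \<Longrightarrow> length l = Suc n"
  using keys_coprods by blast

text \<open>The claims share one induction because balance of the outermost coproduct uses linearity
  and the \<open>\<zeta>\<close> rule of the shorter iterated coproduct.\<close>

lemma coprods_linear: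
  assumes "tensor N (Suc n) F"
  shows "linmod N scB (\<lambda>b. flin F (coprods n b))"
    and "flin F (coprods n (b * \<zeta> r)) \<approx>[N] flin (\<lambda>l. F (hd l * \<zeta> r # tl l)) (coprods n b)"
    and "flin F (coprods n (b * \<xi> r)) \<approx>[N] flin (\<lambda>l. F (butlast l @ [last l * \<xi> r])) (coprods n b)"
proof -
  have "linmod N scB (\<lambda>b. flin F (coprods n b))
     \<and> (\<forall>b r. flin F (coprods n (b * \<zeta> r)) \<approx>[N] flin (\<lambda>l. F (hd l * \<zeta> r # tl l)) (coprods n b))
     \<and> (\<forall>b r. flin F (coprods n (b * \<xi> r)) \<approx>[N] flin (\<lambda>l. F (butlast l @ [last l * \<xi> r])) (coprods n b))"
    using assms
  proof (induction n arbitrary: F)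
    case 0
    then show ?case by (simp add: tens_Suc_0)
  next
    case (Suc n)
    have Fu: "tensor N (Suc n) (\<lambda>l. F (u # l))" for u
      using Suc.prems by (simp add: tens_Suc_Suc)
    let ?f = "\<lambda>u v. flin (\<lambda>l. F (u # l)) (coprods n v)"
    have f: "bil N ?f"
    proof (rule bilI)
      show "linmod N scB (\<lambda>u. ?f u v)" for v
        using Suc.prems length_coprods by (intro linmod_flin) (simp add: tens_Suc_Suc)
      show "linmod N scB (?f u)" for u
        using Suc.IH[OF Fu] by blast
      fix u v r
      have "?f (u * \<xi> r) v \<approx>[N] flin (\<lambda>l. F (u # hd l * \<zeta> r # tl l)) (coprods n v)"
      proof (rule eqmod_flin)
        fix l assume "l \<in> supp (coprods n v)"
        then obtain a l' where "l = a # l'" "length l' = n"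
          using length_coprods by (metis length_Suc_conv)
        then show "F (u * \<xi> r # l) \<approx>[N] F (u # hd l * \<zeta> r # tl l)"
          using Suc.prems by (simp add: tens_Suc_Suc)
      qed
      also have "\<dots> \<approx>[N] ?f u (v * \<zeta> r)"
        using Suc.IH[OF Fu] eqmod_sym by blast
      finally show "?f (u * \<xi> r) v \<approx>[N] ?f u (v * \<zeta> r)" .
    qed
    have "flin F (coprods (Suc n) (b * \<zeta> r)) \<approx>[N] flin (\<lambda>l. F (hd l * \<zeta> r # tl l)) (coprods (Suc n) b)" for b r
      unfolding flin_coprods_Suc using sweedler_lact[OF f] by simp
    moreover have "flin F (coprods (Suc n) (b * \<xi> r))
        \<approx>[N] flin (\<lambda>l. F (butlast l @ [last l * \<xi> r])) (coprods (Suc n) b)" for b r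
    proof -
      have "flin F (coprods (Suc n) (b * \<xi> r)) \<approx>[N] sweedler b (\<lambda>u v. ?f u (v * \<xi> r))"
        unfolding flin_coprods_Suc by (rule sweedler_ract[OF f])
      also have "\<dots> \<approx>[N] sweedler b (\<lambda>u v. flin (\<lambda>l. F (u # butlast l @ [last l * \<xi> r])) (coprods n v))"
        using Suc.IH[OF Fu] by (intro sweedler_cong) blast
      also have "\<dots> = flin (\<lambda>l. F (butlast l @ [last l * \<xi> r])) (coprods (Suc n) b)"
        unfolding flin_coprods_Suc sweedler_def
        by (intro lext_cong) (auto dest!: length_coprods)
      finally show ?thesis .
    qed
    ultimately show ?case
      using linmod_sweedler_arg[OF f] unfolding flin_coprods_Suc by blast
  qed
  then show "linmod N scB (\<lambda>b. flin F (coprods n b))"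
    and "flin F (coprods n (b * \<zeta> r)) \<approx>[N] flin (\<lambda>l. F (hd l * \<zeta> r # tl l)) (coprods n b)"
    and "flin F (coprods n (b * \<xi> r)) \<approx>[N] flin (\<lambda>l. F (butlast l @ [last l * \<xi> r])) (coprods n b)"
    by blast+
qed

lemma eqmod_flin_coprods:
  assumes "\<And>l. length l = Suc n \<Longrightarrow> F l \<approx>[N] G l"
  shows "flin F (coprods n b) \<approx>[N] flin G (coprods n b)"
  using assms length_coprods by (intro eqmod_flin) blast

lemma linmod_flin_coprods:
  assumes "\<And>l. length l = Suc n \<Longrightarrow> linmod N sc (\<lambda>m. F m l)"
  shows "linmod N sc (\<lambda>m. flin (F m) (coprods n b))"
  using assms length_coprods by (intro linmod_flin) blast

lemma bil_coprods:
  assumes "tensor N (Suc (Suc n)) F"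
  shows "bil N (\<lambda>u v. flin (\<lambda>l. F (u # l)) (coprods n v))"
proof (rule bilI)
  have Fu: "tensor N (Suc n) (\<lambda>l. F (u # l))" for u
    using assms by (simp add: tens_Suc_Suc)
  show "linmod N scB (\<lambda>u. flin (\<lambda>l. F (u # l)) (coprods n v))" for v
    using assms by (intro linmod_flin_coprods) (simp add: tens_Suc_Suc)
  show "linmod N scB (\<lambda>v. flin (\<lambda>l. F (u # l)) (coprods n v))" for u
    using coprods_linear(1)[OF Fu] .
  fix u v r
  have "flin (\<lambda>l. F (u * \<xi> r # l)) (coprods n v) \<approx>[N] flin (\<lambda>l. F (u # hd l * \<zeta> r # tl l)) (coprods n v)"
  proof (rule eqmod_flin_coprods)
    fix l :: "'b list" assume "length l = Suc n"
    then obtain a l' where "l = a # l'" "length l' = n"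
      by (metis length_Suc_conv)
    then show "F (u * \<xi> r # l) \<approx>[N] F (u # hd l * \<zeta> r # tl l)"
      using assms by (simp add: tens_Suc_Suc)
  qed
  also have "\<dots> \<approx>[N] flin (\<lambda>l. F (u # l)) (coprods n (v * \<zeta> r))"
    by (rule eqmod_sym[OF coprods_linear(2)[OF Fu]])
  finally show "flin (\<lambda>l. F (u * \<xi> r # l)) (coprods n v) \<approx>[N] flin (\<lambda>l. F (u # l)) (coprods n (v * \<zeta> r))" .
qed

lemma flin_sweedler_commute:
  "flin (\<lambda>l. sweedler b (\<lambda>u v. F u v l)) p = sweedler b (\<lambda>u v. flin (F u v) p)"
  unfolding sweedler_def by (rule fs.lext_commute)

lemma tril_coprods_right:
  assumes "tensor N (Suc (Suc (Suc n))) F"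
  shows "tril N (\<lambda>u v w. flin (\<lambda>l. F (u # v # l)) (coprods n w))"
proof -
  have "bil N (\<lambda>v w. flin (\<lambda>l. F (u # v # l)) (coprods n w))" for u
    using assms by (intro bil_coprods) (simp add: tens_Suc_Suc[of _ _ _ _ "Suc n"])
  moreover have "linmod N scB (\<lambda>u. flin (\<lambda>l. F (u # v # l)) (coprods n w))" for v w
    using assms by (intro linmod_flin_coprods) (simp add: tens_Suc_Suc[of _ _ _ _ "Suc n"])
  moreover have "flin (\<lambda>l. F (u * \<xi> r # v # l)) (coprods n w) \<approx>[N] flin (\<lambda>l. F (u # v * \<zeta> r # l)) (coprods n w)"
    for u v w r
    using assms by (intro eqmod_flin_coprods) (simp add: tens_Suc_Suc[of _ _ _ _ "Suc n"])
  ultimately show ?thesis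
    by (simp add: tril_def bil_def)
qed

text \<open>General coassociativity. For \<open>k = 0\<close> it is the coassociativity of a single
  coproduct with the remaining legs as spectators; positive \<open>k\<close> is handled in the
  tail.\<close>

lemma coprods_split:
  assumes "tensor N (Suc (Suc n)) F" "k \<le> n"
  shows "flin (split_fun k F) (coprods n b) \<approx>[N] flin F (coprods (Suc n) b)"
  using assms
proof (induction n arbitrary: k F b)
  case 0
  then show ?case by (simp add: split_fun_def flin_sweedler)
next
  case (Suc n)
  show ?case
  proof (cases k)
    case 0
    have "flin (split_fun k F) (coprods (Suc n) b)
        = sweedler b (\<lambda>u v. sweedler u (\<lambda>p q. flin (\<lambda>l. F (p # q # l)) (coprods n v)))"
      by (simp only: 0 flin_coprods_Suc split_fun_0 flin_sweedler_commute)
    also have "\<dots> \<approx>[N] sweedler b (\<lambda>u v. sweedler v (\<lambda>p q. flin (\<lambda>l. F (u # p # l)) (coprods n q)))"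
      using sweedler_coassoc[OF tril_coprods_right[OF Suc.prems(1)]] .
    finally show ?thesis
      by (simp only: flin_coprods_Suc)
  next
    case k: (Suc k')
    have "tensor N (Suc (Suc n)) (\<lambda>l. F (u # l))" for u
      using Suc.prems(1) by (simp add: tens_Suc_Suc[of _ _ _ _ "Suc n"])
    from Suc.IH[OF this] Suc.prems(2) k show ?thesis
      unfolding flin_coprods_Suc[of _ n] flin_coprods_Suc[of _ "Suc n"] k split_fun_Suc
      by (intro sweedler_cong) simp
  qed
qed

lemma tensor_snoc:
  assumes "tensor N (Suc (Suc n)) F"
  shows "tensor N (Suc n) (\<lambda>l. F (l @ [v]))"
    and "length l = Suc n \<Longrightarrow> linmod N scB (\<lambda>v. F (l @ [v]))"
    and "length l = Suc n \<Longrightarrow> F (butlast l @ [last l * \<xi> r] @ [v]) \<approx>[N] F (l @ [v * \<zeta> r])"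
proof -
  have slot: "linmod N scB (\<lambda>m. F (us @ m # vs))" if "length us + length vs = Suc n" for us vs
    using assms that by (simp add: tens_iff)
  have bal: "F (us @ a * \<xi> r # b # vs) \<approx>[N] F (us @ a # b * \<zeta> r # vs)" if "length us + length vs = n" for us vs a b r
    using assms that by (simp add: tens_iff)
  show "tensor N (Suc n) (\<lambda>l. F (l @ [v]))"
    unfolding tens_iff using slot[of _ "_ @ [v]"] bal[of _ "_ @ [v]"] by simp
  show "linmod N scB (\<lambda>v. F (l @ [v]))" if "length l = Suc n"
    using slot[of l "[]"] that by simp
  show "F (butlast l @ [last l * \<xi> r] @ [v]) \<approx>[N] F (l @ [v * \<zeta> r])" if "length l = Suc n"
  proof -
    have "l = butlast l @ [last l]" "length (butlast l) = n" using that by (cases l rule: rev_cases; simp)+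
    then show ?thesis
      using bal[of "butlast l" "[]" "last l" r v] by (metis append.assoc append_Cons append_Nil add.right_neutral list.size(3))
  qed
qed

text \<open>Rotation singles out the last tensor factor, so the leg acting there has to be separated
  from the others. Repeated coassociativity moves the outermost splitting from the front to the
  back.\<close>

lemma coprods_snoc:
  assumes "tensor N (Suc (Suc n)) F"
  shows "flin F (coprods (Suc n) b) \<approx>[N] sweedler b (\<lambda>u v. flin (\<lambda>l. F (l @ [v])) (coprods n u))"
  using assms
proof (induction n arbitrary: F b)
  case 0
  show ?case by (simp add: flin_sweedler)
next
  case (Suc n)
  have Fu: "tensor N (Suc (Suc n)) (\<lambda>l. F (u # l))" for u
    using Suc.prems by (simp add: tens_Suc_Suc[of _ _ _ _ "Suc n"])
  have tril: "tril N (\<lambda>u v w. flin (\<lambda>l. F (u # l @ [w])) (coprods n v))"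
  proof (rule trilI)
    show "linmod N scB (\<lambda>u. flin (\<lambda>l. F (u # l @ [w])) (coprods n v))" for v w
      using Suc.prems by (intro linmod_flin_coprods) (simp add: tens_Suc_Suc[of _ _ _ _ "Suc n"])
    show "linmod N scB (\<lambda>v. flin (\<lambda>l. F (u # l @ [w])) (coprods n v))" for u w
      by (rule coprods_linear(1)[OF tensor_snoc(1)[OF Fu]])
    show "linmod N scB (\<lambda>w. flin (\<lambda>l. F (u # l @ [w])) (coprods n v))" for u v
      by (rule linmod_flin_coprods) (rule tensor_snoc(2)[OF Fu])
    show "flin (\<lambda>l. F (u * \<xi> r # l @ [w])) (coprods n v) \<approx>[N] flin (\<lambda>l. F (u # l @ [w])) (coprods n (v * \<zeta> r))"
      for u v w r
      using bil_coprods[OF tensor_snoc(1)[OF Suc.prems, of w]] by (simp add: bil_def)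
    fix u v w r
    have "flin (\<lambda>l. F (u # l @ [w])) (coprods n (v * \<xi> r))
        \<approx>[N] flin (\<lambda>l. F (u # (butlast l @ [last l * \<xi> r]) @ [w])) (coprods n v)"
      by (rule coprods_linear(3)[OF tensor_snoc(1)[OF Fu]])
    also have "\<dots> \<approx>[N] flin (\<lambda>l. F (u # l @ [w * \<zeta> r])) (coprods n v)"
      using tensor_snoc(3)[OF Fu] by (intro eqmod_flin_coprods) simp
    finally show "flin (\<lambda>l. F (u # l @ [w])) (coprods n (v * \<xi> r)) \<approx>[N] flin (\<lambda>l. F (u # l @ [w * \<zeta> r])) (coprods n v)" .
  qed
  have "flin F (coprods (Suc (Suc n)) b)
      \<approx>[N] sweedler b (\<lambda>u v. sweedler v (\<lambda>p q. flin (\<lambda>l. F (u # l @ [q])) (coprods n p)))"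
    unfolding flin_coprods_Suc[of F] by (intro sweedler_cong Suc.IH[OF Fu])
  also have "\<dots> \<approx>[N] sweedler b (\<lambda>u v. sweedler u (\<lambda>p q. flin (\<lambda>l. F (p # l @ [v])) (coprods n q)))"
    by (rule eqmod_sym[OF sweedler_coassoc[OF tril]])
  finally show ?case
    by (simp only: flin_coprods_Suc append_Cons)
qed

text \<open>Splitting entry 0 once more is the case \<open>k = 0\<close> of
  \<open>coprods_split\<close>, and balancedness makes the choice of representatives in each step
  irrelevant.\<close>

lemma iter_coprod_coset: "iter_coprod scB \<xi> \<zeta> \<Delta> n b = coprods n b +o fspan (rels (Suc n))"
proof (induction n)
  case 0
  show ?case by simp
next
  case (Suc n)
  have *: "flin (split_fun 0 gen) (coprods n b) \<approx>[rels (Suc (Suc n))] coprods (Suc n) b"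
    using coprods_split[OF tens_gen, of 0 n b] by (simp only: flin_gen_id le0)
  have "iter_coprod scB \<xi> \<zeta> \<Delta> (Suc n) b
      = induced (fspan (rels (Suc (Suc n)))) (split_at \<Delta> 0) (coprods n b +o fspan (rels (Suc n)))"
    by (simp add: Suc)
  also have "\<dots> = flin (\<lambda>l. flin (\<lambda>ds. gen (take 0 l @ ds @ drop (Suc 0) l)) (coprod_rep (l ! 0))) (coprods n b) +o fspan (rels (Suc (Suc n)))"
  proof (rule induced_coset[OF keys_coprods])
    show "supp r \<subseteq> {l. length l = Suc n}" if "r \<in> rels (Suc n)" for r
      using keys_tpow_rels[OF that] .
    show in_split: "flin (\<lambda>ds. gen (take 0 l @ ds @ drop (Suc 0) l)) (coprod_rep (l ! 0)) \<in> split_at \<Delta> 0 l" for l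
      by (rule split_at_memI)
    have y: "y \<approx>[rels (Suc (Suc n))] split_fun 0 gen l" if "l \<in> {l. length l = Suc n}" "y \<in> split_at \<Delta> 0 l" for l y
      using split_at_eqmod[OF _ _ tens_gen that(2), of n] that(1) by (simp add: flin_gen_id)
    show "y \<approx>[rels (Suc (Suc n))] flin (\<lambda>ds. gen (take 0 l @ ds @ drop (Suc 0) l)) (coprod_rep (l ! 0))"
      if "l \<in> {l. length l = Suc n}" "y \<in> split_at \<Delta> 0 l" for l y
      using y[OF that] y[OF that(1) in_split[of l]] by (rule eqmod_trans[OF _ eqmod_sym])
    fix r assume r: "r \<in> rels (Suc n)"
    have "flin (\<lambda>l. flin (\<lambda>ds. gen (take 0 l @ ds @ drop (Suc 0) l)) (coprod_rep (l ! 0))) r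
        \<approx>[rels (Suc (Suc n))] flin (split_fun 0 gen) r"
      using y in_split keys_tpow_rels[OF r] by (intro eqmod_flin) blast
    also have "\<dots> \<approx>[rels (Suc (Suc n))] 0"
      using tensor_split_fun[OF tens_gen, of 0 n] r by (simp add: tens_def)
    finally show "flin (\<lambda>l. flin (\<lambda>ds. gen (take 0 l @ ds @ drop (Suc 0) l)) (coprod_rep (l ! 0))) r \<approx>[rels (Suc (Suc n))] 0" .
  qed
  also have "\<dots> = coprods (Suc n) b +o fspan (rels (Suc (Suc n)))"
    unfolding coset_eq_iff
  proof (rule eqmod_trans[OF _ *], rule eqmod_flin)
    fix l assume "l \<in> supp (coprods n b)"
    then have "length l = Suc n" by (rule length_coprods)
    from split_at_eqmod[OF this _ tens_gen split_at_memI[of 0 l]]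
    show "flin (\<lambda>ds. gen (take 0 l @ ds @ drop (Suc 0) l)) (coprod_rep (l ! 0)) \<approx>[rels (Suc (Suc n))] split_fun 0 gen l"
      by (simp add: flin_gen_id)
  qed
  finally show ?case .
qed

end

section \<open>Comodules\<close>

lemma keys_flin_tpow_rels:
  assumes "t \<in> tpow_rels sc lact ract n" "\<And>l. length l = n \<Longrightarrow> g l \<in> G"
  shows "supp (flin (\<lambda>l. gen (g l)) t) \<subseteq> G"
  using keys_tpow_rels[OF assms(1)] assms(2) by (intro keys_flin_subset) auto

lemma keys_comod_rels:
  fixes p :: "'x::ab_group_add \<times> 'b::{ring,monoid_mult} list \<Rightarrow>\<^sub>0 'k::comm_ring_1"
  assumes "p \<in> comod_rels scB \<xi> \<zeta> scX ractX n"
  shows "supp p \<subseteq> {(x, bs). length bs = n}"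
proof -
  let ?G = "{(x :: 'x, bs :: 'b list). length bs = n}"
  have "supp (flin (\<lambda>bs. gen (x, bs)) t :: _ \<Rightarrow>\<^sub>0 'k) \<subseteq> ?G"
    if "t \<in> tpow_rels scB (\<lambda>r b. b * \<zeta> r) (\<lambda>b r. b * \<xi> r) n" for x t
    using that by (rule keys_flin_tpow_rels) simp
  moreover have "supp p \<subseteq> ?G"
    if "p \<in> slot_rels scX (\<lambda>x. (x, bs))" "length bs = n" for bs
    using that by (intro keys_slot_rels[OF that(1)]) simp
  moreover have "supp (gen (ractX x r, b # bs) - gen (x, b * \<zeta> r # bs) :: _ \<Rightarrow>\<^sub>0 'k) \<subseteq> ?G"
    if "length bs + 1 = n" for x r b bs
    using that by (intro keys_gen_diff) simp_all
  ultimately show ?thesis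
    using assms unfolding comod_rels_def by blast
qed

context right_comodule
begin

definition coact_rep :: "'x \<Rightarrow> ('x \<times> 'b list \<Rightarrow>\<^sub>0 'k)" where
  "coact_rep x = (SOME p. p \<in> \<rho> x)"

abbreviation crels where "crels n \<equiv> comod_rels scB \<xi> \<zeta> scX ractX n"

lemma coaction_coset: "\<rho> x = coact_rep x +o fspan (crels 1)"
  and keys_coaction: "p \<in> \<rho> x \<Longrightarrow> supp p \<subseteq> {(x, bs). length bs = 1}"
proof -
  obtain p where p: "\<rho> x = p +o fspan (crels 1)" "supp p \<subseteq> {(x, bs). length bs = 1}"
    using carrier_quot_modE[OF coact_closed[of x]] .
  then have "\<exists>p. p \<in> \<rho> x"
    by (auto simp: mem_coset_iff intro: eqmod_refl)
  then have "coact_rep x \<in> \<rho> x"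
    unfolding coact_rep_def by (rule someI_ex)
  then have "coact_rep x \<approx>[crels 1] p"
    by (simp add: p mem_coset_iff)
  then show "\<rho> x = coact_rep x +o fspan (crels 1)"
    by (simp add: p coset_eq_iff eqmod_sym)
  fix q assume "q \<in> \<rho> x"
  then have "supp (q - p) \<subseteq> {(x, bs). length bs = 1}"
    using keys_fspan[of "crels 1", OF keys_comod_rels] by (simp add: p mem_coset_iff eqmod_def)
  with p(2) show "supp q \<subseteq> {(x, bs). length bs = 1}"
    using keys_add[of "q - p" p] by auto
qed

lemma coact_rep_in: "coact_rep x \<in> \<rho> x"
  by (simp add: coaction_coset mem_coset_iff)

lemma in_coaction: "p \<in> \<rho> x \<longleftrightarrow> p \<approx>[crels 1] coact_rep x"
  by (simp add: coaction_coset mem_coset_iff)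

definition coact :: "'x \<Rightarrow> ('x \<Rightarrow> 'b \<Rightarrow> ('t \<Rightarrow>\<^sub>0 'k)) \<Rightarrow> ('t \<Rightarrow>\<^sub>0 'k)" where
  "coact x f = flin (\<lambda>(y, bs). f y (hd bs)) (coact_rep x)"

text \<open>The universal property of \<open>X \<otimes> B \<otimes> ... \<otimes> B\<close> with
  \<open>n\<close> factors \<open>B\<close>.\<close>

definition comodmap :: "('t \<Rightarrow>\<^sub>0 'k) set \<Rightarrow> nat \<Rightarrow> ('x \<times> 'b list \<Rightarrow> ('t \<Rightarrow>\<^sub>0 'k)) \<Rightarrow> bool" where
  "comodmap N n F \<longleftrightarrow> (\<forall>x. tensor N n (\<lambda>bs. F (x, bs)))
     \<and> (\<forall>bs. length bs = n \<longrightarrow> linmod N scX (\<lambda>x. F (x, bs)))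
     \<and> (\<forall>x r b bs. length bs + 1 = n \<longrightarrow> F (ractX x r, b # bs) \<approx>[N] F (x, b * \<zeta> r # bs))"

lemma comodmap_eqmod:
  assumes F: "comodmap N n F" and p: "p \<approx>[crels n] q"
  shows "flin F p \<approx>[N] flin F q"
proof (rule eqmod_flin_arg[OF _ p])
  fix t assume "t \<in> crels n"
  moreover have "flin F (flin (\<lambda>bs. gen (x, bs)) t) \<approx>[N] 0" if "t \<in> rels n" for x t
    using F that by (simp add: fs.lext_flin comodmap_def tens_def)
  moreover have "flin F t \<approx>[N] 0" if "t \<in> slot_rels scX (\<lambda>x. (x, bs))" "length bs = n" for bs
    using F that linmod_iff_slot_rels[of N scX F "\<lambda>x. (x, bs)"] by (simp add: comodmap_def)
  moreover have "flin F (gen (ractX x r, b # bs) - gen (x, b * \<zeta> r # bs)) \<approx>[N] 0"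
    if "length bs + 1 = n" for x r b bs
    using F that by (simp add: fs.lext_diff eqmod_diff_zero comodmap_def)
  ultimately show "flin F t \<approx>[N] 0"
    unfolding comod_rels_def by blast
qed

definition cobil :: "('t \<Rightarrow>\<^sub>0 'k) set \<Rightarrow> ('x \<Rightarrow> 'b \<Rightarrow> ('t \<Rightarrow>\<^sub>0 'k)) \<Rightarrow> bool" where
  "cobil N f \<longleftrightarrow> (\<forall>b. linmod N scX (\<lambda>x. f x b)) \<and> (\<forall>x. linmod N scB (f x))
     \<and> (\<forall>x r b. f (ractX x r) b \<approx>[N] f x (b * \<zeta> r))"

lemma cobilI:
  "(\<And>b. linmod N scX (\<lambda>x. f x b)) \<Longrightarrow> (\<And>x. linmod N scB (f x))
     \<Longrightarrow> (\<And>x r b. f (ractX x r) b \<approx>[N] f x (b * \<zeta> r)) \<Longrightarrow> cobil N f"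
  by (simp add: cobil_def)

lemma coact_eqI:
  assumes "cobil N f" "p \<in> \<rho> x"
  shows "flin (\<lambda>(y, bs). f y (hd bs)) p \<approx>[N] coact x f"
proof -
  have "comodmap N 1 (\<lambda>(y, bs). f y (hd bs))"
    using assms(1) by (auto simp: comodmap_def cobil_def tens_Suc_0)
  then show ?thesis
    using assms(2) unfolding coact_def in_coaction by (rule comodmap_eqmod)
qed

lemma coact_cong: "(\<And>y b. f y b \<approx>[N] g y b) \<Longrightarrow> coact x f \<approx>[N] coact x g"
  unfolding coact_def by (rule eqmod_flin) auto

lemma flin_coact: "flin F (coact x f) = coact x (\<lambda>y b. flin F (f y b))"
  unfolding coact_def fs.lext_flin by (rule lext_cong) auto

lemma linmod_coact:
  "(\<And>y b. linmod N sc' (\<lambda>m. f m y b)) \<Longrightarrow> linmod N sc' (\<lambda>m. coact x (f m))"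
  unfolding coact_def by (rule linmod_flin) auto

lemma coact_of_ract:
  assumes "cobil N f"
  shows "coact (ractX x r) f \<approx>[N] coact x (\<lambda>y b. f y (b * \<xi> r))"
proof -
  have "flin (\<lambda>(y, bs). f y (hd bs)) (flin (\<lambda>(x0, bs). gen (x0, [hd bs * \<xi> r])) (coact_rep x))
      = coact x (\<lambda>y b. f y (b * \<xi> r))"
    unfolding coact_def fs.lext_flin by (rule lext_cong) auto
  then show ?thesis
    using coact_eqI[OF assms coact_ract[OF coact_rep_in[of x], of r]] eqmod_sym by metis
qed

lemma linmod_coact_arg:
  assumes f: "cobil N f"
  shows "linmod N scX (\<lambda>x. coact x f)"
proof (rule linmodI)
  fix a b
  have "coact_rep a + coact_rep b \<in> \<rho> (a + b)"
    by (simp add: coact_add coact_rep_in set_plus_intro)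
  from coact_eqI[OF f this] show "coact (a + b) f \<approx>[N] coact a f + coact b f"
    unfolding coact_def fs.lext_add by (rule eqmod_sym)
next
  fix k a
  \<comment> \<open>As for the coproduct, scaling is the action of \<open>scR k 1\<close>, which
    makes homogeneity a case of right linearity of the coaction.\<close>
  have sc: "scX k x = ractX x (scR k 1)" for x
    by (simp add: X.ract_sc_right X.ract_one)
  have scB: "b * \<xi> (scR k 1) = scB k b" for b
    by (simp add: xi_sc xi_one B.sc_mult_right)
  have "coact (scX k a) f \<approx>[N] coact a (\<lambda>y b. f y (scB k b))"
    unfolding sc using coact_of_ract[OF f, of a "scR k 1"] by (simp add: scB)
  also have "\<dots> \<approx>[N] coact a (\<lambda>y b. fsmult k (f y b))"
    using f by (intro coact_cong linmod_scale) (simp add: cobil_def)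
  also have "coact a (\<lambda>y b. fsmult k (f y b)) = fsmult k (coact a f)"
    unfolding coact_def fs.lext_fun_scale[symmetric] by (rule lext_cong) auto
  finally show "coact (scX k a) f \<approx>[N] fsmult k (coact a f)" .
qed

definition cotril :: "('t \<Rightarrow>\<^sub>0 'k) set \<Rightarrow> ('x \<Rightarrow> 'b \<Rightarrow> 'b \<Rightarrow> ('t \<Rightarrow>\<^sub>0 'k)) \<Rightarrow> bool" where
  "cotril N f \<longleftrightarrow> (\<forall>u v. linmod N scX (\<lambda>x. f x u v)) \<and> (\<forall>x. bil N (f x))
     \<and> (\<forall>x r u v. f (ractX x r) u v \<approx>[N] f x (u * \<zeta> r) v)"

lemma cobil_sweedler:
  assumes "cotril N f"
  shows "cobil N (\<lambda>x b. sweedler b (f x))"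
proof (rule cobilI)
  show "linmod N scX (\<lambda>x. sweedler b (f x))" for b
    using assms by (intro linmod_sweedler) (simp add: cotril_def)
  show "linmod N scB (\<lambda>b. sweedler b (f x))" for x
    using assms by (intro linmod_sweedler_arg) (simp add: cotril_def)
  fix x r b
  have "sweedler b (f (ractX x r)) \<approx>[N] sweedler b (\<lambda>u v. f x (u * \<zeta> r) v)"
    using assms by (intro sweedler_cong) (simp add: cotril_def)
  also have "\<dots> \<approx>[N] sweedler (b * \<zeta> r) (f x)"
    using assms by (intro eqmod_sym[OF sweedler_lact]) (simp add: cotril_def)
  finally show "sweedler b (f (ractX x r)) \<approx>[N] sweedler (b * \<zeta> r) (f x)" .
qed

text \<open>The argument of \<open>sweedler_coassoc\<close>: a member of the left set in
  \<open>coact_coassoc\<close> is followed to the right set, and \<open>cotril\<close> absorbs the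
  unknown representatives there.\<close>

lemma coact_coassociative:
  assumes f: "cotril N f"
  shows "coact x (\<lambda>y b. coact y (\<lambda>z u. f z u b)) \<approx>[N] coact x (\<lambda>y b. sweedler b (f y))"
proof -
  let ?F = "\<lambda>(y, bs). f y (bs ! 0) (bs ! 1)"
  let ?s = "\<lambda>(x0, bs). flin (\<lambda>(x00, bs'). gen (x00, bs' @ bs)) (coact_rep x0) :: 'x \<times> 'b list \<Rightarrow>\<^sub>0 'k"
  have F: "comodmap N 2 ?F"
    using f bil_tensor[of N "f _"]
    by (auto simp: comodmap_def cotril_def numeral_2_eq_2 length_Suc_conv)
  have s: "flin ?F (?s (y, bs)) = coact y (\<lambda>z u. f z u (hd bs))" if len: "length bs = 1" for y bs
  proof -
    obtain b where b: "bs = [b]" using len by (auto simp: length_Suc_conv)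
    have "flin ?F (?s (y, bs)) = flin (\<lambda>s. flin ?F (case s of (x00, bs') \<Rightarrow> gen (x00, bs' @ bs))) (coact_rep y)"
      by (simp add: fs.lext_flin)
    also have "\<dots> = coact y (\<lambda>z u. f z u (hd bs))"
      unfolding coact_def
    proof (rule lext_cong)
      fix s assume "s \<in> supp (coact_rep y)"
      then obtain z c where "s = (z, [c])"
        using keys_coaction[OF coact_rep_in] by (fastforce simp: length_Suc_conv)
      then show "flin ?F (case s of (x00, bs') \<Rightarrow> gen (x00, bs' @ bs)) = (case s of (z, bs') \<Rightarrow> f z (hd bs') (hd bs))"
        by (simp add: b)
    qed
    finally show ?thesis .
  qed
  have "flin ?s (coact_rep x) \<in> induced (fspan (crels 2))
         (\<lambda>(x0, bs). flin (\<lambda>(x00, bs'). gen (x00, bs' @ bs)) ` \<rho> x0) (\<rho> x)"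
    by (rule induced_memI[OF coact_rep_in]) (auto intro!: imageI coact_rep_in)
  then have "flin ?s (coact_rep x) \<in> induced (fspan (crels 2))
         (\<lambda>(x0, bs). flin (\<lambda>bs'. gen (x0, bs')) ` \<Delta> (hd bs)) (\<rho> x)"
    by (simp add: coact_coassoc)
  then obtain h w m where eq: "flin ?s (coact_rep x) = flin h w + m" and w: "w \<in> \<rho> x" and m: "m \<approx>[crels 2] 0"
    and h: "\<forall>s\<in>supp w. h s \<in> (\<lambda>(x0, bs). flin (\<lambda>bs'. gen (x0, bs')) ` \<Delta> (hd bs)) s"
    by (rule induced_memE)
  have hs: "flin ?F (h s) \<approx>[N] (case s of (y, bs) \<Rightarrow> sweedler (hd bs) (f y))" if s_in: "s \<in> supp w" for s
  proof -
    obtain y bs where s: "s = (y, bs)" by (cases s)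
    obtain d where d: "d \<in> \<Delta> (hd bs)" "h s = flin (\<lambda>bs'. gen (y, bs')) d"
      using h s_in s by fastforce
    have "flin ?F (h s) = flin (\<lambda>bs. f y (bs ! 0) (bs ! 1)) d"
      by (simp add: d(2) fs.lext_flin)
    also have "\<dots> \<approx>[N] sweedler (hd bs) (f y)"
      using f d(1) by (intro sweedler_eqI) (simp add: cotril_def)
    finally show ?thesis by (simp add: s)
  qed
  have "coact x (\<lambda>y b. coact y (\<lambda>z u. f z u b)) = flin ?F (flin ?s (coact_rep x))"
    unfolding coact_def[of x]
    by (subst fs.lext_flin, rule lext_cong) (use keys_coaction[OF coact_rep_in[of x]] s in fastforce)
  also have "\<dots> = flin ?F (flin h w) + flin ?F m"
    unfolding eq by (rule fs.lext_add)
  also have "\<dots> \<approx>[N] flin ?F (flin h w) + 0"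
    using comodmap_eqmod[OF F m] by (intro eqmod_add) auto
  also have "\<dots> \<approx>[N] flin (\<lambda>(y, bs). sweedler (hd bs) (f y)) w"
    unfolding fs.lext_flin using hs by (simp add: eqmod_flin)
  also have "\<dots> \<approx>[N] coact x (\<lambda>y b. sweedler b (f y))"
    using cobil_sweedler[OF f] w by (rule coact_eqI)
  finally show ?thesis .
qed

abbreviation lX where "lX \<equiv> comod_lact \<xi> \<epsilon> scX ractX \<rho>"

text \<open>\<open>comod_lact\<close> and \<open>coact\<close> choose the same representative of the
  coaction, so no independence of the choice enters here.\<close>

lemma coact_lX:
  assumes "linmod N scX h"
  shows "coact x (\<lambda>y b. h (ractX y (\<epsilon> (\<xi> r * b)))) \<approx>[N] h (lX r x)"
proof -
  have "(\<lambda>s. h (case s of (x0, bs) \<Rightarrow> ractX x0 (\<epsilon> (\<xi> r * hd bs)))) = (\<lambda>(y, bs). h (ractX y (\<epsilon> (\<xi> r * hd bs))))"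
    by auto
  then show ?thesis
    using linmod_lext[OF assms, of "\<lambda>(x0, bs). ractX x0 (\<epsilon> (\<xi> r * hd bs))" "coact_rep x"]
    by - (rule eqmod_sym, simp add: coact_def comod_lact_def coact_rep_def)
qed

lemma linmod_ractX: "linmod N scX h \<Longrightarrow> linmod N scX (\<lambda>x. h (ractX x r))"
  by (rule linmod_comp[where sc = scX]) (auto simp: X.ract_add_left X.ract_sc_left)

lemma linmod_ractX_right: "linmod N scX h \<Longrightarrow> linmod N scR (\<lambda>r. h (ractX x r))"
  by (rule linmod_comp[where sc = scX]) (auto simp: X.ract_add_right X.ract_sc_right)

text \<open>Expand \<open>r \<cdot> x\<close> by its definition. Right linearity of the coaction
  puts the scalar into \<open>B\<close> as a right factor \<open>\<xi>\<close>, coassociativity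
  makes its argument the second leg of a coproduct, and \<open>sweedler_counit_right_xi\<close>
  contracts that coproduct to \<open>\<xi> r * b\<close>.\<close>

lemma coact_of_lX:
  assumes f: "cobil N f"
  shows "coact (lX r x) f \<approx>[N] coact x (\<lambda>y b. f y (\<xi> r * b))"
proof -
  have fb: "linmod N scB (f y)" for y
    using f by (simp add: cobil_def)
  have lin: "linmod N scB (\<lambda>v. f y (u * \<xi> (\<epsilon> (\<xi> r * v))))" for y u
    by (rule linmod_comp[OF fb])
      (simp_all add: distrib_left counit_add xi_add B.sc_mult_right counit_sc xi_sc)
  have tril: "cotril N (\<lambda>y u v. f y (u * \<xi> (\<epsilon> (\<xi> r * v))))"
    unfolding cotril_def
  proof (intro conjI allI bilI)
    show "linmod N scB (\<lambda>u. f y (u * \<xi> (\<epsilon> (\<xi> r * v))))" for y v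
      by (rule B.linmod_mult_right[OF fb])
    show "f y (u * \<xi> s * \<xi> (\<epsilon> (\<xi> r * v))) \<approx>[N] f y (u * \<xi> (\<epsilon> (\<xi> r * (v * \<zeta> s))))" for y u v s
      using counit_lact[where r = s and m = "\<xi> r * v"] by (simp add: mult.assoc xi_mult)
    show "f (ractX y s) (u * \<xi> (\<epsilon> (\<xi> r * v))) \<approx>[N] f y (u * \<zeta> s * \<xi> (\<epsilon> (\<xi> r * v)))" for y s u v
    proof -
      have "u * \<zeta> s * \<xi> (\<epsilon> (\<xi> r * v)) = u * \<xi> (\<epsilon> (\<xi> r * v)) * \<zeta> s"
        by (simp add: mult.assoc xi_zeta)
      then show ?thesis
        using f by (simp add: cobil_def)
    qed
  qed (use f lin in \<open>simp_all add: cobil_def\<close>)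
  have "coact (lX r x) f \<approx>[N] coact x (\<lambda>y b. coact (ractX y (\<epsilon> (\<xi> r * b))) f)"
    by (rule eqmod_sym[OF coact_lX[OF linmod_coact_arg[OF f]]])
  also have "\<dots> \<approx>[N] coact x (\<lambda>y b. coact y (\<lambda>z u. f z (u * \<xi> (\<epsilon> (\<xi> r * b)))))"
    by (intro coact_cong coact_of_ract[OF f])
  also have "\<dots> \<approx>[N] coact x (\<lambda>y b. sweedler b (\<lambda>u v. f y (u * \<xi> (\<epsilon> (\<xi> r * v)))))"
    by (rule coact_coassociative[OF tril])
  also have "\<dots> \<approx>[N] coact x (\<lambda>y b. f y (\<xi> r * b))"
    by (intro coact_cong sweedler_counit_right_xi fb)
  finally show ?thesis .
qed

text \<open>Here the scalar hidden in the left action on the inner \<open>x\<close> comes from the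
  first leg of a coproduct. It passes to the second leg as a right factor \<open>\<zeta>\<close>,
  and \<open>sweedler_counit_left_xi\<close> contracts the sum to
  \<open>\<zeta> r * b\<close>.\<close>

lemma coact_takeuchi:
  assumes f: "cobil N f"
  shows "coact x (\<lambda>y b. f (lX r y) b) \<approx>[N] coact x (\<lambda>y b. f y (\<zeta> r * b))"
proof -
  have fx: "linmod N scX (\<lambda>y. f y b)" and fb: "linmod N scB (f y)" for y b
    using f by (simp_all add: cobil_def)
  have tril: "cotril N (\<lambda>y u v. f (ractX y (\<epsilon> (\<xi> r * u))) v)"
    unfolding cotril_def
  proof (intro conjI allI bilI)
    show "linmod N scX (\<lambda>y. f (ractX y (\<epsilon> (\<xi> r * u))) v)" for u v
      by (rule linmod_ractX[OF fx])
    show "linmod N scB (\<lambda>u. f (ractX y (\<epsilon> (\<xi> r * u))) v)" for y v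
      by (rule linmod_comp[OF linmod_ractX_right[OF fx]])
        (simp_all add: distrib_left counit_add B.sc_mult_right counit_sc)
    show "f (ractX y (\<epsilon> (\<xi> r * (u * \<xi> s)))) v \<approx>[N] f (ractX y (\<epsilon> (\<xi> r * u))) (v * \<zeta> s)" for y u v s
      using f counit_ract[where r = s and m = "\<xi> r * u"] by (simp add: cobil_def mult.assoc X.ract_mult)
    show "f (ractX (ractX y s) (\<epsilon> (\<xi> r * u))) v \<approx>[N] f (ractX y (\<epsilon> (\<xi> r * (u * \<zeta> s)))) v" for y s u v
      using counit_lact[where r = s and m = "\<xi> r * u"] by (simp add: mult.assoc X.ract_mult)
  qed (rule fb)
  have "coact x (\<lambda>y b. f (lX r y) b) \<approx>[N] coact x (\<lambda>y b. coact y (\<lambda>z u. f (ractX z (\<epsilon> (\<xi> r * u))) b))"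
    by (intro coact_cong eqmod_sym[OF coact_lX[OF fx]])
  also have "\<dots> \<approx>[N] coact x (\<lambda>y b. sweedler b (\<lambda>u v. f (ractX y (\<epsilon> (\<xi> r * u))) v))"
    by (rule coact_coassociative[OF tril])
  also have "\<dots> \<approx>[N] coact x (\<lambda>y b. sweedler b (\<lambda>u v. f y (v * \<zeta> (\<epsilon> (\<xi> r * u)))))"
    using f by (intro coact_cong sweedler_cong) (simp add: cobil_def)
  also have "\<dots> \<approx>[N] coact x (\<lambda>y b. f y (\<zeta> r * b))"
    by (intro coact_cong sweedler_counit_left_xi fb)
  finally show ?thesis .
qed

end

section \<open>The translation map\<close>

context right_times_R_hopf_algebra
begin

lemma galois_translation: "galois scB \<xi> \<zeta> \<Delta> (translation scB \<xi> \<zeta> \<Delta> a) = gen [1, a] +o fspan (rels 2)"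
  and translation_nonempty: "\<exists>p. p \<in> translation scB \<xi> \<zeta> \<Delta> a"
proof -
  have "gen [1, a] +o fspan (rels 2) \<in> carrier (tpow scB (\<lambda>r b. b * \<zeta> r) (\<lambda>b r. b * \<xi> r) 2)"
    unfolding tpow_def by (rule coset_in_carrier) simp
  then have im: "gen [1, a] +o fspan (rels 2) \<in> galois scB \<xi> \<zeta> \<Delta> ` carrier (op_tensor scB \<zeta>)"
    using galois_bij by (simp add: bij_betw_def)
  then show "galois scB \<xi> \<zeta> \<Delta> (translation scB \<xi> \<zeta> \<Delta> a) = gen [1, a] +o fspan (rels 2)"
    unfolding translation_def by (rule f_inv_into_f)
  have "translation scB \<xi> \<zeta> \<Delta> a \<in> carrier (op_tensor scB \<zeta>)"
    unfolding translation_def using im by (rule inv_into_into)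
  then show "\<exists>p. p \<in> translation scB \<xi> \<zeta> \<Delta> a"
    unfolding op_tensor_def by (elim carrier_quot_modE) (auto simp: mem_coset_iff intro: eqmod_refl)
qed

definition translation_rep :: "'c \<Rightarrow> ('c \<times> 'c \<Rightarrow>\<^sub>0 'a)" where
  "translation_rep a = (SOME p. p \<in> translation scB \<xi> \<zeta> \<Delta> a)"

lemma translation_rep_in: "translation_rep a \<in> translation scB \<xi> \<zeta> \<Delta> a"
  unfolding translation_rep_def by (rule someI_ex[OF translation_nonempty])

text \<open>Evaluation on one chosen representative of \<open>a_- \<otimes> a_+\<close>, with
  \<open>m\<close> for \<open>a_-\<close> and \<open>p\<close> for \<open>a_+\<close>. The choice is
  eliminated only by composing with the Galois map, as in \<open>translate_galois\<close>.\<close>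

definition translate :: "'c \<Rightarrow> ('c \<Rightarrow> 'c \<Rightarrow> ('t \<Rightarrow>\<^sub>0 'a)) \<Rightarrow> ('t \<Rightarrow>\<^sub>0 'a)" where
  "translate a f = flin (\<lambda>(m, p). f m p) (translation_rep a)"

lemma translate_cong: "(\<And>m p. f m p \<approx>[N] g m p) \<Longrightarrow> translate a f \<approx>[N] translate a g"
  unfolding translate_def by (rule eqmod_flin) auto

text \<open>The Galois map sends \<open>a_- \<otimes> a_+\<close> back to
  \<open>1 \<otimes> a\<close>, by the definition of the former as a preimage; \<open>f\<close>
  tests this equation of tensors.\<close>

lemma translate_galois:
  assumes f: "bil N f"
  shows "translate a (\<lambda>m p. sweedler p (\<lambda>u v. f (m * u) v)) \<approx>[N] f 1 a"
proof -
  let ?s = "\<lambda>(b, b'). flin (\<lambda>bs. gen [b * bs ! 0, bs ! 1]) (coprod_rep b') :: 'c list \<Rightarrow>\<^sub>0 'a"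
  have "flin ?s (translation_rep a) \<in> galois scB \<xi> \<zeta> \<Delta> (translation scB \<xi> \<zeta> \<Delta> a)"
    unfolding galois_def by (rule induced_memI[OF translation_rep_in]) (auto intro!: imageI coprod_rep_in)
  then have "flin ?s (translation_rep a) \<approx>[rels 2] gen [1, a]"
    by (simp add: galois_translation mem_coset_iff)
  from tens_eqmod[OF f[unfolded bil_tensor] this]
  have "flin (\<lambda>ms. f (ms ! 0) (ms ! 1)) (flin ?s (translation_rep a)) \<approx>[N] f 1 a"
    by simp
  moreover have "flin (\<lambda>ms. f (ms ! 0) (ms ! 1)) (flin ?s (translation_rep a)) = translate a (\<lambda>m p. sweedler p (\<lambda>u v. f (m * u) v))"
    unfolding translate_def sweedler_def fs.lext_flin by (rule lext_cong) (auto simp: fs.lext_flin)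
  ultimately show ?thesis by simp
qed

text \<open>The counit applied to the second leg of the Galois identity: on the left it contracts
  the coproduct of \<open>p\<close>, on the right it turns \<open>1 \<otimes> a\<close> into
  \<open>\<xi> (\<epsilon> a)\<close>.\<close>

lemma translate_counit:
  assumes h: "linmod N scB h"
  shows "translate a (\<lambda>m p. h (m * p)) \<approx>[N] h (\<xi> (\<epsilon> a))"
proof -
  have "bil N (\<lambda>u v. h (u * \<xi> (\<epsilon> v)))"
  proof (rule bilI)
    show "linmod N scB (\<lambda>u. h (u * \<xi> (\<epsilon> v)))" for v
      by (rule B.linmod_mult_right[OF h])
    show "linmod N scB (\<lambda>v. h (u * \<xi> (\<epsilon> v)))" for u
      by (rule linmod_comp[OF h])
        (simp_all add: counit_add xi_add distrib_left counit_sc xi_sc B.sc_mult_right)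
  qed (simp add: counit_lact xi_mult mult.assoc)
  from translate_galois[OF this, of a]
  have "translate a (\<lambda>m p. sweedler p (\<lambda>u v. h (m * (u * \<xi> (\<epsilon> v))))) \<approx>[N] h (\<xi> (\<epsilon> a))"
    by (simp add: mult.assoc)
  moreover have "translate a (\<lambda>m p. sweedler p (\<lambda>u v. h (m * (u * \<xi> (\<epsilon> v)))))
      \<approx>[N] translate a (\<lambda>m p. h (m * p))"
    by (intro translate_cong sweedler_counit_right[OF B.linmod_mult_left[OF h]])
  ultimately show ?thesis
    using eqmod_sym eqmod_trans by blast
qed

end

context anti_yetter_drinfeld_module
begin

text \<open>The anti Yetter-Drinfel'd condition tested on a balanced function: \<open>u\<close> and
  \<open>v\<close> are the legs of \<open>b\<close>, while \<open>m\<close> and \<open>p\<close>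
  stand for \<open>u_-\<close> and \<open>u_+\<close>.\<close>

lemma coact_lactB:
  assumes f: "cobil N f"
  shows "coact (lactB b x) f \<approx>[N]
    sweedler b (\<lambda>u v. coact x (\<lambda>y c. translate u (\<lambda>m p. f (lactB p y) (v * c * m))))"
proof -
  let ?P = "flin (\<lambda>bs. flin (\<lambda>(x0, xs). flin (\<lambda>(bm, bp). gen (lactB bp x0, [bs ! 1 * hd xs * bm]))
        (translation_rep (bs ! 0))) (coact_rep x)) (coprod_rep b) :: 'x \<times> 'b list \<Rightarrow>\<^sub>0 'k"
  have "?P \<in> \<rho> (lactB b x)"
    by (rule ayd_coaction[OF coprod_rep_in coact_rep_in translation_rep_in])
  from coact_eqI[OF f this] have "flin (\<lambda>(y, bs). f y (hd bs)) ?P \<approx>[N] coact (lactB b x) f" .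
  moreover have "flin (\<lambda>(y, bs). f y (hd bs)) ?P
      = sweedler b (\<lambda>u v. coact x (\<lambda>y c. translate u (\<lambda>m p. f (lactB p y) (v * c * m))))"
    unfolding coact_def sweedler_def translate_def by (simp add: fs.lext_flin case_prod_unfold)
  ultimately show ?thesis
    using eqmod_sym by simp
qed

end

section \<open>Functions on the cyclic tensor product\<close>

locale module_coring_with_coefficients =
    module_coring scR scB \<xi> \<zeta> \<Delta> \<epsilon> scC act \<Delta>C \<epsilon>C
    + anti_yetter_drinfeld_module scR scB \<xi> \<zeta> \<Delta> \<epsilon> scX ractX \<rho> lactB
  for scR :: "'k::comm_ring_1 \<Rightarrow> 'r::{ring,monoid_mult} \<Rightarrow> 'r"
    and scB :: "'k \<Rightarrow> 'b::{ring,monoid_mult} \<Rightarrow> 'b"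
    and \<xi> \<zeta> :: "'r \<Rightarrow> 'b" and \<Delta> :: "'b \<Rightarrow> ('b list \<Rightarrow>\<^sub>0 'k) set" and \<epsilon> :: "'b \<Rightarrow> 'r"
    and scC :: "'k \<Rightarrow> 'c::ab_group_add \<Rightarrow> 'c" and act :: "'c \<Rightarrow> 'b \<Rightarrow> 'c"
    and \<Delta>C :: "'c \<Rightarrow> ('c list \<Rightarrow>\<^sub>0 'k) set" and \<epsilon>C :: "'c \<Rightarrow> 'r"
    and scX :: "'k \<Rightarrow> 'x::ab_group_add \<Rightarrow> 'x" and ractX :: "'x \<Rightarrow> 'r \<Rightarrow> 'x"
    and \<rho> :: "'x \<Rightarrow> ('x \<times> 'b list \<Rightarrow>\<^sub>0 'k) set" and lactB :: "'b \<Rightarrow> 'x \<Rightarrow> 'x"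
begin

abbreviation lC where "lC \<equiv> \<lambda>r c. act c (\<zeta> r)"
abbreviation rC where "rC \<equiv> \<lambda>c r. act c (\<xi> r)"

text \<open>Read directly, \<open>lX\<close> is a sum over an arbitrarily chosen representative. By
  \<open>ayd_lact\<close> it is the action of \<open>\<xi> r\<close>, which makes its algebraic
  properties evident.\<close>

lemma lX_add: "lX r (x + y) = lX r x + lX r y" and lX_scale: "lX r (scX k x) = scX k (lX r x)"
  and lX_add_left: "lX (r + s) x = lX r x + lX s x" and lX_scale_left: "lX (scR k r) x = scX k (lX r x)"
  and lX_mult: "lX (r * s) x = lX r (lX s x)" and ractX_lX: "ractX (lX s x) r = lX s (ractX x r)"
  by (simp_all add: ayd_lact ayd_ract Xl.lact_add_right Xl.lact_sc_right Xl.lact_add_left Xl.lact_sc_left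
      Xl.lact_mult[symmetric] xi_add xi_sc xi_mult xi_zeta)

lemma linmod_act: "linmod N scC h \<Longrightarrow> linmod N scB (\<lambda>b. h (act c b))"
  by (rule linmod_comp[where sc = scC]) (auto simp: C.ract_add_right C.ract_sc_right)

lemma linmod_act_left: "linmod N scC h \<Longrightarrow> linmod N scC (\<lambda>c. h (act c b))"
  by (rule linmod_comp[where sc = scC]) (auto simp: C.ract_add_left C.ract_sc_left)

lemma linmod_lX: "linmod N scX h \<Longrightarrow> linmod N scX (\<lambda>x. h (lX r x))"
  by (rule linmod_comp[where sc = scX]) (auto simp: lX_add lX_scale)

lemma linmod_lX_left: "linmod N scX h \<Longrightarrow> linmod N scR (\<lambda>r. h (lX r x))"
  by (rule linmod_comp[where sc = scX]) (auto simp: lX_add_left lX_scale_left)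

text \<open>
  \<open>cycmap N n F\<close>, resp. \<open>balmap N n F\<close> below, says that \<open>F\<close> factors through the cyclic tensor product,
  resp. the tensor product over \<open>\<B>\<close>, modulo \<open>N\<close>. Faces, degeneracies and the cyclic operator act on
  such \<open>F\<close> by precomposition.
\<close>

definition cycmap :: "('t \<Rightarrow>\<^sub>0 'k) set \<Rightarrow> nat \<Rightarrow> ('c list \<times> 'x \<Rightarrow> ('t \<Rightarrow>\<^sub>0 'k)) \<Rightarrow> bool" where
  "cycmap N n F \<longleftrightarrow> (\<forall>x. C.tensor N (Suc n) (\<lambda>cs. F (cs, x)))
     \<and> (\<forall>cs. length cs = Suc n \<longrightarrow> linmod N scX (\<lambda>x. F (cs, x)))
     \<and> (\<forall>cs c r x. length cs = n \<longrightarrow> F (cs @ [act c (\<xi> r)], x) \<approx>[N] F (cs @ [c], lX r x))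
     \<and> (\<forall>cs c r x. length cs = n \<longrightarrow> F (act c (\<zeta> r) # cs, x) \<approx>[N] F (c # cs, ractX x r))"

lemma cycmapI:
  assumes "\<And>x. C.tensor N (Suc n) (\<lambda>cs. F (cs, x))"
    "\<And>cs. length cs = Suc n \<Longrightarrow> linmod N scX (\<lambda>x. F (cs, x))"
    "\<And>cs c r x. length cs = n \<Longrightarrow> F (cs @ [act c (\<xi> r)], x) \<approx>[N] F (cs @ [c], lX r x)"
    "\<And>cs c r x. length cs = n \<Longrightarrow> F (act c (\<zeta> r) # cs, x) \<approx>[N] F (c # cs, ractX x r)"
  shows "cycmap N n F"
  using assms by (simp add: cycmap_def)

lemma cycmapD:
  assumes "cycmap N n F"
  shows "C.tensor N (Suc n) (\<lambda>cs. F (cs, x))"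
    "length cs = Suc n \<Longrightarrow> linmod N scX (\<lambda>x. F (cs, x))"
    "length ds = n \<Longrightarrow> F (ds @ [act c (\<xi> r)], x) \<approx>[N] F (ds @ [c], lX r x)"
    "length ds = n \<Longrightarrow> F (act c (\<zeta> r) # ds, x) \<approx>[N] F (c # ds, ractX x r)"
  using assms by (simp_all add: cycmap_def)

lemma cycmap_slot:
  assumes "cycmap N n F"
  shows "length us + length vs = n \<Longrightarrow> linmod N scC (\<lambda>m. F (us @ m # vs, x))"
    and "Suc (length us + length vs) = n \<Longrightarrow>
      F (us @ act a (\<xi> r) # b # vs, x) \<approx>[N] F (us @ a # act b (\<zeta> r) # vs, x)"
  using cycmapD(1)[OF assms] by (simp_all add: tens_iff)

lemma absorb_app: "length us = k \<Longrightarrow> C.absorb k (us @ a # b # vs) = us @ act b (\<zeta> (\<epsilon>C a)) # vs"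
  by (simp add: C.absorb_def nth_append)

lemma split_fun_app:
  "length us = k \<Longrightarrow> C.split_fun k F (us @ a # vs) = C.sweedler a (\<lambda>u v. F (us @ u # v # vs))"
  by (simp add: C.split_fun_def nth_append)

text \<open>A face sends a generator to a generator and can be a map of generators. Degeneracies and
  rotation produce formal sums, so \<open>degen\<close> and \<open>rot\<close> are given as
  operators on functions \<open>F\<close> instead.\<close>

fun face :: "nat \<Rightarrow> nat \<Rightarrow> 'c list \<times> 'x \<Rightarrow> 'c list \<times> 'x" where
  "face n k (cs, x) = (if k < n then (C.absorb k cs, x) else (take n cs, lX (\<epsilon>C (cs ! n)) x))"

definition degen :: "nat \<Rightarrow> ('c list \<times> 'x \<Rightarrow> ('t \<Rightarrow>\<^sub>0 'k)) \<Rightarrow> 'c list \<times> 'x \<Rightarrow> ('t \<Rightarrow>\<^sub>0 'k)" where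
  "degen k F = (\<lambda>(cs, x). C.split_fun k (\<lambda>cs. F (cs, x)) cs)"

definition rot :: "nat \<Rightarrow> ('c list \<times> 'x \<Rightarrow> ('t \<Rightarrow>\<^sub>0 'k)) \<Rightarrow> 'c list \<times> 'x \<Rightarrow> ('t \<Rightarrow>\<^sub>0 'k)" where
  "rot n F = (\<lambda>(cs, x). coact x (\<lambda>y b. F (act (cs ! n) b # take n cs, y)))"

lemma degen_app:
  "length us = k \<Longrightarrow> degen k F (us @ a # vs, x) = C.sweedler a (\<lambda>u v. F (us @ u # v # vs, x))"
  by (simp add: degen_def split_fun_app)

lemma rot_app: "length us = n \<Longrightarrow> rot n F (us @ [c], x) = coact x (\<lambda>y b. F (act c b # us, y))"
  by (simp add: rot_def nth_append)

lemma list_splitE: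
  assumes "length cs = n" "k < n"
  obtains us a vs where "cs = us @ a # vs" "length us = k" "length vs = n - Suc k"
  using id_take_nth_drop[of k cs] assms by (metis length_drop length_take min.absorb4)

lemma length_Suc_snocE:
  assumes "length cs = Suc n"
  obtains us c where "cs = us @ [c]" "length us = n"
  using assms by (cases cs rule: rev_cases) auto

lemma cycmap_face_less:
  assumes F: "cycmap N n F" and k: "k \<le> n"
  shows "cycmap N (Suc n) (\<lambda>(cs, x). F (C.absorb k cs, x))"
proof (rule cycmapI; simp only: prod.case)
  show "C.tensor N (Suc (Suc n)) (\<lambda>cs. F (C.absorb k cs, x))" for x
    using C.tensor_absorb[OF cycmapD(1)[OF F] k] .
  show "linmod N scX (\<lambda>x. F (C.absorb k cs, x))" if "length cs = Suc (Suc n)" for cs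
    using that k by (intro cycmapD(2)[OF F]) (simp add: C.absorb_def)
  show "F (C.absorb k (cs @ [act c (\<xi> r)]), x) \<approx>[N] F (C.absorb k (cs @ [c]), lX r x)"
    if len: "length cs = Suc n" for cs c r x
  proof -
    obtain us a vs where cs: "cs = us @ a # vs" "length us = k" "length vs = Suc n - Suc k"
      by (rule list_splitE[OF len, of k]) (use k in auto)
    show ?thesis
    proof (cases vs)
      \<comment> \<open>The last entry is the one that receives the scalar. The two actions on it
        commute because the ranges of \<open>\<xi>\<close> and \<open>\<zeta>\<close> do.\<close>
      case Nil
      have "F (us @ [act (act c (\<zeta> (\<epsilon>C a))) (\<xi> r)], x) \<approx>[N] F (us @ [act c (\<zeta> (\<epsilon>C a))], lX r x)"
        using cs Nil k by (intro cycmapD(3)[OF F]) simp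
      then show ?thesis
        using cs(2) by (simp add: cs(1) Nil absorb_app C.ract_mult[symmetric] xi_zeta)
    next
      case (Cons b vs')
      have "F ((us @ act b (\<zeta> (\<epsilon>C a)) # vs') @ [act c (\<xi> r)], x)
          \<approx>[N] F ((us @ act b (\<zeta> (\<epsilon>C a)) # vs') @ [c], lX r x)"
        using cs Cons k by (intro cycmapD(3)[OF F]) simp
      then show ?thesis
        using cs(2) by (simp add: cs(1) Cons absorb_app)
    qed
  qed
  show "F (C.absorb k (act c (\<zeta> r) # cs), x) \<approx>[N] F (C.absorb k (c # cs), ractX x r)"
    if len: "length cs = Suc n" for cs c r x
  proof (cases k)
    \<comment> \<open>The first entry itself is absorbed: left linearity of the counit and
      antimultiplicativity of \<open>\<zeta>\<close> pass \<open>r\<close> on to the new first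
      entry.\<close>
    case 0
    obtain d cs' where cs: "cs = d # cs'" "length cs' = n"
      using len by (metis length_Suc_conv)
    have "F (act (act d (\<zeta> (\<epsilon>C c))) (\<zeta> r) # cs', x) \<approx>[N] F (act d (\<zeta> (\<epsilon>C c)) # cs', ractX x r)"
      using cs by (intro cycmapD(4)[OF F])
    then show ?thesis
      by (simp add: 0 cs(1) C.absorb_0 C.counit_lact zeta_mult C.ract_mult)
  next
    case (Suc k')
    have "F (act c (\<zeta> r) # C.absorb k' cs, x) \<approx>[N] F (c # C.absorb k' cs, ractX x r)"
      using Suc k len by (intro cycmapD(4)[OF F]) (simp add: C.absorb_def)
    then show ?thesis
      by (simp add: Suc C.absorb_Suc)
  qed
qed

text \<open>The scalar goes into \<open>x\<close>, so the tensor sign in front of the absorbed entry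
  becomes the one between the new last entry and \<open>x\<close>. That boundary is governed by a
  cyclic relation instead of a relation of the tensor power.\<close>

lemma cycmap_face_last:
  assumes F: "cycmap N n F"
  shows "cycmap N (Suc n) (\<lambda>(cs, x). F (take (Suc n) cs, lX (\<epsilon>C (cs ! Suc n)) x))"
proof (rule cycmapI; simp only: prod.case)
  show "C.tensor N (Suc (Suc n)) (\<lambda>cs. F (take (Suc n) cs, lX (\<epsilon>C (cs ! Suc n)) x))" for x
    unfolding tens_iff
  proof (intro conjI allI impI)
    fix us vs :: "'c list" assume len: "length us + length vs + 1 = Suc (Suc n)"
    show "linmod N scC (\<lambda>m. F (take (Suc n) (us @ m # vs), lX (\<epsilon>C ((us @ m # vs) ! Suc n)) x))"
    proof (cases vs rule: rev_cases)
      case Nil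
      have "linmod N scC (\<lambda>m. F (us, lX (\<epsilon>C m) x))"
        using len Nil by (intro linmod_comp[OF linmod_lX_left[OF cycmapD(2)[OF F]]])
          (simp_all add: C.counit_add C.counit_sc)
      then show ?thesis
        using len Nil by (simp add: nth_append)
    next
      case (snoc vs' c)
      have "linmod N scC (\<lambda>m. F (us @ m # vs', lX (\<epsilon>C c) x))"
        using len snoc by (intro cycmap_slot(1)[OF F]) simp
      moreover have "n = length us + length vs'"
        using len snoc by simp
      then have "take (Suc n) (us @ m # vs) = us @ m # vs'" "(us @ m # vs) ! Suc n = c" for m
        by (simp_all add: snoc nth_append)
      ultimately show ?thesis by simp
    qed
  next
    fix us vs :: "'c list" and a b r assume len: "length us + length vs + 2 = Suc (Suc n)"
    show "F (take (Suc n) (us @ act a (\<xi> r) # b # vs), lX (\<epsilon>C ((us @ act a (\<xi> r) # b # vs) ! Suc n)) x)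
        \<approx>[N] F (take (Suc n) (us @ a # act b (\<zeta> r) # vs), lX (\<epsilon>C ((us @ a # act b (\<zeta> r) # vs) ! Suc n)) x)"
    proof (cases vs rule: rev_cases)
      case Nil
      have "F (us @ [act a (\<xi> r)], lX (\<epsilon>C b) x) \<approx>[N] F (us @ [a], lX r (lX (\<epsilon>C b) x))"
        using len Nil by (intro cycmapD(3)[OF F]) simp
      then show ?thesis
        using len Nil by (simp add: nth_append C.counit_lact lX_mult)
    next
      case (snoc vs' c)
      have "F (us @ act a (\<xi> r) # b # vs', lX (\<epsilon>C c) x) \<approx>[N] F (us @ a # act b (\<zeta> r) # vs', lX (\<epsilon>C c) x)"
        using len snoc by (intro cycmap_slot(2)[OF F]) simp
      moreover have "n = Suc (length us + length vs')"
        using len snoc by simp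
      then have "take (Suc n) (us @ d # e # vs) = us @ d # e # vs'" "(us @ d # e # vs) ! Suc n = c" for d e
        by (simp_all add: snoc nth_append)
      ultimately show ?thesis by simp
    qed
  qed
  show "linmod N scX (\<lambda>x. F (take (Suc n) cs, lX (\<epsilon>C (cs ! Suc n)) x))" if "length cs = Suc (Suc n)" for cs
    using that by (intro linmod_lX cycmapD(2)[OF F]) simp
  show "F (take (Suc n) (cs @ [act c (\<xi> r)]), lX (\<epsilon>C ((cs @ [act c (\<xi> r)]) ! Suc n)) x)
      \<approx>[N] F (take (Suc n) (cs @ [c]), lX (\<epsilon>C ((cs @ [c]) ! Suc n)) (lX r x))"
    if "length cs = Suc n" for cs c r x
    using that by (simp add: nth_append C.counit_ract lX_mult)
  show "F (take (Suc n) (act c (\<zeta> r) # cs), lX (\<epsilon>C ((act c (\<zeta> r) # cs) ! Suc n)) x)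
      \<approx>[N] F (take (Suc n) (c # cs), lX (\<epsilon>C ((c # cs) ! Suc n)) (ractX x r))"
    if "length cs = Suc n" for cs c r x
    using that cycmapD(4)[OF F, of "take n cs" c r "lX (\<epsilon>C (cs ! n)) x"] by (simp add: ractX_lX)
qed

lemma cycmap_face:
  assumes "cycmap N n F" "k \<le> Suc n"
  shows "cycmap N (Suc n) (\<lambda>s. F (face (Suc n) k s))"
proof (cases "k \<le> n")
  case True
  have "(\<lambda>s. F (face (Suc n) k s)) = (\<lambda>(cs, x). F (C.absorb k cs, x))"
    using True by auto
  then show ?thesis
    using cycmap_face_less[OF assms(1) True] by simp
next
  case False
  then have "(\<lambda>s. F (face (Suc n) k s)) = (\<lambda>(cs, x). F (take (Suc n) cs, lX (\<epsilon>C (cs ! Suc n)) x))"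
    by auto
  then show ?thesis
    using cycmap_face_last[OF assms(1)] by simp
qed

lemma cycmap_bil:
  assumes F: "cycmap N (Suc n) F" and "length us + length vs = n"
  shows "C.bil N (\<lambda>u v. F (us @ u # v # vs, x))"
proof (rule C.bilI)
  show "linmod N scC (\<lambda>u. F (us @ u # v # vs, x))" for v
    using assms(2) by (intro cycmap_slot(1)[OF F]) simp
  have "linmod N scC (\<lambda>v. F ((us @ [u]) @ v # vs, x))" for u
    using assms(2) by (intro cycmap_slot(1)[OF F]) simp
  then show "linmod N scC (\<lambda>v. F (us @ u # v # vs, x))" for u
    by simp
  show "F (us @ act u (\<xi> r) # v # vs, x) \<approx>[N] F (us @ u # act v (\<zeta> r) # vs, x)" for u v r
    using assms(2) by (intro cycmap_slot(2)[OF F]) simp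
qed

lemma cycmap_degen:
  assumes F: "cycmap N (Suc n) F" and k: "k \<le> n"
  shows "cycmap N n (degen k F)"
proof (rule cycmapI)
  show "C.tensor N (Suc n) (\<lambda>cs. degen k F (cs, x))" for x
    using C.tensor_split_fun[OF cycmapD(1)[OF F] k] by (simp add: degen_def)
  show "linmod N scX (\<lambda>x. degen k F (cs, x))" if "length cs = Suc n" for cs
    unfolding degen_def prod.case C.split_fun_def using that k
    by (intro C.linmod_sweedler cycmapD(2)[OF F]) simp
  show "degen k F (cs @ [act c (\<xi> r)], x) \<approx>[N] degen k F (cs @ [c], lX r x)" if len: "length cs = n" for cs c r x
  proof (cases "k = n")
    case True
    have "degen k F (cs @ [act c (\<xi> r)], x) = C.sweedler (act c (\<xi> r)) (\<lambda>u v. F (cs @ [u, v], x))"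
      using True len by (simp add: degen_app)
    also have "\<dots> \<approx>[N] C.sweedler c (\<lambda>u v. F (cs @ [u, act v (\<xi> r)], x))"
      using len by (intro C.sweedler_ract cycmap_bil[OF F]) simp
    also have "\<dots> \<approx>[N] C.sweedler c (\<lambda>u v. F (cs @ [u, v], lX r x))"
    proof (rule C.sweedler_cong)
      show "F (cs @ [u, act v (\<xi> r)], x) \<approx>[N] F (cs @ [u, v], lX r x)" for u v
        using cycmapD(3)[OF F, of "cs @ [u]"] len by simp
    qed
    finally show ?thesis
      using True len by (simp add: degen_app)
  next
    case False
    obtain us a vs where cs: "cs = us @ a # vs" "length us = k" "length vs = n - Suc k"
      by (rule list_splitE[OF len, of k]) (use k False in auto)
    have "F (us @ u # v # vs @ [act c (\<xi> r)], x) \<approx>[N] F (us @ u # v # vs @ [c], lX r x)" for u v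
      using cycmapD(3)[OF F, of "us @ u # v # vs"] cs len by simp
    then show ?thesis
      unfolding cs(1) append.assoc append_Cons degen_app[OF cs(2)] by (rule C.sweedler_cong)
  qed
  show "degen k F (act c (\<zeta> r) # cs, x) \<approx>[N] degen k F (c # cs, ractX x r)" if len: "length cs = n" for cs c r x
  proof (cases k)
    case 0
    have "degen k F (act c (\<zeta> r) # cs, x) = C.sweedler (act c (\<zeta> r)) (\<lambda>u v. F ([] @ u # v # cs, x))"
      using 0 degen_app[of "[]"] by simp
    also have "\<dots> \<approx>[N] C.sweedler c (\<lambda>u v. F ([] @ act u (\<zeta> r) # v # cs, x))"
      using len by (intro C.sweedler_lact cycmap_bil[OF F]) simp
    also have "\<dots> \<approx>[N] C.sweedler c (\<lambda>u v. F ([] @ u # v # cs, ractX x r))"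
      using cycmapD(4)[OF F] len by (intro C.sweedler_cong) simp
    finally show ?thesis
      using 0 degen_app[of "[]" 0 F c cs "ractX x r"] by simp
  next
    case (Suc k')
    obtain us a vs where cs: "cs = us @ a # vs" "length us = k'" "length vs = n - Suc k'"
      by (rule list_splitE[OF len, of k']) (use k Suc in auto)
    have "F (act c (\<zeta> r) # us @ u # v # vs, x) \<approx>[N] F (c # us @ u # v # vs, ractX x r)" for u v
      using cycmapD(4)[OF F, of "us @ u # v # vs"] cs len by simp
    moreover have "degen k F (d # us @ a # vs, z) = C.sweedler a (\<lambda>u v. F (d # us @ u # v # vs, z))" for d z
      using cs(2) Suc degen_app[of "d # us" k F a vs z] by simp
    ultimately show ?thesis
      unfolding cs(1) by (simp only:) (rule C.sweedler_cong)
  qed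
qed

text \<open>Balance over \<open>R\<close> in \<open>X \<otimes> B\<close> is exactly the cyclic
  relation between \<open>x\<close> and the first entry; this is what makes the rotation formula
  independent of the representative of the coaction.\<close>

lemma cobil_rot:
  assumes F: "cycmap N n F" and "length cs = n"
  shows "cobil N (\<lambda>y b. F (act c b # cs, y))"
proof (rule cobilI)
  show "linmod N scX (\<lambda>y. F (act c b # cs, y))" for b
    using assms(2) by (intro cycmapD(2)[OF F]) simp
  show "linmod N scB (\<lambda>b. F (act c b # cs, y))" for y
    using assms(2) cycmap_slot(1)[OF F, of "[]"] by (intro linmod_act) simp
  show "F (act c b # cs, ractX y r) \<approx>[N] F (act c (b * \<zeta> r) # cs, y)" for y r b
    using cycmapD(4)[OF F assms(2), of "act c b" r y] by (simp add: C.ract_mult eqmod_sym)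
qed

text \<open>Rotation shifts the boundaries of the circle. The one in front of the last entry becomes
  the boundary to \<open>x\<close> and needs \<open>coact_takeuchi\<close>; the one between the last
  entry and \<open>x\<close> needs \<open>coact_of_lX\<close>; the one between \<open>x\<close> and
  the first entry becomes an inner boundary and needs \<open>coact_of_ract\<close>.\<close>

lemma cycmap_rot:
  assumes F: "cycmap N n F"
  shows "cycmap N n (rot n F)"
proof (rule cycmapI)
  show "C.tensor N (Suc n) (\<lambda>cs. rot n F (cs, x))" for x
    unfolding tens_iff
  proof (intro conjI allI impI)
    fix us vs :: "'c list" assume len: "length us + length vs + 1 = Suc n"
    show "linmod N scC (\<lambda>m. rot n F (us @ m # vs, x))"
    proof (cases vs rule: rev_cases)
      case Nil
      have "linmod N scC (\<lambda>m. F (act m b # us, y))" for b y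
        using len Nil cycmap_slot(1)[OF F, of "[]" us] by (intro linmod_act_left) simp
      moreover have "rot n F (us @ m # vs, x) = coact x (\<lambda>y b. F (act m b # us, y))" for m
        using len Nil by (simp add: rot_app)
      ultimately show ?thesis
        by (simp only:) (rule linmod_coact)
    next
      case (snoc vs' c)
      have "linmod N scC (\<lambda>m. F (act c b # us @ m # vs', y))" for b y
        using len snoc cycmap_slot(1)[OF F, of "act c b # us" vs'] by simp
      moreover have "rot n F (us @ m # vs, x) = coact x (\<lambda>y b. F (act c b # us @ m # vs', y))" for m
        using len snoc rot_app[of "us @ m # vs'" n F c x] by simp
      ultimately show ?thesis
        by (simp only:) (rule linmod_coact)
    qed
  next
    fix us vs :: "'c list" and a b r assume len: "length us + length vs + 2 = Suc n"
    show "rot n F (us @ act a (\<xi> r) # b # vs, x) \<approx>[N] rot n F (us @ a # act b (\<zeta> r) # vs, x)"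
    proof (cases vs rule: rev_cases)
      case Nil
      have "rot n F (us @ act a (\<xi> r) # b # vs, x) = coact x (\<lambda>y e. F (act b e # us @ [act a (\<xi> r)], y))"
        using len Nil rot_app[of "us @ [act a (\<xi> r)]" n F b x] by simp
      also have "\<dots> \<approx>[N] coact x (\<lambda>y e. F (act b e # us @ [a], lX r y))"
      proof (rule coact_cong)
        show "F (act b e # us @ [act a (\<xi> r)], y) \<approx>[N] F (act b e # us @ [a], lX r y)" for y e
          using cycmapD(3)[OF F, of "act b e # us"] len Nil by simp
      qed
      also have "\<dots> \<approx>[N] coact x (\<lambda>y e. F (act b (\<zeta> r * e) # us @ [a], y))"
        using len Nil by (intro coact_takeuchi[OF cobil_rot[OF F]]) simp
      also have "\<dots> = rot n F (us @ a # act b (\<zeta> r) # vs, x)"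
        using len Nil rot_app[of "us @ [a]" n F "act b (\<zeta> r)" x] by (simp add: C.ract_mult)
      finally show ?thesis .
    next
      case (snoc vs' c)
      have "F (act c e # us @ act a (\<xi> r) # b # vs', y) \<approx>[N] F (act c e # us @ a # act b (\<zeta> r) # vs', y)" for e y
        using len snoc cycmap_slot(2)[OF F, of "act c e # us" vs'] by simp
      moreover have "rot n F (us @ d # e # vs, x) = coact x (\<lambda>y b. F (act c b # us @ d # e # vs', y))" for d e
        using len snoc rot_app[of "us @ d # e # vs'" n F c x] by simp
      ultimately show ?thesis
        by (simp only:) (rule coact_cong)
    qed
  qed
  show "linmod N scX (\<lambda>x. rot n F (cs, x))" if "length cs = Suc n" for cs
    using that unfolding rot_def prod.case by (intro linmod_coact_arg cobil_rot[OF F]) simp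
  show "rot n F (cs @ [act c (\<xi> r)], x) \<approx>[N] rot n F (cs @ [c], lX r x)" if len: "length cs = n" for cs c r x
  proof -
    have "rot n F (cs @ [act c (\<xi> r)], x) = coact x (\<lambda>y b. F (act c (\<xi> r * b) # cs, y))"
      using len by (simp add: rot_app C.ract_mult)
    also have "\<dots> \<approx>[N] rot n F (cs @ [c], lX r x)"
      unfolding rot_app[OF len] by (rule eqmod_sym[OF coact_of_lX[OF cobil_rot[OF F len]]])
    finally show ?thesis .
  qed
  show "rot n F (act c (\<zeta> r) # cs, x) \<approx>[N] rot n F (c # cs, ractX x r)" if len: "length cs = n" for cs c r x
  proof (cases cs rule: rev_cases)
    \<comment> \<open>In degree 0 the first entry is also the rotated one. So
      \<open>\<zeta> r\<close> travels once around the circle: into \<open>x\<close> as a left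
      action, back to the entry as a right factor \<open>\<xi> r\<close>, and again into
      \<open>x\<close> as a right action.\<close>
    case Nil
    have n: "n = 0" using len Nil by simp
    have "rot n F (act c (\<zeta> r) # cs, x) = coact x (\<lambda>y b. F (act c (\<zeta> r * b) # [], y))"
      using n Nil rot_app[of "[]"] by (simp add: C.ract_mult)
    also have "\<dots> \<approx>[N] coact x (\<lambda>y b. F ([act c b], lX r y))"
      using n by (intro eqmod_sym[OF coact_takeuchi[OF cobil_rot[OF F]]]) simp
    also have "\<dots> \<approx>[N] coact x (\<lambda>y b. F ([act c (b * \<xi> r)], y))"
    proof (rule coact_cong)
      show "F ([act c b], lX r y) \<approx>[N] F ([act c (b * \<xi> r)], y)" for y b
        using cycmapD(3)[OF F, of "[]" "act c b" r y] n by (simp add: C.ract_mult eqmod_sym)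
    qed
    also have "\<dots> \<approx>[N] coact (ractX x r) (\<lambda>y b. F (act c b # [], y))"
      using n by (intro eqmod_sym[OF coact_of_ract[OF cobil_rot[OF F]]]) simp
    also have "\<dots> = rot n F (c # cs, ractX x r)"
      using n Nil rot_app[of "[]" n F c "ractX x r"] by simp
    finally show ?thesis .
  next
    case (snoc cs' d)
    have "rot n F (act c (\<zeta> r) # cs, x) = coact x (\<lambda>y b. F (act d b # act c (\<zeta> r) # cs', y))"
      using len snoc rot_app[of "act c (\<zeta> r) # cs'" n F d x] by simp
    also have "\<dots> \<approx>[N] coact x (\<lambda>y b. F (act d (b * \<xi> r) # c # cs', y))"
    proof (rule coact_cong)
      show "F (act d b # act c (\<zeta> r) # cs', y) \<approx>[N] F (act d (b * \<xi> r) # c # cs', y)" for y b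
        using cycmap_slot(2)[OF F, of "[]" cs' "act d b" r c y] len snoc by (simp add: C.ract_mult eqmod_sym)
    qed
    also have "\<dots> \<approx>[N] coact (ractX x r) (\<lambda>y b. F (act d b # c # cs', y))"
      using len snoc by (intro eqmod_sym[OF coact_of_ract[OF cobil_rot[OF F]]]) simp
    also have "\<dots> = rot n F (c # cs, ractX x r)"
      using len snoc rot_app[of "c # cs'" n F d "ractX x r"] by simp
    finally show ?thesis .
  qed
qed

end

section \<open>Functions on the tensor product over the bialgebroid\<close>

context module_coring_with_coefficients
begin

definition balmap :: "('t \<Rightarrow>\<^sub>0 'k) set \<Rightarrow> nat \<Rightarrow> ('c list \<times> 'x \<Rightarrow> ('t \<Rightarrow>\<^sub>0 'k)) \<Rightarrow> bool" where
  "balmap N n F \<longleftrightarrow> cycmap N n F \<and> (\<forall>cs x b. length cs = Suc n \<longrightarrow>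
     flin (\<lambda>bs. F (map2 act cs bs, x)) (coprods n b) \<approx>[N] F (cs, lactB b x))"

lemma balmap_cycmap: "balmap N n F \<Longrightarrow> cycmap N n F"
  by (simp add: balmap_def)

lemma balmapD: "balmap N n F \<Longrightarrow> length cs = Suc n \<Longrightarrow>
    flin (\<lambda>bs. F (map2 act cs bs, x)) (coprods n b) \<approx>[N] F (cs, lactB b x)"
  by (simp add: balmap_def)

lemma map2_act_app:
  "length cs = length bs \<Longrightarrow> map2 act (cs @ c # cs') (bs @ b # bs') = map2 act cs bs @ act c b # map2 act cs' bs'"
  by simp

text \<open>The actions of \<open>R\<close> on the coring come from \<open>act\<close>, so the
  relations of tensor powers of \<open>B\<close> go over to those of tensor powers of the
  coring.\<close>

lemma tensor_map2:
  assumes "C.tensor N n F" "length cs = n"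
  shows "tensor N n (\<lambda>bs. F (map2 act cs bs))"
  unfolding tens_iff
proof (intro conjI allI impI)
  fix us vs :: "'b list" assume len: "length us + length vs + 1 = n"
  obtain cs1 c cs2 where cs: "cs = cs1 @ c # cs2" "length cs1 = length us" "length cs2 = n - Suc (length us)"
    by (rule list_splitE[OF assms(2), of "length us"]) (use len in auto)
  have "linmod N scC (\<lambda>m. F (map2 act cs1 us @ m # map2 act cs2 vs))"
    using assms(1) len cs by (simp add: tens_iff)
  then show "linmod N scB (\<lambda>m. F (map2 act cs (us @ m # vs)))"
    unfolding cs(1) map2_act_app[OF cs(2)] by (rule linmod_act)
next
  fix us vs :: "'b list" and a b r assume len: "length us + length vs + 2 = n"
  obtain cs1 c ds where cs1: "cs = cs1 @ c # ds" "length cs1 = length us" "length ds = n - Suc (length us)"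
    by (rule list_splitE[OF assms(2), of "length us"]) (use len in auto)
  then obtain d cs2 where ds: "ds = d # cs2" "length cs2 = length vs"
    using len by (cases ds) auto
  have "F (map2 act cs1 us @ act (act c a) (\<xi> r) # act d b # map2 act cs2 vs)
      \<approx>[N] F (map2 act cs1 us @ act c a # act (act d b) (\<zeta> r) # map2 act cs2 vs)"
    using assms(1) len cs1(2) ds(2) by (simp add: tens_iff)
  then show "F (map2 act cs (us @ a * \<xi> r # b # vs)) \<approx>[N] F (map2 act cs (us @ a # b * \<zeta> r # vs))"
    using cs1(2) by (simp add: cs1(1) ds(1) C.ract_mult)
qed

text \<open>By coassociativity the legs acting on the absorbed entry \<open>c\<close> and on its
  neighbour \<open>d\<close> come from one leg \<open>e\<close>. Since the counit of
  \<open>act c u\<close> is \<open>\<epsilon> (\<xi> (\<epsilon>C c) * u)\<close>,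
  \<open>sweedler_counit_left_xi\<close> contracts them to the action of
  \<open>\<zeta> (\<epsilon>C c) * e\<close> on \<open>d\<close>, that is, \<open>e\<close> acts
  after the absorption.\<close>

lemma balmap_face_less:
  assumes F: "balmap N n F" and k: "k \<le> n" and len: "length cs = Suc (Suc n)"
  shows "flin (\<lambda>bs. F (C.absorb k (map2 act cs bs), x)) (coprods (Suc n) b) \<approx>[N] F (C.absorb k cs, lactB b x)"
proof -
  note Fc = balmap_cycmap[OF F]
  obtain cs1 c ds where cs1: "cs = cs1 @ c # ds" "length cs1 = k" "length ds = Suc (Suc n) - Suc k"
    by (rule list_splitE[OF len, of k]) (use k in auto)
  then obtain d cs2 where ds: "ds = d # cs2" "length cs2 = n - k"
    using k by (cases ds) auto
  let ?F = "\<lambda>bs. F (C.absorb k (map2 act cs bs), x)"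
  have "tensor N (Suc (Suc n)) ?F"
    by (rule tensor_map2[OF C.tensor_absorb[OF cycmapD(1)[OF Fc] k] len])
  then have "flin ?F (coprods (Suc n) b) \<approx>[N] flin (split_fun k ?F) (coprods n b)"
    using k by (intro eqmod_sym[OF coprods_split])
  also have "\<dots> \<approx>[N] flin (\<lambda>bs. F (map2 act (C.absorb k cs) bs, x)) (coprods n b)"
  proof (rule eqmod_flin_coprods)
    fix l :: "'b list" assume l: "length l = Suc n"
    obtain l1 e l2 where le: "l = l1 @ e # l2" "length l1 = k" "length l2 = Suc n - Suc k"
      by (rule list_splitE[OF l, of k]) (use k in auto)
    let ?h = "\<lambda>e. F (map2 act cs1 l1 @ act d e # map2 act cs2 l2, x)"
    have h: "linmod N scB ?h"
      using cs1(2) ds(2) le(2,3) k by (intro linmod_act cycmap_slot(1)[OF Fc]) simp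
    have len1: "length (map2 act cs1 l1) = k"
      using cs1(2) le(2) by simp
    have "split_fun k ?F l = sweedler e (\<lambda>u v. ?h (v * \<zeta> (\<epsilon> (\<xi> (\<epsilon>C c) * u))))"
      unfolding split_fun_def using cs1(2) le(2)
      by (simp add: le(1) cs1(1) ds(1) nth_append absorb_app[OF len1] counit_act C.ract_mult)
    also have "\<dots> \<approx>[N] ?h (\<zeta> (\<epsilon>C c) * e)"
      by (rule sweedler_counit_left_xi[OF h])
    also have "\<dots> = F (map2 act (C.absorb k cs) l, x)"
      using cs1(2) le(2) by (simp add: le(1) cs1(1) ds(1) absorb_app C.ract_mult)
    finally show "split_fun k ?F l \<approx>[N] F (map2 act (C.absorb k cs) l, x)" .
  qed
  also have "\<dots> \<approx>[N] F (C.absorb k cs, lactB b x)"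
    using k len by (intro balmapD[OF F]) (simp add: C.absorb_def)
  finally show ?thesis .
qed

lemma sweedler_act:
  assumes "C.bil N f"
  shows "C.sweedler (act c b) f \<approx>[N] C.sweedler c (\<lambda>p q. sweedler b (\<lambda>u v. f (act p u) (act q v)))"
  using C.sweedler_eqI[OF assms coprod_act[OF C.coprod_rep_in coprod_rep_in]]
  by - (rule eqmod_sym, simp add: C.sweedler_def sweedler_def fs.lext_flin)

text \<open>Compatibility of the coproduct with the action splits the leg that meets the split
  entry; \<open>coprods_split\<close> turns the result into the longer diagonal action.\<close>

lemma balmap_degen:
  assumes F: "balmap N (Suc n) F" and k: "k \<le> n"
  shows "balmap N n (degen k F)"
  unfolding balmap_def
proof (intro conjI allI impI)
  note Fc = balmap_cycmap[OF F]
  show "cycmap N n (degen k F)"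
    by (rule cycmap_degen[OF Fc k])
  fix cs :: "'c list" and x b assume len: "length cs = Suc n"
  obtain us c vs where cs: "cs = us @ c # vs" "length us = k" "length vs = Suc n - Suc k"
    by (rule list_splitE[OF len, of k]) (use k in auto)
  let ?G = "\<lambda>p q bs. F (map2 act (us @ p # q # vs) bs, x)"
  have G: "tensor N (Suc (Suc n)) (?G p q)" for p q
    using cs len by (intro tensor_map2[OF cycmapD(1)[OF Fc]]) simp
  have "flin (\<lambda>bs. degen k F (map2 act cs bs, x)) (coprods n b)
      \<approx>[N] flin (\<lambda>bs. C.sweedler c (\<lambda>p q. split_fun k (?G p q) bs)) (coprods n b)"
  proof (rule eqmod_flin_coprods)
    fix l :: "'b list" assume l: "length l = Suc n"
    obtain l1 e l2 where le: "l = l1 @ e # l2" "length l1 = k" "length l2 = Suc n - Suc k"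
      by (rule list_splitE[OF l, of k]) (use k in auto)
    have "degen k F (map2 act cs l, x) = C.sweedler (act c e) (\<lambda>u v. F (map2 act us l1 @ u # v # map2 act vs l2, x))"
      using cs(2) le(2) by (simp add: cs(1) le(1) degen_app)
    also have "\<dots> \<approx>[N] C.sweedler c (\<lambda>p q. sweedler e (\<lambda>u v. F (map2 act us l1 @ act p u # act q v # map2 act vs l2, x)))"
      using cs(2,3) le(2,3) k by (intro sweedler_act cycmap_bil[OF Fc]) simp
    also have "\<dots> = C.sweedler c (\<lambda>p q. split_fun k (?G p q) l)"
      using cs(2) le(2) by (simp add: split_fun_def le(1) nth_append)
    finally show "degen k F (map2 act cs l, x) \<approx>[N] C.sweedler c (\<lambda>p q. split_fun k (?G p q) l)" .
  qed
  also have "\<dots> = C.sweedler c (\<lambda>p q. flin (split_fun k (?G p q)) (coprods n b))"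
    unfolding C.sweedler_def by (rule fs.lext_commute)
  also have "\<dots> \<approx>[N] C.sweedler c (\<lambda>p q. flin (?G p q) (coprods (Suc n) b))"
    by (intro C.sweedler_cong coprods_split[OF G k])
  also have "\<dots> \<approx>[N] C.sweedler c (\<lambda>p q. F (us @ p # q # vs, lactB b x))"
    using cs len by (intro C.sweedler_cong balmapD[OF F]) simp
  also have "\<dots> = degen k F (cs, lactB b x)"
    by (simp add: cs(1) degen_app[OF cs(2)])
  finally show "flin (\<lambda>bs. degen k F (map2 act cs bs, x)) (coprods n b) \<approx>[N] degen k F (cs, lactB b x)" .
qed

lemma flin_coact_commute:
  "flin (\<lambda>l. coact x (\<lambda>y e. f l y e)) p = coact x (\<lambda>y e. flin (\<lambda>l. f l y e) p)"
  unfolding coact_def case_prod_unfold by (rule fs.lext_commute)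

text \<open>Moving \<open>b\<^sub>+\<close> across the tensor product produces \<open>b\<^sub>- b\<^sub>+\<^sup>(\<^sup>1\<^sup>) \<otimes> b\<^sub>+\<^sup>(\<^sup>2\<^sup>) = 1 \<otimes> b\<close>.\<close>

lemma rot_lactB:
  assumes F: "balmap N n F" and len: "length cs = n"
  shows "coact (lactB b x) (\<lambda>y e. F (act c e # cs, y)) \<approx>[N]
    sweedler b (\<lambda>u v. coact x (\<lambda>y e. translate u (\<lambda>m p.
      flin (\<lambda>l. F (map2 act (act c (v * e * m) # cs) l, y)) (coprods n p))))"
proof -
  have "coact (lactB b x) (\<lambda>y e. F (act c e # cs, y))
      \<approx>[N] sweedler b (\<lambda>u v. coact x (\<lambda>y e. translate u (\<lambda>m p. F (act c (v * e * m) # cs, lactB p y))))"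
    by (rule coact_lactB[OF cobil_rot[OF balmap_cycmap[OF F] len]])
  also have "\<dots> \<approx>[N] sweedler b (\<lambda>u v. coact x (\<lambda>y e. translate u (\<lambda>m p.
      flin (\<lambda>l. F (map2 act (act c (v * e * m) # cs) l, y)) (coprods n p))))"
    using len by (intro sweedler_cong coact_cong translate_cong eqmod_sym[OF balmapD[OF F]]) simp
  finally show ?thesis .
qed

text \<open>With a single entry, \<open>m\<close> and \<open>p\<close> act on the same place and
  only \<open>translate_counit\<close> is available. The resulting scalar
  \<open>\<xi> (\<epsilon> u)\<close> goes into \<open>x\<close> by the cyclic relation and returns
  by \<open>coact_takeuchi\<close> as a right factor \<open>\<zeta> (\<epsilon> u)\<close> of
  \<open>v\<close>, where the counit axiom restores \<open>b\<close>.\<close>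

lemma balmap_rot_0:
  assumes F: "balmap N 0 F"
  shows "coact (lactB b x) (\<lambda>y e. F ([act c e], y)) \<approx>[N] coact x (\<lambda>y e. F ([act c (b * e)], y))"
proof -
  note Fc = balmap_cycmap[OF F]
  have lin: "linmod N scB (\<lambda>z. F ([act c z], y))" for y c
    using cycmap_slot(1)[OF Fc, of "[]" "[]"] by (intro linmod_act) simp
  have "coact (lactB b x) (\<lambda>y e. F ([act c e], y))
      \<approx>[N] sweedler b (\<lambda>u v. coact x (\<lambda>y e. translate u (\<lambda>m p. F ([act (act c (v * e)) (m * p)], y))))"
    using rot_lactB[OF F, of "[]" b x c] by (simp add: C.ract_mult mult.assoc)
  also have "\<dots> \<approx>[N] sweedler b (\<lambda>u v. coact x (\<lambda>y e. F ([act (act c (v * e)) (\<xi> (\<epsilon> u))], y)))"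
    by (intro sweedler_cong coact_cong translate_counit lin)
  also have "\<dots> \<approx>[N] sweedler b (\<lambda>u v. coact x (\<lambda>y e. F ([act (act c v) e], lX (\<epsilon> u) y)))"
  proof (intro sweedler_cong coact_cong)
    show "F ([act (act c (v * e)) (\<xi> (\<epsilon> u))], y) \<approx>[N] F ([act (act c v) e], lX (\<epsilon> u) y)" for u v y e
      using cycmapD(3)[OF Fc, of "[]"] by (simp add: C.ract_mult)
  qed
  also have "\<dots> \<approx>[N] sweedler b (\<lambda>u v. coact x (\<lambda>y e. F ([act (act c v) (\<zeta> (\<epsilon> u) * e)], y)))"
    by (intro sweedler_cong coact_takeuchi cobil_rot[OF Fc]) simp
  also have "\<dots> = sweedler b (\<lambda>u v. coact x (\<lambda>y e. F ([act (act c (v * \<zeta> (\<epsilon> u))) e], y)))"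
    by (simp add: C.ract_mult mult.assoc)
  also have "\<dots> \<approx>[N] coact x (\<lambda>y e. F ([act (act c b) e], y))"
  proof (rule sweedler_counit_left[of N "\<lambda>v. coact x (\<lambda>y e. F ([act (act c v) e], y))"])
    show "linmod N scB (\<lambda>v. coact x (\<lambda>y e. F ([act (act c v) e], y)))"
      using cycmap_slot(1)[OF Fc, of "[]" "[]"]
      by (intro linmod_coact linmod_act[of N "\<lambda>c. F ([act c _], _)"] linmod_act_left[of N "\<lambda>c. F ([c], _)"]) simp
  qed
  finally show ?thesis
    by (simp add: C.ract_mult)
qed

text \<open>After the Galois identity the rotated entry sees only the second leg of
  \<open>b\<close>, acting before the coaction, while the first leg acts diagonally on all other
  entries.\<close>

lemma balmap_rot_Suc:
  assumes F: "balmap N (Suc n) F" and len: "length cs = Suc n"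
  shows "coact (lactB b x) (\<lambda>y e. F (act c e # cs, y))
    \<approx>[N] sweedler b (\<lambda>u v. coact x (\<lambda>y e. flin (\<lambda>l. F (act c (v * e) # map2 act cs l, y)) (coprods n u)))"
proof -
  note Fc = balmap_cycmap[OF F]
  \<comment> \<open>\<open>s\<close> acts on the rotated entry and \<open>t\<close> diagonally on
    the rest. This is the two-variable form in which the Galois identity replaces
    \<open>m * s\<close> and \<open>t\<close> by \<open>1\<close> and \<open>u\<close>.\<close>
  let ?g = "\<lambda>d y s t. flin (\<lambda>l. F (act d s # map2 act cs l, y)) (coprods n t)"
  have g: "bil N (?g d y)" for d y
  proof -
    have "tensor N (Suc (Suc n)) (\<lambda>bs. F (map2 act (d # cs) bs, y))"
      using len by (intro tensor_map2[OF cycmapD(1)[OF Fc]]) simp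
    from bil_coprods[OF this] show ?thesis by simp
  qed
  have "coact (lactB b x) (\<lambda>y e. F (act c e # cs, y))
      \<approx>[N] sweedler b (\<lambda>u v. coact x (\<lambda>y e. translate u (\<lambda>m p.
        sweedler p (\<lambda>s t. ?g (act c (v * e)) y (m * s) t))))"
    using rot_lactB[OF F len, of b x c] by (simp add: flin_coprods_Suc C.ract_mult del: coprods.simps)
  also have "\<dots> \<approx>[N] sweedler b (\<lambda>u v. coact x (\<lambda>y e. ?g (act c (v * e)) y 1 u))"
    by (intro sweedler_cong coact_cong translate_galois g)
  finally show ?thesis
    by (simp add: C.ract_one)
qed

lemma balmap_rot:
  assumes F: "balmap N n F"
  shows "balmap N n (rot n F)"
  unfolding balmap_def
proof (intro conjI allI impI)
  note Fc = balmap_cycmap[OF F]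
  show "cycmap N n (rot n F)"
    by (rule cycmap_rot[OF Fc])
  fix cs :: "'c list" and x b assume len: "length cs = Suc n"
  obtain ds c where cs: "cs = ds @ [c]" "length ds = n"
    by (rule length_Suc_snocE[OF len])
  show "flin (\<lambda>bs. rot n F (map2 act cs bs, x)) (coprods n b) \<approx>[N] rot n F (cs, lactB b x)"
  proof (cases n)
    case 0
    have "coact (lactB b x) (\<lambda>y e. F ([act c e], y)) \<approx>[N] coact x (\<lambda>y e. F ([act c (b * e)], y))"
      using F 0 by (intro balmap_rot_0) simp
    then show ?thesis
      using cs 0 by (simp add: rot_def C.ract_mult eqmod_sym)
  next
    case (Suc n')
    have "tensor N (Suc (Suc n')) (\<lambda>bs. rot n F (map2 act cs bs, x))"
      using tensor_map2[OF cycmapD(1)[OF cycmap_rot[OF Fc]] len] by (simp add: Suc)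
    \<comment> \<open>The leg \<open>v\<close> acts on the last entry, which is about to be rotated;
      the legs of \<open>u\<close> act on those that stay.\<close>
    from coprods_snoc[OF this]
    have "flin (\<lambda>bs. rot n F (map2 act cs bs, x)) (coprods n b)
        \<approx>[N] sweedler b (\<lambda>u v. flin (\<lambda>l. rot n F (map2 act cs (l @ [v]), x)) (coprods n' u))"
      by (simp only: Suc)
    also have "\<dots> \<approx>[N] sweedler b (\<lambda>u v. flin (\<lambda>l. coact x (\<lambda>y e. F (act c (v * e) # map2 act ds l, y))) (coprods n' u))"
    proof (intro sweedler_cong eqmod_flin_coprods eqmod_reflI)
      fix l :: "'b list" and v assume l: "length l = Suc n'"
      have "map2 act cs (l @ [v]) = map2 act ds l @ [act c v]"
        using cs(2) l by (simp add: cs(1) Suc)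
      then show "rot n F (map2 act cs (l @ [v]), x) = coact x (\<lambda>y e. F (act c (v * e) # map2 act ds l, y))"
        using cs(2) l by (simp add: rot_app Suc C.ract_mult)
    qed
    also have "\<dots> = sweedler b (\<lambda>u v. coact x (\<lambda>y e. flin (\<lambda>l. F (act c (v * e) # map2 act ds l, y)) (coprods n' u)))"
      by (simp only: flin_coact_commute)
    also have "\<dots> \<approx>[N] coact (lactB b x) (\<lambda>y e. F (act c e # ds, y))"
      using F cs(2) by (intro eqmod_sym[OF balmap_rot_Suc]) (simp_all add: Suc)
    also have "\<dots> = rot n F (cs, lactB b x)"
      by (simp add: cs(1) rot_app[OF cs(2)])
    finally show ?thesis .
  qed
qed

text \<open>The counit of the rotated entry is
  \<open>\<epsilon> (\<xi> (\<epsilon>C c) * e)\<close>. Absorbed by the next entry and carried over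
  to \<open>x\<close> by the cyclic relation, it yields precisely the defining formula of the left
  action on a comodule.\<close>

lemma rot_face_0:
  assumes F: "cycmap N n F" and len: "length cs = Suc (Suc n)"
  shows "rot (Suc n) (\<lambda>s. F (face (Suc n) 0 s)) (cs, x) \<approx>[N] F (face (Suc n) (Suc n) (cs, x))"
proof -
  obtain d ds where "cs = d # ds" "length ds = Suc n"
    using len by (metis length_Suc_conv)
  moreover obtain us c where "ds = us @ [c]" "length us = n"
    by (rule length_Suc_snocE[OF \<open>length ds = Suc n\<close>])
  ultimately have cs: "cs = (d # us) @ [c]" "length us = n" by simp_all
  have "rot (Suc n) (\<lambda>s. F (face (Suc n) 0 s)) (cs, x)
      = coact x (\<lambda>y e. F (act d (\<zeta> (\<epsilon> (\<xi> (\<epsilon>C c) * e))) # us, y))"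
    using rot_app[of "d # us" "Suc n" "\<lambda>s. F (face (Suc n) 0 s)" c x] cs(2) by (simp add: cs(1) C.absorb_0 counit_act)
  also have "\<dots> \<approx>[N] coact x (\<lambda>y e. F (d # us, ractX y (\<epsilon> (\<xi> (\<epsilon>C c) * e))))"
    using cs(2) by (intro coact_cong cycmapD(4)[OF F])
  also have "\<dots> \<approx>[N] F (d # us, lX (\<epsilon>C c) x)"
    using cs(2) by (intro coact_lX cycmapD(2)[OF F]) simp
  also have "\<dots> = F (face (Suc n) (Suc n) (cs, x))"
    using cs(2) by (simp add: cs(1) nth_append)
  finally show ?thesis .
qed

lemma balmap_face:
  assumes F: "balmap N n F" and k: "k \<le> Suc n"
  shows "balmap N (Suc n) (\<lambda>s. F (face (Suc n) k s))"
proof -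
  note Fc = balmap_cycmap[OF F]
  have less: "balmap N (Suc n) (\<lambda>s. F (face (Suc n) k s))" if k: "k \<le> n" for k
  proof -
    have "cycmap N (Suc n) (\<lambda>s. F (face (Suc n) k s))"
      using k by (intro cycmap_face[OF Fc]) simp
    then show ?thesis
      unfolding balmap_def using balmap_face_less[OF F k] k by simp
  qed
  show ?thesis
  proof (cases "k \<le> n")
    case True
    then show ?thesis by (rule less)
  next
    case False
    then have k: "k = Suc n" using k by simp
    let ?G = "rot (Suc n) (\<lambda>s. F (face (Suc n) 0 s))"
    have G: "balmap N (Suc n) ?G"
      by (rule balmap_rot[OF less]) simp
    show ?thesis
      unfolding balmap_def k
    proof (intro conjI allI impI)
      show "cycmap N (Suc n) (\<lambda>s. F (face (Suc n) (Suc n) s))"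
        by (rule cycmap_face[OF Fc]) simp
      fix cs :: "'c list" and x b assume len: "length cs = Suc (Suc n)"
      have "flin (\<lambda>bs. F (face (Suc n) (Suc n) (map2 act cs bs, x))) (coprods (Suc n) b)
          \<approx>[N] flin (\<lambda>bs. ?G (map2 act cs bs, x)) (coprods (Suc n) b)"
        using len by (intro eqmod_flin_coprods eqmod_sym[OF rot_face_0[OF Fc]]) simp
      also have "\<dots> \<approx>[N] ?G (cs, lactB b x)"
        by (rule balmapD[OF G len])
      also have "\<dots> \<approx>[N] F (face (Suc n) (Suc n) (cs, lactB b x))"
        by (rule rot_face_0[OF Fc len])
      finally show "flin (\<lambda>bs. F (face (Suc n) (Suc n) (map2 act cs bs, x))) (coprods (Suc n) b)
          \<approx>[N] F (face (Suc n) (Suc n) (cs, lactB b x))" .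
    qed
  qed
qed

end

section \<open>The para-cyclic identities\<close>

context module_coring_with_coefficients
begin

lemma absorb_append: "C.absorb (length us + k) (us @ vs) = us @ C.absorb k vs"
  by (simp add: C.absorb_def nth_append)

lemma split_at_twoE:
  assumes "length cs = Suc n" "i < n"
  obtains us a b ws where "cs = us @ a # b # ws" "length us = i" "length ws = n - Suc i"
proof -
  obtain us a vs where 1: "cs = us @ a # vs" "length us = i" "length vs = Suc n - Suc i"
    by (rule list_splitE[OF assms(1), of i]) (use assms(2) in auto)
  moreover obtain b ws where "vs = b # ws"
    using 1(3) assms(2) by (cases vs) auto
  ultimately show thesis
    using that by auto
qed

lemma face_less: "k < n \<Longrightarrow> face n k (cs, x) = (C.absorb k cs, x)"
  and face_last: "length us = n \<Longrightarrow> face n n (us @ [c], x) = (us, lX (\<epsilon>C c) x)"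
  by (simp_all add: nth_append)

declare face.simps [simp del]

lemma face_face:
  assumes "i < j" "j \<le> n + 2" "length cs = Suc (Suc (Suc n))"
  shows "face (Suc n) i (face (Suc (Suc n)) j (cs, x)) = face (Suc n) (j - 1) (face (Suc (Suc n)) i (cs, x))"
proof -
  obtain us a b ws where cs: "cs = us @ a # b # ws" "length us = i" "length ws = Suc (Suc n) - Suc i"
    by (rule split_at_twoE[OF assms(3), of i]) (use assms in auto)
  have i: "face (Suc (Suc n)) i (cs, x) = (us @ act b (\<zeta> (\<epsilon>C a)) # ws, x)"
    using cs(2) assms(1,2) by (simp add: face_less cs(1) absorb_app)
  \<comment> \<open>Two alternatives are combined: the faces are adjacent or apart, and the later
    one is absorbed by \<open>x\<close> or by a further entry. Adjacent faces agree by left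
    linearity of the counit, separate ones do not interfere.\<close>
  consider "j = Suc i" "ws = []" | c ws' where "j = Suc i" "ws = c # ws'"
    | ws' c where "Suc i < j" "j = Suc (Suc n)" "ws = ws' @ [c]"
    | m where "j = i + 2 + m" "j < Suc (Suc n)"
  proof (cases "j = Suc i")
    case True
    then show thesis using that(1,2) by (cases ws) auto
  next
    case False
    then have j: "Suc i < j" using assms(1) by simp
    show thesis
    proof (cases "j = Suc (Suc n)")
      case True
      then have "ws \<noteq> []" using cs(3) j by auto
      then show thesis using that(3)[OF j True] by (cases ws rule: rev_cases) auto
    next
      case False
      then show thesis using that(4)[of "j - i - 2"] j assms(2) by simp
    qed
  qed
  then show ?thesis
  proof cases
    case 1
    then have n: "i = Suc n" using cs(3) assms by simp
    have "face (Suc (Suc n)) j (cs, x) = (us @ [a], lX (\<epsilon>C b) x)"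
      using face_last[of "us @ [a]" "Suc (Suc n)" b x] cs(2) by (simp add: 1 n cs(1))
    then show ?thesis
      using cs(2) unfolding i by (simp add: 1 n face_last C.counit_lact lX_mult)
  next
    case 2
    have less: "j < Suc (Suc n)" using 2 cs(3) by simp
    have "face (Suc (Suc n)) j (cs, x) = (us @ a # act c (\<zeta> (\<epsilon>C b)) # ws', x)"
      using less absorb_app[of "us @ [a]" j b c ws'] cs(2) by (simp add: face_less cs(1) 2)
    then show ?thesis
      using cs(2) less unfolding i
      by (simp add: 2 face_less absorb_app C.counit_lact zeta_mult C.ract_mult)
  next
    case 3
    have "length (us @ a # b # ws') = Suc (Suc n)" "length (us @ act b (\<zeta> (\<epsilon>C a)) # ws') = Suc n"
      using 3 cs(2,3) by auto
    from face_last[OF this(1), of c x] face_last[OF this(2), of c x] show ?thesis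
      using 3 cs(2) unfolding i by (simp add: cs(1) face_less absorb_app)
  next
    case 4
    have "C.absorb j cs = us @ a # b # C.absorb m ws"
      using absorb_append[of "us @ [a, b]" m ws] cs(2) by (simp add: cs(1) 4)
    moreover have "C.absorb (Suc (i + m)) (us @ act b (\<zeta> (\<epsilon>C a)) # ws) = us @ act b (\<zeta> (\<epsilon>C a)) # C.absorb m ws"
      using absorb_append[of "us @ [act b (\<zeta> (\<epsilon>C a))]" m ws] cs(2) by simp
    ultimately show ?thesis
      using 4 cs(2) unfolding i by (simp add: face_less absorb_app)
  qed
qed

lemma Csweedler_commute:
  "C.sweedler b (\<lambda>p q. C.sweedler a (\<lambda>u v. f p q u v)) = C.sweedler a (\<lambda>u v. C.sweedler b (\<lambda>p q. f p q u v))"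
  unfolding C.sweedler_def by (rule fs.lext_commute)

text \<open>Precomposition reverses the order: \<open>degen j (degen i F)\<close> is
  \<open>F\<close> after the degeneracies \<open>j\<close> and then \<open>i\<close>. Equal
  positions require coassociativity, distinct ones an exchange of sums.\<close>

lemma degen_degen:
  assumes F: "cycmap N (Suc (Suc n)) F" and "i \<le> j" "j \<le> n" "length cs = Suc n"
  shows "degen j (degen i F) (cs, x) \<approx>[N] degen i (degen (Suc j) F) (cs, x)"
proof (cases "i = j")
  case True
  obtain us a vs where cs: "cs = us @ a # vs" "length us = j" "length vs = Suc n - Suc j"
    by (rule list_splitE[OF assms(4), of j]) (use assms in auto)
  let ?f = "\<lambda>u v w. F (us @ u # v # w # vs, x)"
  have slot: "linmod N scC (\<lambda>m. F (us' @ m # vs', x))" if "length us' + length vs' = Suc (Suc n)" for us' vs'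
    using that by (rule cycmap_slot(1)[OF F])
  have "C.tril N ?f"
  proof (rule C.trilI)
    show "linmod N scC (\<lambda>u. ?f u v w)" for v w
      using cs assms by (intro slot) simp
    show "linmod N scC (\<lambda>v. ?f u v w)" for u w
      using slot[of "us @ [u]" "w # vs"] cs assms by simp
    show "linmod N scC (?f u v)" for u v
      using slot[of "us @ [u, v]" "vs"] cs assms by simp
    show "?f (act u (\<xi> r)) v w \<approx>[N] ?f u (act v (\<zeta> r)) w" for u v w r
      using cs assms by (intro cycmap_slot(2)[OF F]) simp
    show "?f u (act v (\<xi> r)) w \<approx>[N] ?f u v (act w (\<zeta> r))" for u v w r
      using cycmap_slot(2)[OF F, of "us @ [u]" vs] cs assms by simp
  qed
  from C.sweedler_coassoc[OF this, of a]
  have "C.sweedler a (\<lambda>u v. C.sweedler u (\<lambda>p q. ?f p q v)) \<approx>[N] C.sweedler a (\<lambda>u v. C.sweedler v (?f u))" .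
  moreover have "degen (Suc j) F (us @ u # v # vs, x) = C.sweedler v (?f u)" for u v
    using degen_app[of "us @ [u]" "Suc j" F v vs x] cs(2) by simp
  ultimately show ?thesis
    using True cs(2) by (simp add: cs(1) degen_app)
next
  case False
  then have ij: "i < j" using assms by simp
  obtain us a ds where cs1: "cs = us @ a # ds" "length us = i" "length ds = Suc n - Suc i"
    by (rule list_splitE[OF assms(4), of i]) (use assms in auto)
  obtain vs b ws where ds: "ds = vs @ b # ws" "length vs = j - Suc i"
    by (rule list_splitE[OF cs1(3), of "j - Suc i"]) (use assms ij in auto)
  have "degen j (degen i F) (cs, x) = C.sweedler b (\<lambda>p q. C.sweedler a (\<lambda>u v. F (us @ u # v # vs @ p # q # ws, x)))"
    using degen_app[of "us @ a # vs" j "degen i F" b ws x] cs1(2) ds(2) ij by (simp add: cs1(1) ds(1) degen_app)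
  moreover have "degen (Suc j) F (us @ u # v # vs @ b # ws, x) = C.sweedler b (\<lambda>p q. F (us @ u # v # vs @ p # q # ws, x))" for u v
    using degen_app[of "us @ u # v # vs" "Suc j" F b ws x] cs1(2) ds(2) ij by simp
  ultimately show ?thesis
    using cs1(2) by (simp add: cs1(1) ds(1) degen_app Csweedler_commute[of b])
qed

text \<open>Only \<open>j = i + 1\<close> has content: the entry that receives the scalar is then
  the one that is split, and left linearity of the coproduct applies.\<close>

lemma degen_face_less:
  assumes F: "cycmap N (Suc n) F" and "i < j" "j \<le> n + 1" "length cs = Suc (Suc n)"
  shows "degen j (\<lambda>s. F (face (Suc (Suc n)) i s)) (cs, x) \<approx>[N] degen (j - 1) F (face (Suc n) i (cs, x))"
proof -
  obtain us a b ws where cs: "cs = us @ a # b # ws" "length us = i" "length ws = Suc n - Suc i"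
    by (rule split_at_twoE[OF assms(4), of i]) (use assms in auto)
  have i: "face (Suc n) i (cs, x) = (us @ act b (\<zeta> (\<epsilon>C a)) # ws, x)"
    using cs(2) assms(2,3) by (simp add: face_less cs(1) absorb_app)
  have less: "i < Suc (Suc n)" using assms by simp
  show ?thesis
  proof (cases "j = Suc i")
    case True
    have "degen j (\<lambda>s. F (face (Suc (Suc n)) i s)) (cs, x)
        = C.sweedler b (\<lambda>p q. F (us @ act p (\<zeta> (\<epsilon>C a)) # q # ws, x))"
      using degen_app[of "us @ [a]" j "\<lambda>s. F (face (Suc (Suc n)) i s)" b ws x] cs(2) less True
      by (simp add: cs(1) face_less absorb_app)
    also have "\<dots> \<approx>[N] C.sweedler (act b (\<zeta> (\<epsilon>C a))) (\<lambda>p q. F (us @ p # q # ws, x))"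
      using cs(2,3) assms by (intro eqmod_sym[OF C.sweedler_lact] cycmap_bil[OF F]) simp
    also have "\<dots> = degen (j - 1) F (face (Suc n) i (cs, x))"
      unfolding i using cs(2) True by (simp add: degen_app)
    finally show ?thesis .
  next
    case False
    obtain vs c zs where ws: "ws = vs @ c # zs" "length vs = j - i - 2"
      by (rule list_splitE[OF cs(3), of "j - i - 2"]) (use assms False in auto)
    have "degen j (\<lambda>s. F (face (Suc (Suc n)) i s)) (cs, x)
        = C.sweedler c (\<lambda>p q. F (us @ act b (\<zeta> (\<epsilon>C a)) # vs @ p # q # zs, x))"
      using degen_app[of "us @ a # b # vs" j "\<lambda>s. F (face (Suc (Suc n)) i s)" c zs x] cs(2) ws(2) less False assms(2)
      by (simp add: cs(1) ws(1) face_less absorb_app)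
    moreover have "degen (j - 1) F (face (Suc n) i (cs, x))
        = C.sweedler c (\<lambda>p q. F (us @ act b (\<zeta> (\<epsilon>C a)) # vs @ p # q # zs, x))"
      unfolding i ws(1)
      using degen_app[of "us @ act b (\<zeta> (\<epsilon>C a)) # vs" "j - 1" F c zs x] cs(2) ws(2) False assms(2) by simp
    ultimately show ?thesis by simp
  qed
qed

lemma degen_face_same:
  assumes F: "cycmap N n F" and "j \<le> n" "length cs = Suc n"
  shows "degen j (\<lambda>s. F (face (Suc n) j s)) (cs, x) \<approx>[N] F (cs, x)"
proof -
  obtain us a vs where cs: "cs = us @ a # vs" "length us = j" "length vs = Suc n - Suc j"
    by (rule list_splitE[OF assms(3), of j]) (use assms in auto)
  have "degen j (\<lambda>s. F (face (Suc n) j s)) (cs, x) = C.sweedler a (\<lambda>u v. F (us @ act v (\<zeta> (\<epsilon>C u)) # vs, x))"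
    using cs(2) assms(2) by (simp add: cs(1) degen_app face_less absorb_app)
  also have "\<dots> \<approx>[N] F (us @ a # vs, x)"
    using cs assms by (intro C.sweedler_counit_left[of N "\<lambda>a. F (us @ a # vs, x)"] cycmap_slot(1)[OF F]) simp
  finally show ?thesis by (simp add: cs(1))
qed

text \<open>The face absorbs to the right, but the right counit axiom wants the scalar on the left
  half. It is brought back across a tensor sign, or out of \<open>x\<close> by the cyclic relation
  if the split entry is the last one.\<close>

lemma degen_face_next:
  assumes F: "cycmap N n F" and "j \<le> n" "length cs = Suc n"
  shows "degen j (\<lambda>s. F (face (Suc n) (Suc j) s)) (cs, x) \<approx>[N] F (cs, x)"
proof -
  obtain us a vs where cs: "cs = us @ a # vs" "length us = j" "length vs = Suc n - Suc j"
    by (rule list_splitE[OF assms(3), of j]) (use assms in auto)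
  have "degen j (\<lambda>s. F (face (Suc n) (Suc j) s)) (cs, x) \<approx>[N] C.sweedler a (\<lambda>u v. F (us @ act u (\<xi> (\<epsilon>C v)) # vs, x))"
    unfolding cs(1) degen_app[OF cs(2)]
  proof (rule C.sweedler_cong)
    fix u v
    show "F (face (Suc n) (Suc j) (us @ u # v # vs, x)) \<approx>[N] F (us @ act u (\<xi> (\<epsilon>C v)) # vs, x)"
    proof (cases vs)
      case Nil
      then have n: "n = j" using cs assms by simp
      have "F (us @ [u], lX (\<epsilon>C v) x) \<approx>[N] F (us @ [act u (\<xi> (\<epsilon>C v))], x)"
        using cs(2) n by (intro eqmod_sym[OF cycmapD(3)[OF F]]) simp
      then show ?thesis
        using face_last[of "us @ [u]" "Suc n" v x] cs(2) by (simp add: n Nil)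
    next
      case (Cons b vs')
      then have "Suc j < Suc n" using cs assms by simp
      moreover have "F (us @ u # act b (\<zeta> (\<epsilon>C v)) # vs', x) \<approx>[N] F (us @ act u (\<xi> (\<epsilon>C v)) # b # vs', x)"
        using cs Cons assms by (intro eqmod_sym[OF cycmap_slot(2)[OF F]]) simp
      ultimately show ?thesis
        using absorb_app[of "us @ [u]" "Suc j" v b vs'] cs(2) by (simp add: Cons face_less)
    qed
  qed
  also have "\<dots> \<approx>[N] F (us @ a # vs, x)"
    using cs assms by (intro C.sweedler_counit_right[of N "\<lambda>a. F (us @ a # vs, x)"] cycmap_slot(1)[OF F]) simp
  finally show ?thesis by (simp add: cs(1))
qed

lemma degen_face_greater:
  assumes "j + 1 < i" "i \<le> n + 2" "length cs = Suc (Suc n)"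
  shows "degen j (\<lambda>s. F (face (Suc (Suc n)) i s)) (cs, x) = degen j F (face (Suc n) (i - 1) (cs, x))"
proof -
  obtain us a vs where cs: "cs = us @ a # vs" "length us = j" "length vs = Suc (Suc n) - Suc j"
    by (rule list_splitE[OF assms(3), of j]) (use assms in auto)
  show ?thesis
  proof (cases "i = n + 2")
    case True
    then have "vs \<noteq> []" using cs(3) assms by auto
    then obtain ws c where ws: "vs = ws @ [c]" by (cases vs rule: rev_cases) auto
    have "length (us @ u # v # ws) = Suc (Suc n)" "length (us @ a # ws) = Suc n" for u v
      using ws cs(2,3) True assms by auto
    from face_last[OF this(1), where c = c and x = x] face_last[OF this(2), where c = c and x = x]
    show ?thesis
      using True cs(2) by (simp add: cs(1) ws degen_app)
  next
    case False
    define m where "m = i - j - 2"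
    have i: "i = Suc (Suc (j + m))" "i - 1 = Suc (j + m)" "i < Suc (Suc n)" using assms False by (auto simp: m_def)
    have "C.absorb i (us @ u # v # vs) = us @ u # v # C.absorb m vs" for u v
      using absorb_append[of "us @ [u, v]" m vs] cs(2) by (simp add: i(1))
    moreover have "C.absorb (i - 1) (us @ a # vs) = us @ a # C.absorb m vs"
      unfolding i(2) using absorb_append[of "us @ [a]" m vs] cs(2) by simp
    ultimately show ?thesis
      using cs(2) i by (simp add: cs(1) degen_app face_less)
  qed
qed

text \<open>For \<open>k = n\<close> the absorbed entry \<open>d\<close> becomes the last one after
  rotation, so its scalar acts on \<open>x\<close>; \<open>coact_takeuchi\<close> returns it to the
  rotated entry. For smaller \<open>k\<close> both sides coincide.\<close>

lemma rot_face_Suc: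
  assumes F: "cycmap N n F" and k: "k \<le> n" and len: "length cs = Suc (Suc n)"
  shows "rot (Suc n) (\<lambda>s. F (face (Suc n) (Suc k) s)) (cs, x) \<approx>[N] rot n F (face (Suc n) k (cs, x))"
proof -
  obtain us c where cs: "cs = us @ [c]" "length us = Suc n"
    by (rule length_Suc_snocE[OF len])
  have lhs: "rot (Suc n) (\<lambda>s. F (face (Suc n) (Suc k) s)) (cs, x)
      = coact x (\<lambda>y e. F (face (Suc n) (Suc k) (act c e # us, y)))"
    by (simp add: cs(1) rot_app[OF cs(2)])
  show ?thesis
  proof (cases "k = n")
    case True
    obtain vs d where us: "us = vs @ [d]" "length vs = n"
      by (rule length_Suc_snocE[OF cs(2)])
    have "face (Suc n) (Suc k) (act c e # us, y) = (act c e # vs, lX (\<epsilon>C d) y)" for e y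
      using face_last[of "act c e # vs" "Suc n" d y] us(2) by (simp add: True us(1))
    then have "rot (Suc n) (\<lambda>s. F (face (Suc n) (Suc k) s)) (cs, x) = coact x (\<lambda>y e. F (act c e # vs, lX (\<epsilon>C d) y))"
      unfolding lhs by simp
    also have "\<dots> \<approx>[N] coact x (\<lambda>y e. F (act c (\<zeta> (\<epsilon>C d) * e) # vs, y))"
      by (rule coact_takeuchi[OF cobil_rot[OF F us(2)]])
    also have "\<dots> = rot n F (face (Suc n) k (cs, x))"
      using us(2) by (simp add: True cs(1) us(1) face_less absorb_app rot_app C.ract_mult)
    finally show ?thesis .
  next
    case False
    then have k: "k < n" using k by simp
    obtain vs a b ws where us: "us = vs @ a # b # ws" "length vs = k" "length ws = n - Suc k"
      by (rule split_at_twoE[OF cs(2) k])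
    have "C.absorb k cs = C.absorb k us @ [c]"
      using us(2) by (simp add: cs(1) us(1) absorb_app)
    moreover have "length (C.absorb k us) = n"
      using us k by (simp add: absorb_app)
    moreover have "face (Suc n) (Suc k) (act c e # us, y) = (act c e # C.absorb k us, y)" for e y
      using k by (simp add: face_less C.absorb_Suc)
    ultimately show ?thesis
      unfolding lhs using k by (simp add: face_less rot_app)
  qed
qed

lemma coact_Csweedler_commute:
  "coact x (\<lambda>y b. C.sweedler c (\<lambda>u v. f y b u v)) = C.sweedler c (\<lambda>u v. coact x (\<lambda>y b. f y b u v))"
  unfolding coact_def C.sweedler_def case_prod_unfold by (rule fs.lext_commute)

text \<open>Splitting after rotation makes the two legs of one coaction factor act on the two halves
  of \<open>c\<close>; rotating the halves one by one makes two coaction factors act on them.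
  Coassociativity of the coaction identifies both.\<close>

lemma rot_degen_0:
  assumes F: "cycmap N (Suc n) F" and len: "length cs = Suc n"
  shows "rot n (degen 0 F) (cs, x) \<approx>[N] degen n (rot (Suc n) (rot (Suc n) F)) (cs, x)"
proof -
  obtain us c where cs: "cs = us @ [c]" "length us = n"
    by (rule length_Suc_snocE[OF len])
  have degen_0: "degen 0 F (a # vs, y) = C.sweedler a (\<lambda>u v. F (u # v # vs, y))" for a vs y
    using degen_app[of "[]" 0 F a vs y] by simp
  have bil: "C.bil N (\<lambda>u v. F (u # v # us, y))" for y
    using cycmap_bil[OF F, of "[]" us] cs(2) by simp
  have tril: "cotril N (\<lambda>y s t. F (act p s # act q t # us, y))" for p q
    unfolding cotril_def
  proof (intro conjI allI bilI)
    show "linmod N scX (\<lambda>y. F (act p s # act q t # us, y))" for s t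
      using cs(2) by (intro cycmapD(2)[OF F]) simp
    show "linmod N scB (\<lambda>s. F (act p s # act q t # us, y))" for t y
      using bil unfolding C.bil_def by (intro linmod_act) simp
    show "linmod N scB (\<lambda>t. F (act p s # act q t # us, y))" for s y
      using bil unfolding C.bil_def by (intro linmod_act) simp
    show "F (act p (s * \<xi> r) # act q t # us, y) \<approx>[N] F (act p s # act q (t * \<zeta> r) # us, y)" for y s t r
      using bil unfolding C.bil_def by (simp add: C.ract_mult)
    show "F (act p s # act q t # us, ractX y r) \<approx>[N] F (act p (s * \<zeta> r) # act q t # us, y)" for y r s t
      using cycmapD(4)[OF F, of "act q t # us" "act p s" r y] cs(2) by (simp add: C.ract_mult eqmod_sym)
  qed
  have "rot n (degen 0 F) (cs, x) = coact x (\<lambda>y e. C.sweedler (act c e) (\<lambda>u v. F (u # v # us, y)))"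
    by (simp add: cs(1) rot_app[OF cs(2)] degen_0)
  also have "\<dots> \<approx>[N] coact x (\<lambda>y e. C.sweedler c (\<lambda>p q. sweedler e (\<lambda>s t. F (act p s # act q t # us, y))))"
    by (intro coact_cong sweedler_act bil)
  also have "\<dots> = C.sweedler c (\<lambda>p q. coact x (\<lambda>y e. sweedler e (\<lambda>s t. F (act p s # act q t # us, y))))"
    by (rule coact_Csweedler_commute)
  also have "\<dots> \<approx>[N] C.sweedler c (\<lambda>p q. coact x (\<lambda>y e. coact y (\<lambda>z e'. F (act p e' # act q e # us, z))))"
    by (intro C.sweedler_cong eqmod_sym[OF coact_coassociative[OF tril]])
  also have "\<dots> = C.sweedler c (\<lambda>p q. rot (Suc n) (rot (Suc n) F) (us @ [p, q], x))"
  proof -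
    have "rot (Suc n) (rot (Suc n) F) (us @ [p, q], x)
        = coact x (\<lambda>y e. coact y (\<lambda>z e'. F (act p e' # act q e # us, z)))" for p q
      using rot_app[of "us @ [p]" "Suc n" "rot (Suc n) F" q x] rot_app[of "act q _ # us" "Suc n" F p] cs(2)
      by simp
    then show ?thesis by simp
  qed
  also have "\<dots> = degen n (rot (Suc n) (rot (Suc n) F)) (cs, x)"
    by (simp add: cs(1) degen_app[OF cs(2)])
  finally show ?thesis .
qed

lemma rot_degen_Suc:
  assumes k: "Suc k \<le> n" and len: "length cs = Suc n"
  shows "rot n (degen (Suc k) F) (cs, x) = degen k (rot (Suc n) F) (cs, x)"
proof -
  obtain ds c where cs: "cs = ds @ [c]" "length ds = n"
    by (rule length_Suc_snocE[OF len])
  obtain us a vs where ds: "ds = us @ a # vs" "length us = k" "length vs = n - Suc k"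
    by (rule list_splitE[OF cs(2), of k]) (use k in auto)
  have "rot n (degen (Suc k) F) (cs, x) = coact x (\<lambda>y e. C.sweedler a (\<lambda>p q. F (act c e # us @ p # q # vs, y)))"
  proof -
    have "degen (Suc k) F (act c e # us @ a # vs, y) = C.sweedler a (\<lambda>p q. F (act c e # us @ p # q # vs, y))" for e y
      using degen_app[of "act c e # us" "Suc k" F a vs y] ds(2) by simp
    then show ?thesis
      by (simp only: cs(1) rot_app[OF cs(2)]) (simp add: ds(1))
  qed
  also have "\<dots> = C.sweedler a (\<lambda>p q. coact x (\<lambda>y e. F (act c e # us @ p # q # vs, y)))"
    by (rule coact_Csweedler_commute)
  also have "\<dots> = degen k (rot (Suc n) F) (cs, x)"
  proof -
    have "rot (Suc n) F (us @ p # q # vs @ [c], x) = coact x (\<lambda>y e. F (act c e # us @ p # q # vs, y))" for p q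
      using rot_app[of "us @ p # q # vs" "Suc n" F c x] ds k by simp
    then show ?thesis
      by (simp add: cs(1) ds(1) degen_app[OF ds(2)])
  qed
  finally show ?thesis .
qed

end

section \<open>The two quotients\<close>

lemma induced_single:
  fixes R :: "('s \<Rightarrow>\<^sub>0 'k::comm_ring_1) set"
  assumes "\<And>r. r \<in> R \<Longrightarrow> supp r \<subseteq> G" "\<And>r. r \<in> R \<Longrightarrow> flin f r \<approx>[N] 0"
    "supp v \<subseteq> G"
  shows "induced (fspan N) (\<lambda>s. {f s}) (v +o fspan R) = flin f v +o fspan N"
  by (rule induced_coset[OF assms(3,1)]) (use assms(2) in auto)

lemma keys_pre_rels:
  fixes t :: "'c::ab_group_add list \<times> 'x::ab_group_add \<Rightarrow>\<^sub>0 'k::comm_ring_1"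
  assumes "t \<in> pre_rels scC lC rC scX n"
  shows "supp t \<subseteq> {(cs, x). length cs = n + 1}"
proof -
  have "supp (flin (\<lambda>cs. gen (cs, x)) t :: _ \<Rightarrow>\<^sub>0 'k) \<subseteq> {(cs, x). length cs = n + 1}"
    if "t \<in> tpow_rels scC lC rC (n + 1)" for x :: 'x and t
    using that by (rule keys_flin_tpow_rels) simp
  moreover have "supp t \<subseteq> {(cs, x). length cs = n + 1}"
    if "t \<in> slot_rels scX (\<lambda>x. (cs, x))" "length cs = n + 1" for cs :: "'c list"
    using that by (intro keys_slot_rels[OF that(1)]) simp
  ultimately show ?thesis
    using assms unfolding pre_rels_def by blast
qed

section \<open>Iterated coproducts of the unit and of scalars\<close>

context right_bialgebroid
begin

lemma coprods_one:
  assumes "tensor N (Suc n) F"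
  shows "flin F (coprods n 1) \<approx>[N] F (replicate (Suc n) 1)"
  using assms
proof (induction n arbitrary: F)
  case (Suc n)
  have "flin F (coprods (Suc n) 1) \<approx>[N] flin (\<lambda>l. F (1 # l)) (coprods n 1)"
    unfolding flin_coprods_Suc by (rule sweedler_one[OF bil_coprods[OF Suc.prems]])
  also have "\<dots> \<approx>[N] F (1 # replicate (Suc n) 1)"
    using Suc.prems by (intro Suc.IH) (simp add: tens_Suc_Suc[of _ _ _ _ n])
  finally show ?case by simp
qed simp

text \<open>Balancing by \<open>\<xi> r\<close> changes only the last entry and, by
  \<open>coprods_zeta\<close>, balancing by \<open>\<zeta> r\<close> only the first: these become
  the two cyclic relations in \<open>balmap_gen\<close>.\<close>

lemma coprods_xi:
  assumes "tensor N (Suc n) F"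
  shows "flin F (coprods n (\<xi> r)) \<approx>[N] F (replicate n 1 @ [\<xi> r])"
  using assms
proof (induction n arbitrary: F)
  case (Suc n)
  have "flin F (coprods (Suc n) (\<xi> r)) \<approx>[N] flin (\<lambda>l. F (1 # l)) (coprods n (\<xi> r))"
    unfolding flin_coprods_Suc by (rule sweedler_xi[OF bil_coprods[OF Suc.prems]])
  also have "\<dots> \<approx>[N] F (1 # replicate n 1 @ [\<xi> r])"
    using Suc.prems by (intro Suc.IH) (simp add: tens_Suc_Suc[of _ _ _ _ n])
  finally show ?case by simp
qed simp

lemma coprods_zeta:
  assumes "tensor N (Suc n) F"
  shows "flin F (coprods n (\<zeta> r)) \<approx>[N] F (\<zeta> r # replicate n 1)"
proof (cases n)
  case (Suc m)
  have "flin F (coprods n (\<zeta> r)) \<approx>[N] flin (\<lambda>l. F (\<zeta> r # l)) (coprods m 1)"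
    unfolding Suc flin_coprods_Suc using assms Suc by (intro sweedler_zeta bil_coprods) simp
  also have "\<dots> \<approx>[N] F (\<zeta> r # replicate n 1)"
    using assms unfolding Suc by (intro coprods_one) (simp add: tens_Suc_Suc[of _ _ _ _ m])
  finally show ?thesis .
qed simp

end

context module_coring_with_coefficients
begin

definition gens :: "nat \<Rightarrow> ('c list \<times> 'x) set" where
  "gens n = {(cs, x). length cs = n + 1}"

definition cyc_rels :: "nat \<Rightarrow> ('c list \<times> 'x \<Rightarrow>\<^sub>0 'k) set" where
  "cyc_rels n = pre_rels scC lC rC scX n
     \<union> {gen (cs @ [rC c r], x) - gen (cs @ [c], lX r x) |cs c r x. length cs = n}
     \<union> {gen (lC r c # cs, x) - gen (c # cs, ractX x r) |cs c r x. length cs = n}"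

definition bal_rels :: "nat \<Rightarrow> ('c list \<times> 'x \<Rightarrow>\<^sub>0 'k) set" where
  "bal_rels n = pre_rels scC lC rC scX n
     \<union> {flin (\<lambda>bs. gen (map2 act cs bs, x)) p - gen (cs, lactB b x) |cs x b p.
          length cs = n + 1 \<and> p \<in> iter_coprod scB \<xi> \<zeta> \<Delta> n b}"

lemma cyc_null_eq: "cyc_null scC lC rC scX lX ractX n = fspan (cyc_rels n)"
  by (simp add: cyc_null_def cyc_rels_def)

lemma bal_null_eq: "bal_null scB \<xi> \<zeta> \<Delta> scC act scX lactB n = fspan (bal_rels n)"
  by (simp add: bal_null_def bal_rels_def)

lemma pre_rels_iff:
  "(\<forall>t\<in>pre_rels scC lC rC scX n. flin F t \<approx>[N] 0) \<longleftrightarrow>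
     (\<forall>x. C.tensor N (Suc n) (\<lambda>cs. F (cs, x))) \<and> (\<forall>cs. length cs = Suc n \<longrightarrow> linmod N scX (\<lambda>x. F (cs, x)))"
proof -
  have "(\<forall>t\<in>{flin (\<lambda>cs. gen (cs, x)) t |x t. t \<in> tpow_rels scC lC rC (n + 1)}. flin F t \<approx>[N] 0)
      \<longleftrightarrow> (\<forall>x. \<forall>t\<in>tpow_rels scC lC rC (n + 1). flin F (flin (\<lambda>cs. gen (cs, x)) t) \<approx>[N] 0)"
    by blast
  also have "\<dots> \<longleftrightarrow> (\<forall>x. C.tensor N (Suc n) (\<lambda>cs. F (cs, x)))"
    by (simp add: tens_def fs.lext_flin)
  finally show ?thesis
    unfolding pre_rels_def ball_Un linmod_iff_slot_rels[of N scX F "\<lambda>x. (_, x)"] by auto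
qed

lemma cyc_rels_cases:
  assumes "t \<in> cyc_rels n"
  obtains "t \<in> pre_rels scC lC rC scX n"
    | cs c r x where "t = gen (cs @ [rC c r], x) - gen (cs @ [c], lX r x)" "length cs = n"
    | cs c r x where "t = gen (lC r c # cs, x) - gen (c # cs, ractX x r)" "length cs = n"
  using assms unfolding cyc_rels_def by (elim UnE CollectE exE conjE) (rule that; assumption)+

lemma bal_rels_cases:
  assumes "t \<in> bal_rels n"
  obtains "t \<in> pre_rels scC lC rC scX n"
    | cs x b p where "t = flin (\<lambda>bs. gen (map2 act cs bs, x)) p - gen (cs, lactB b x)"
      "length cs = n + 1" "p \<in> iter_coprod scB \<xi> \<zeta> \<Delta> n b"
  using assms unfolding bal_rels_def by (elim UnE CollectE exE conjE) (rule that; assumption)+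

lemma cycmap_kills:
  assumes F: "cycmap N n F" and t: "t \<in> cyc_rels n"
  shows "flin F t \<approx>[N] 0"
proof -
  have "\<forall>t\<in>pre_rels scC lC rC scX n. flin F t \<approx>[N] 0"
    using F by (simp add: pre_rels_iff cycmap_def)
  then show ?thesis
    using cycmapD(3,4)[OF F]
    by - (rule cyc_rels_cases[OF t], simp_all add: fs.lext_diff eqmod_diff_zero)
qed

lemma eqmod_rel: "t \<in> R \<Longrightarrow> flin gen t \<approx>[R] 0"
  by (simp add: flin_gen_id eqmod_zero_iff fs.span_base)

text \<open>The universal example for the cyclic tensor product; feeding it into the pullback lemmas
  gives well-definedness of the structure maps.\<close>

lemma cycmap_gen: "cycmap (cyc_rels n) n gen"
proof -
  have "\<forall>t\<in>pre_rels scC lC rC scX n. flin gen t \<approx>[cyc_rels n] 0"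
    by (auto intro!: eqmod_rel simp: cyc_rels_def)
  moreover have "gen (cs @ [act c (\<xi> r)], x) \<approx>[cyc_rels n] gen (cs @ [c], lX r x)" if "length cs = n" for cs c r x
    unfolding eqmod_def cyc_rels_def using that by (intro fs.span_base) blast
  moreover have "gen (act c (\<zeta> r) # cs, x) \<approx>[cyc_rels n] gen (c # cs, ractX x r)" if "length cs = n" for cs c r x
    unfolding eqmod_def cyc_rels_def using that by (intro fs.span_base) blast
  ultimately show ?thesis
    unfolding pre_rels_iff cycmap_def by blast
qed

lemma balmap_kills:
  assumes F: "balmap N n F" and t: "t \<in> bal_rels n"
  shows "flin F t \<approx>[N] 0"
proof -
  have "\<forall>t\<in>pre_rels scC lC rC scX n. flin F t \<approx>[N] 0"
    using balmap_cycmap[OF F] by (simp add: pre_rels_iff cycmap_def)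
  moreover have "flin F (flin (\<lambda>bs. gen (map2 act cs bs, x)) p - gen (cs, lactB b x)) \<approx>[N] 0"
    if len: "length cs = n + 1" and p: "p \<in> iter_coprod scB \<xi> \<zeta> \<Delta> n b" for cs x b p
  proof -
    have "tensor N (Suc n) (\<lambda>bs. F (map2 act cs bs, x))"
      using len by (intro tensor_map2[OF cycmapD(1)[OF balmap_cycmap[OF F]]]) simp
    moreover have "p \<approx>[rels (Suc n)] coprods n b"
      using p by (simp add: iter_coprod_coset mem_coset_iff)
    ultimately have "flin (\<lambda>bs. F (map2 act cs bs, x)) p \<approx>[N] flin (\<lambda>bs. F (map2 act cs bs, x)) (coprods n b)"
      by (rule tens_eqmod)
    also have "\<dots> \<approx>[N] F (cs, lactB b x)"
      using len by (intro balmapD[OF F]) simp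
    finally show ?thesis
      by (simp add: fs.lext_diff fs.lext_flin eqmod_diff_zero)
  qed
  ultimately show ?thesis
    by - (rule bal_rels_cases[OF t], simp_all)
qed

lemma map2_act_one: "length cs = n \<Longrightarrow> map2 act cs (replicate n 1) = cs"
  by (rule nth_equalityI) (auto simp: C.ract_one)

text \<open>The relations \<open>bal_rels\<close> do not list the cyclic relations explicitly. They
  arise as balancing by \<open>\<xi> r\<close> and \<open>\<zeta> r\<close>, because these elements
  act on \<open>x\<close> as the left and right actions of \<open>R\<close>.\<close>

lemma balmap_gen: "balmap (bal_rels n) n gen"
proof -
  let ?N = "bal_rels n"
  have "\<forall>t\<in>pre_rels scC lC rC scX n. flin gen t \<approx>[?N] 0"
    by (auto intro!: eqmod_rel simp: bal_rels_def)
  then have pre: "C.tensor ?N (Suc n) (\<lambda>cs. gen (cs, x))" "length cs = Suc n \<Longrightarrow> linmod ?N scX (\<lambda>x. gen (cs, x))" for cs x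
    by (simp_all add: pre_rels_iff)
  have bal: "flin (\<lambda>bs. gen (map2 act cs bs, x)) (coprods n b) \<approx>[?N] gen (cs, lactB b x)" if "length cs = Suc n" for cs x b
  proof -
    have "coprods n b \<in> iter_coprod scB \<xi> \<zeta> \<Delta> n b"
      by (simp add: iter_coprod_coset mem_coset_iff)
    then show ?thesis
      unfolding eqmod_def bal_rels_def using that by (intro fs.span_base UnI2 CollectI exI conjI refl) simp_all
  qed
  have tens: "tensor ?N (Suc n) (\<lambda>bs. gen (map2 act cs bs, x))" if "length cs = Suc n" for cs x
    by (rule tensor_map2[OF pre(1) that])
  have "gen (cs @ [act c (\<xi> r)], x) \<approx>[?N] gen (cs @ [c], lX r x)" if len: "length cs = n" for cs c r x
  proof -
    have "gen (cs @ [act c (\<xi> r)], x) = gen (map2 act (cs @ [c]) (replicate n 1 @ [\<xi> r]), x)"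
      using len by (simp add: map2_act_one)
    also have "\<dots> \<approx>[?N] flin (\<lambda>bs. gen (map2 act (cs @ [c]) bs, x)) (coprods n (\<xi> r))"
      using len by (intro eqmod_sym[OF coprods_xi] tens) simp
    also have "\<dots> \<approx>[?N] gen (cs @ [c], lX r x)"
      unfolding ayd_lact using len by (intro bal) simp
    finally show ?thesis .
  qed
  moreover have "gen (act c (\<zeta> r) # cs, x) \<approx>[?N] gen (c # cs, ractX x r)" if len: "length cs = n" for cs c r x
  proof -
    have "gen (act c (\<zeta> r) # cs, x) = gen (map2 act (c # cs) (\<zeta> r # replicate n 1), x)"
      using len by (simp add: map2_act_one)
    also have "\<dots> \<approx>[?N] flin (\<lambda>bs. gen (map2 act (c # cs) bs, x)) (coprods n (\<zeta> r))"
      using len by (intro eqmod_sym[OF coprods_zeta] tens) simp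
    also have "\<dots> \<approx>[?N] gen (c # cs, ractX x r)"
      unfolding ayd_ract using len by (intro bal) simp
    finally show ?thesis .
  qed
  ultimately show ?thesis
    using pre bal unfolding balmap_def cycmap_def by blast
qed

lemma keys_cyc_rels:
  assumes "t \<in> cyc_rels n"
  shows "supp t \<subseteq> gens n"
proof -
  have "supp (gen (cs @ [rC c r], x) - gen (cs @ [c], lX r x) :: _ \<Rightarrow>\<^sub>0 'k) \<subseteq> gens n"
    "supp (gen (lC r c # cs, x) - gen (c # cs, ractX x r) :: _ \<Rightarrow>\<^sub>0 'k) \<subseteq> gens n"
    if "length cs = n" for cs c r x
    using that by (intro keys_gen_diff; simp add: gens_def)+
  then show ?thesis
    using keys_pre_rels[of t scC lC rC scX n, folded gens_def]
    by - (rule cyc_rels_cases[OF assms], simp_all)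
qed

lemma keys_bal_rels:
  assumes "t \<in> bal_rels n"
  shows "supp t \<subseteq> gens n"
proof -
  have "supp (flin (\<lambda>bs. gen (map2 act cs bs, x)) p - gen (cs, lactB b x) :: _ \<Rightarrow>\<^sub>0 'k) \<subseteq> gens n"
    if len: "length cs = n + 1" and p: "p \<in> iter_coprod scB \<xi> \<zeta> \<Delta> n b" for cs x b p
  proof -
    have "supp (p - coprods n b) \<subseteq> {l. length l = Suc n}"
      using p keys_fspan[of "rels (Suc n)", OF keys_tpow_rels]
      by (simp add: iter_coprod_coset mem_coset_iff eqmod_def)
    then have "supp p \<subseteq> {l. length l = Suc n}"
      using keys_add[of "p - coprods n b" "coprods n b"] keys_coprods[of n b] by auto
    then have "supp (flin (\<lambda>bs. gen (map2 act cs bs, x)) p :: _ \<Rightarrow>\<^sub>0 'k) \<subseteq> gens n"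
      using len by (intro keys_flin_subset) (auto simp: gens_def)
    moreover have "supp (gen (cs, lactB b x) :: _ \<Rightarrow>\<^sub>0 'k) \<subseteq> gens n"
      using len by (simp add: gens_def)
    ultimately show ?thesis
      by (intro order_trans[OF keys_diff_subset] Un_least)
  qed
  then show ?thesis
    using keys_pre_rels[of t scC lC rC scX n, folded gens_def]
    by - (rule bal_rels_cases[OF assms], simp_all)
qed

text \<open>For \<open>g = gen\<close> the left side applies the degeneracy to generators and then
  extends \<open>f\<close> linearly, and the right side is the pullback of \<open>f\<close>. This
  converts statements about functions into statements about maps.\<close>

lemma flin_degen: "flin f (degen k g s) = degen k (\<lambda>s. flin f (g s)) s"
  by (cases s) (simp add: degen_def C.split_fun_def C.flin_sweedler)

lemma flin_rot: "flin f (rot n g s) = rot n (\<lambda>s. flin f (g s)) s"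
  by (cases s) (simp add: rot_def flin_coact)

lemma keys_face: "k \<le> Suc n \<Longrightarrow> s \<in> gens (Suc n) \<Longrightarrow> face (Suc n) k s \<in> gens n"
  by (cases s) (auto simp: gens_def face.simps C.absorb_def)

lemma keys_degen:
  assumes "k \<le> n" "s \<in> gens n"
  shows "supp (degen k gen s :: _ \<Rightarrow>\<^sub>0 'k) \<subseteq> gens (Suc n)"
proof -
  obtain cs x where "s = (cs, x)" "length cs = Suc n"
    using assms(2) by (auto simp: gens_def)
  then show ?thesis
    unfolding degen_def C.split_fun_def C.sweedler_def prod.case using assms(1)
    by (simp add: degen_def C.split_fun_def C.sweedler_def) (intro keys_flin_subset, auto simp: gens_def)
qed

lemma keys_rot:
  assumes "s \<in> gens n"
  shows "supp (rot n gen s :: _ \<Rightarrow>\<^sub>0 'k) \<subseteq> gens n"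
proof -
  obtain cs x where "s = (cs, x)" "length cs = Suc n"
    using assms by (auto simp: gens_def)
  then show ?thesis
    by (simp add: rot_def coact_def) (intro keys_flin_subset, auto simp: gens_def)
qed

text \<open>The identities hold modulo any relations for which generators are cyclically balanced,
  which covers both \<open>cyc_rels\<close> and \<open>bal_rels\<close>.\<close>

lemma para_cyclic_module_gens:
  assumes R: "\<And>n. cycmap (R n) n gen"
    and D: "\<And>n k v. k \<le> Suc n \<Longrightarrow> supp v \<subseteq> gens (Suc n) \<Longrightarrow>
      D (Suc n) k (v +o fspan (R (Suc n))) = flin (\<lambda>s. gen (face (Suc n) k s)) v +o fspan (R n)"
    and S: "\<And>n k v. k \<le> n \<Longrightarrow> supp v \<subseteq> gens n \<Longrightarrow>
      S n k (v +o fspan (R n)) = flin (degen k gen) v +o fspan (R (Suc n))"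
    and W: "\<And>n v. supp v \<subseteq> gens n \<Longrightarrow>
      W n (v +o fspan (R n)) = flin (rot n gen) v +o fspan (R n)"
  shows "para_cyclic_module (\<lambda>n. quot_mod (gens n) (fspan (R n))) D S W"
proof (rule para_cyclic_module_presented[where dg = "\<lambda>n k s. gen (face n k s)" and sg = "\<lambda>n k. degen k gen" and wg = "\<lambda>n. rot n gen"])
  show "supp (gen (face (Suc n) k s) :: _ \<Rightarrow>\<^sub>0 'k) \<subseteq> gens n" if "k \<le> Suc n" "s \<in> gens (Suc n)" for n k s
    using keys_face[OF that] by simp
  show "flin (\<lambda>s. gen (face (Suc n) i s)) (gen (face (Suc (Suc n)) j s))
      \<approx>[R n] flin (\<lambda>s. gen (face (Suc n) (j - 1) s)) (gen (face (Suc (Suc n)) i s))"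
    if "i < j" "j \<le> n + 2" "s \<in> gens (Suc (Suc n))" for n i j s
    using that face_face[of i j n "fst s" "snd s"] by (auto simp: gens_def)
  show "flin (degen i gen) (degen j gen s) \<approx>[R (Suc (Suc n))] flin (degen (Suc j) gen) (degen i gen s)"
    if "i \<le> j" "j \<le> n" "s \<in> gens n" for n i j s
    using that degen_degen[OF R] by (auto simp: gens_def flin_degen)
  show "flin (\<lambda>s. gen (face (Suc (Suc n)) i s)) (degen j gen s)
      \<approx>[R (Suc n)] flin (degen (j - 1) gen) (gen (face (Suc n) i s))"
    if "i < j" "j \<le> n + 1" "s \<in> gens (Suc n)" for n i j s
    using that degen_face_less[OF R] by (auto simp: gens_def flin_degen)
  show "flin (\<lambda>s. gen (face (Suc n) j s)) (degen j gen s) \<approx>[R n] gen s" if "j \<le> n" "s \<in> gens n" for n j s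
    using that degen_face_same[OF R] by (auto simp: gens_def flin_degen)
  show "flin (\<lambda>s. gen (face (Suc n) (Suc j) s)) (degen j gen s) \<approx>[R n] gen s" if "j \<le> n" "s \<in> gens n" for n j s
    using that degen_face_next[OF R] by (auto simp: gens_def flin_degen)
  show "flin (\<lambda>s. gen (face (Suc (Suc n)) i s)) (degen j gen s)
      \<approx>[R (Suc n)] flin (degen j gen) (gen (face (Suc n) (i - 1) s))"
    if "j + 1 < i" "i \<le> n + 2" "s \<in> gens (Suc n)" for n i j s
    using that degen_face_greater[of j i n "fst s" gen "snd s"] by (auto simp: gens_def flin_degen)
  show "flin (\<lambda>s. gen (face (Suc n) 0 s)) (rot (Suc n) gen s) \<approx>[R n] gen (face (Suc n) (Suc n) s)"
    if "s \<in> gens (Suc n)" for n s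
    using that rot_face_0[OF R] by (auto simp: gens_def flin_rot)
  show "flin (\<lambda>s. gen (face (Suc n) (Suc k) s)) (rot (Suc n) gen s)
      \<approx>[R n] flin (rot n gen) (gen (face (Suc n) k s))" if "k \<le> n" "s \<in> gens (Suc n)" for n k s
    using that rot_face_Suc[OF R] by (auto simp: gens_def flin_rot)
  show "flin (degen 0 gen) (rot n gen s)
      \<approx>[R (Suc n)] flin (rot (Suc n) gen) (flin (rot (Suc n) gen) (degen n gen s))" if "s \<in> gens n" for n s
    using that rot_degen_0[OF R] by (auto simp: gens_def flin_rot flin_degen)
  show "flin (degen (Suc k) gen) (rot n gen s) \<approx>[R (Suc n)] flin (rot (Suc n) gen) (degen k gen s)"
    if "Suc k \<le> n" "s \<in> gens n" for n k s
    using that rot_degen_Suc[of k n "fst s" gen "snd s"] by (auto simp: gens_def flin_rot flin_degen)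
qed (fact D S W keys_degen keys_rot)+

end

section \<open>The two para-cyclic modules and the projection between them\<close>

context module_coring_with_coefficients
begin

abbreviation Z where "Z \<equiv> cyc_tensor scC lC rC scX lX ractX"
abbreviation Y where "Y \<equiv> bal_tensor scB \<xi> \<zeta> \<Delta> scC act scX lactB"
abbreviation \<pi> where "\<pi> \<equiv> canonical_map scB \<xi> \<zeta> \<Delta> scC act scX lactB"
abbreviation dZ where "dZ \<equiv> cyc_face scC lC rC scX lX ractX \<epsilon>C"
abbreviation sZ where "sZ \<equiv> cyc_degen scC lC rC scX lX ractX \<Delta>C"
abbreviation wZ where "wZ \<equiv> cyc_w scC lC rC scX lX ractX act \<rho>"

lemma Z_eq: "Z n = quot_mod (gens n) (fspan (cyc_rels n))"
  unfolding cyc_tensor_def cyc_null_eq gens_def ..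

lemma Y_eq: "Y n = quot_mod (gens n) (fspan (bal_rels n))"
  unfolding bal_tensor_def bal_null_eq gens_def ..

lemma cyc_face_coset:
  assumes k: "k \<le> Suc n" and v: "supp v \<subseteq> gens (Suc n)"
  shows "dZ (Suc n) k (v +o fspan (cyc_rels (Suc n))) = flin (\<lambda>s. gen (face (Suc n) k s)) v +o fspan (cyc_rels n)"
proof -
  have eq: "(\<lambda>(cs, x). {gen (if k < Suc n
        then (take k cs @ lC (\<epsilon>C (cs ! k)) (cs ! (k + 1)) # drop (k + 2) cs, x)
        else (take (Suc n) cs, lX (\<epsilon>C (cs ! Suc n)) x)) :: _ \<Rightarrow>\<^sub>0 'k}) = (\<lambda>s. {gen (face (Suc n) k s)})"
    by (auto simp: face.simps C.absorb_def)
  have "induced (fspan (cyc_rels n)) (\<lambda>s. {gen (face (Suc n) k s)}) (v +o fspan (cyc_rels (Suc n)))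
      = flin (\<lambda>s. gen (face (Suc n) k s)) v +o fspan (cyc_rels n)"
    using v by (intro induced_single[OF keys_cyc_rels] cycmap_kills[OF cycmap_face[OF cycmap_gen k]])
  then show ?thesis
    unfolding cyc_face_def eq cyc_null_eq by simp
qed

lemma cyc_degen_coset:
  assumes k: "k \<le> n" and v: "supp v \<subseteq> gens n"
  shows "sZ n k (v +o fspan (cyc_rels n)) = flin (degen k gen) v +o fspan (cyc_rels (Suc n))"
  unfolding cyc_degen_def cyc_null_eq Suc_eq_plus1[symmetric]
proof (rule induced_coset[OF v keys_cyc_rels])
  fix s :: "'c list \<times> 'x" assume "s \<in> gens n"
  then obtain cs x where s: "s = (cs, x)" and len: "length cs = Suc n"
    by (auto simp: gens_def)
  have "degen k gen s = flin (\<lambda>cs'. gen (cs', x)) (flin (\<lambda>ds. gen (take k cs @ ds @ drop (Suc k) cs)) (C.coprod_rep (cs ! k)))"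
    unfolding s degen_def prod.case C.split_fun_def C.sweedler_def fs.lext_flin
    by (subst (2) C.flin_list2[OF C.keys_coprod_rep]) simp
  then show "degen k gen s \<in> (case s of (cs, x) \<Rightarrow> flin (\<lambda>cs'. gen (cs', x)) ` split_at \<Delta>C k cs)"
    using C.split_at_memI by (simp add: s)
  show "y \<approx>[cyc_rels (Suc n)] degen k gen s"
    if y: "y \<in> (case s of (cs, x) \<Rightarrow> flin (\<lambda>cs'. gen (cs', x)) ` split_at \<Delta>C k cs)" for y
  proof -
    obtain z where "z \<in> split_at \<Delta>C k cs" "y = flin (\<lambda>cs'. gen (cs', x)) z"
      using y by (auto simp: s)
    then show ?thesis
      using C.split_at_eqmod[OF len k cycmapD(1)[OF cycmap_gen]] by (simp add: s degen_def)
  qed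
next
  show "flin (degen k gen) r \<approx>[cyc_rels (Suc n)] 0" if "r \<in> cyc_rels n" for r
    using that by (rule cycmap_kills[OF cycmap_degen[OF cycmap_gen k]])
qed

lemma cyc_w_coset:
  assumes v: "supp v \<subseteq> gens n"
  shows "wZ n (v +o fspan (cyc_rels n)) = flin (rot n gen) v +o fspan (cyc_rels n)"
  unfolding cyc_w_def cyc_null_eq
proof (rule induced_coset[OF v keys_cyc_rels])
  fix s :: "'c list \<times> 'x" assume "s \<in> gens n"
  then obtain cs x where s: "s = (cs, x)" and len: "length cs = Suc n"
    by (auto simp: gens_def)
  let ?F = "\<lambda>s. case s of (cs, x) \<Rightarrow> flin (\<lambda>(x0, bs). gen (act (cs ! n) (hd bs) # take n cs, x0)) ` \<rho> x"
  show "rot n gen s \<in> ?F s"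
    by (simp add: s rot_def coact_def coact_rep_in)
  show "y \<approx>[cyc_rels n] rot n gen s" if y: "y \<in> ?F s" for y
  proof -
    obtain p where "p \<in> \<rho> x" "y = flin (\<lambda>(x0, bs). gen (act (cs ! n) (hd bs) # take n cs, x0)) p"
      using y by (auto simp: s)
    then show ?thesis
      using coact_eqI[OF cobil_rot[OF cycmap_gen, of "take n cs" n "cs ! n"]] len by (simp add: s rot_def)
  qed
next
  show "flin (rot n gen) r \<approx>[cyc_rels n] 0" if "r \<in> cyc_rels n" for r
    using that by (rule cycmap_kills[OF cycmap_rot[OF cycmap_gen]])
qed

text \<open>Both modules are quotients of one free module, so the canonical map keeps the
  representative and only enlarges the submodule.\<close>

lemma canonical_map_coset:
  assumes v: "supp v \<subseteq> gens n"
  shows "\<pi> n (v +o fspan (cyc_rels n)) = v +o fspan (bal_rels n)"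
proof -
  have eq: "(\<lambda>(cs, x). {gen (cs, x)}) = (\<lambda>s. {gen s})"
    by auto
  have "induced (fspan (bal_rels n)) (\<lambda>s. {gen s}) (v +o fspan (cyc_rels n)) = flin gen v +o fspan (bal_rels n)"
    using v by (intro induced_single[OF keys_cyc_rels] cycmap_kills[OF balmap_cycmap[OF balmap_gen]])
  then show ?thesis
    unfolding canonical_map_def eq bal_null_eq by (simp add: flin_gen_id)
qed

theorem para_cyclic_Z: "para_cyclic_module Z dZ sZ wZ"
  unfolding Z_eq[abs_def]
  by (rule para_cyclic_module_gens[where R = cyc_rels])
    (rule cycmap_gen cyc_face_coset cyc_degen_coset cyc_w_coset; assumption)+

lemma canonical_map_hom: "\<pi> n \<in> module_maps (Z n) (Y n)"
  unfolding Z_eq Y_eq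
  by (rule module_maps_quot_mod[where f = gen]) (simp_all add: canonical_map_coset flin_gen_id)

lemma canonical_map_onto: "\<pi> n ` carrier (Z n) = carrier (Y n)"
proof (intro equalityI subsetI)
  fix y assume "y \<in> \<pi> n ` carrier (Z n)"
  then show "y \<in> carrier (Y n)"
    using canonical_map_hom[of n] by (auto simp: module_maps_def)
next
  fix y assume "y \<in> carrier (Y n)"
  then obtain v where v: "y = v +o fspan (bal_rels n)" "supp v \<subseteq> gens n"
    unfolding Y_eq by (rule carrier_quot_modE)
  then have "y = \<pi> n (v +o fspan (cyc_rels n))"
    by (simp add: canonical_map_coset)
  then show "y \<in> \<pi> n ` carrier (Z n)"
    unfolding Z_eq using coset_in_carrier[OF v(2)] by (rule image_eqI)
qed

text \<open>The same formulas on generators as for the cyclic tensor product, with the chosen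
  representatives built into \<open>degen\<close> and \<open>rot\<close>; commuting with the
  projection is then immediate.\<close>

definition dY where "dY n k = induced (fspan (bal_rels (n - 1))) (\<lambda>s. {gen (face n k s)})"
definition sY where "sY n k = induced (fspan (bal_rels (Suc n))) (\<lambda>s. {degen k gen s})"
definition wY where "wY n = induced (fspan (bal_rels n)) (\<lambda>s. {rot n gen s})"

lemma dY_coset: "k \<le> Suc n \<Longrightarrow> supp v \<subseteq> gens (Suc n) \<Longrightarrow>
    dY (Suc n) k (v +o fspan (bal_rels (Suc n))) = flin (\<lambda>s. gen (face (Suc n) k s)) v +o fspan (bal_rels n)"
  unfolding dY_def diff_Suc_1
  by (intro induced_single[OF keys_bal_rels] balmap_kills[OF balmap_face[OF balmap_gen]])

lemma sY_coset: "k \<le> n \<Longrightarrow> supp v \<subseteq> gens n \<Longrightarrow>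
    sY n k (v +o fspan (bal_rels n)) = flin (degen k gen) v +o fspan (bal_rels (Suc n))"
  unfolding sY_def by (intro induced_single[OF keys_bal_rels] balmap_kills[OF balmap_degen[OF balmap_gen]])

lemma wY_coset: "supp v \<subseteq> gens n \<Longrightarrow>
    wY n (v +o fspan (bal_rels n)) = flin (rot n gen) v +o fspan (bal_rels n)"
  unfolding wY_def by (intro induced_single[OF keys_bal_rels] balmap_kills[OF balmap_rot[OF balmap_gen]])

theorem para_cyclic_Y: "para_cyclic_module Y dY sY wY"
  unfolding Y_eq[abs_def]
  by (rule para_cyclic_module_gens[where R = bal_rels])
    (rule balmap_cycmap[OF balmap_gen] dY_coset sY_coset wY_coset; assumption)+

lemma keys_flin_gens:
  assumes "supp v \<subseteq> gens m" "\<And>s. s \<in> gens m \<Longrightarrow> supp (f s) \<subseteq> gens n"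
  shows "supp (flin f v) \<subseteq> gens n"
  using assms by (intro keys_flin_subset) auto

theorem projects: "projects_to Z dZ sZ wZ \<pi> dY sY wY"
  unfolding projects_to_def
proof (intro conjI allI impI ballI)
  fix n k z assume k: "k \<le> Suc n" and "z \<in> carrier (Z (Suc n))"
  then obtain v where z: "z = v +o fspan (cyc_rels (Suc n))" and v: "supp v \<subseteq> gens (Suc n)"
    unfolding Z_eq by (elim carrier_quot_modE)
  have "supp (flin (\<lambda>s. gen (face (Suc n) k s)) v) \<subseteq> gens n"
    using v keys_face[OF k] by (intro keys_flin_gens[OF v]) simp
  then show "dY (Suc n) k (\<pi> (Suc n) z) = \<pi> n (dZ (Suc n) k z)"
    using k v by (simp add: z canonical_map_coset cyc_face_coset dY_coset)
next
  fix n k z assume k: "k \<le> n" and "z \<in> carrier (Z n)"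
  then obtain v where z: "z = v +o fspan (cyc_rels n)" and v: "supp v \<subseteq> gens n"
    unfolding Z_eq by (elim carrier_quot_modE)
  have "supp (flin (degen k gen) v) \<subseteq> gens (Suc n)"
    by (rule keys_flin_gens[OF v keys_degen[OF k]])
  then show "sY n k (\<pi> n z) = \<pi> (Suc n) (sZ n k z)"
    using k v by (simp add: z canonical_map_coset cyc_degen_coset sY_coset)
next
  fix n z assume "z \<in> carrier (Z n)"
  then obtain v where z: "z = v +o fspan (cyc_rels n)" and v: "supp v \<subseteq> gens n"
    unfolding Z_eq by (elim carrier_quot_modE)
  have "supp (flin (rot n gen) v) \<subseteq> gens n"
    by (rule keys_flin_gens[OF v keys_rot])
  then show "wY n (\<pi> n z) = \<pi> n (wZ n z)"
    using v by (simp add: z canonical_map_coset cyc_w_coset wY_coset)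
qed


section \<open>Cyclicity in the stable case\<close>

text \<open>Each rotation contributes one coaction factor, and coassociativity gathers them into the
  iterated coproduct of a single one. The block \<open>vs\<close>, acted on diagonally, thereby
  moves in front of \<open>us\<close>.\<close>

lemma rot_iterate:
  assumes F: "cycmap N n F" and "length vs = Suc j" "length us + Suc j = Suc n"
  shows "(rot n ^^ Suc j) F (us @ vs, x) \<approx>[N] coact x (\<lambda>y e. flin (\<lambda>l. F (map2 act vs l @ us, y)) (coprods j e))"
  using assms
proof (induction j arbitrary: F us vs x)
  case 0
  then obtain c where "vs = [c]" by (auto simp: length_Suc_conv)
  then show ?case using 0 by (simp add: rot_app)
next
  case (Suc j)
  then obtain c ds where vs: "vs = c # ds" and len: "length ds = Suc j"
    by (auto simp: length_Suc_conv)
  let ?f = "\<lambda>y s t. flin (\<lambda>l. F (act c s # map2 act ds l @ us, y)) (coprods j t)"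
  have tens: "C.tensor N (Suc (Suc j)) (\<lambda>cs. F (cs @ us, y))" for y
    unfolding tens_iff
  proof (intro conjI allI impI)
    fix as bs :: "'c list" assume l: "length as + length bs + 1 = Suc (Suc j)"
    show "linmod N scC (\<lambda>m. F ((as @ m # bs) @ us, y))"
      using cycmap_slot(1)[OF Suc.prems(1), of as "bs @ us" y] l Suc.prems(3) by simp
  next
    fix as bs :: "'c list" and a b r assume l: "length as + length bs + 2 = Suc (Suc j)"
    show "F ((as @ act a (\<xi> r) # b # bs) @ us, y) \<approx>[N] F ((as @ a # act b (\<zeta> r) # bs) @ us, y)"
      using cycmap_slot(2)[OF Suc.prems(1), of as "bs @ us" a r b y] l Suc.prems(3) by simp
  qed
  have bil: "bil N (?f y)" for y
    using bil_coprods[OF tensor_map2[OF tens, of "c # ds"]] len by simp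
  have tril: "cotril N ?f"
    unfolding cotril_def
  proof (intro conjI allI bil)
    show "linmod N scX (\<lambda>y. ?f y s t)" for s t
      using len Suc.prems(3) by (intro linmod_flin_coprods cycmapD(2)[OF Suc.prems(1)]) simp
    show "?f (ractX y r) s t \<approx>[N] ?f y (s * \<zeta> r) t" for y r s t
    proof (rule eqmod_flin_coprods)
      show "F (act c s # map2 act ds l @ us, ractX y r) \<approx>[N] F (act c (s * \<zeta> r) # map2 act ds l @ us, y)"
        if "length l = Suc j" for l
        using cycmapD(4)[OF Suc.prems(1), of "map2 act ds l @ us" "act c s" r y] that len Suc.prems(3)
        by (simp add: C.ract_mult eqmod_sym)
    qed
  qed
  \<comment> \<open>Precomposition reverses the order, so the innermost \<open>rot n F\<close> is
    the rotation performed last. It moves \<open>c\<close>, after the entries \<open>ds\<close>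
    behind it have been moved.\<close>
  have "(rot n ^^ Suc (Suc j)) F (us @ vs, x) = (rot n ^^ Suc j) (rot n F) ((us @ [c]) @ ds, x)"
    by (simp only: funpow_Suc_right o_apply vs append.assoc append_Cons append_Nil)
  also have "\<dots> \<approx>[N] coact x (\<lambda>y e. flin (\<lambda>l. rot n F (map2 act ds l @ us @ [c], y)) (coprods j e))"
    using Suc.prems(3) len by (intro Suc.IH cycmap_rot[OF Suc.prems(1)]) simp_all
  also have "\<dots> \<approx>[N] coact x (\<lambda>y e. flin (\<lambda>l. coact y (\<lambda>z e'. F (act c e' # map2 act ds l @ us, z))) (coprods j e))"
  proof (intro coact_cong eqmod_flin_coprods eqmod_reflI)
    show "rot n F (map2 act ds l @ us @ [c], y) = coact y (\<lambda>z e'. F (act c e' # map2 act ds l @ us, z))"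
      if "length l = Suc j" for l y
      using rot_app[of "map2 act ds l @ us" n F c y] that len Suc.prems(3) by simp
  qed
  also have "\<dots> = coact x (\<lambda>y e. coact y (\<lambda>z e'. ?f z e' e))"
    by (simp only: flin_coact_commute)
  also have "\<dots> \<approx>[N] coact x (\<lambda>y e. sweedler e (?f y))"
    by (rule coact_coassociative[OF tril])
  also have "\<dots> = coact x (\<lambda>y e. flin (\<lambda>l. F (map2 act vs l @ us, y)) (coprods (Suc j) e))"
    by (simp add: flin_coprods_Suc vs del: coprods.simps)
  finally show ?case .
qed

lemma rot_power_stable:
  assumes F: "balmap N n F" and len: "length cs = Suc n"
    and stable: "\<And>p x. p \<in> \<rho> x \<Longrightarrow> lext scX (\<lambda>(x0, bs). lactB (hd bs) x0) p = x"
  shows "(rot n ^^ Suc n) F (cs, x) \<approx>[N] F (cs, x)"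
proof -
  have "(rot n ^^ Suc n) F (cs, x) \<approx>[N] coact x (\<lambda>y e. flin (\<lambda>l. F (map2 act cs l, y)) (coprods n e))"
    using rot_iterate[OF balmap_cycmap[OF F] len, of "[]" x] by simp
  also have "\<dots> \<approx>[N] coact x (\<lambda>y e. F (cs, lactB e y))"
    by (intro coact_cong balmapD[OF F len])
  also have "\<dots> \<approx>[N] F (cs, x)"
  proof -
    have "F (cs, lext scX (\<lambda>(x0, bs). lactB (hd bs) x0) (coact_rep x))
        \<approx>[N] flin (\<lambda>s. F (cs, (\<lambda>(x0, bs). lactB (hd bs) x0) s)) (coact_rep x)"
      by (rule linmod_lext[OF cycmapD(2)[OF balmap_cycmap[OF F] len]])
    moreover have "flin (\<lambda>s. F (cs, (\<lambda>(x0, bs). lactB (hd bs) x0) s)) (coact_rep x) = coact x (\<lambda>y e. F (cs, lactB e y))"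
      unfolding coact_def by (rule lext_cong) auto
    ultimately show ?thesis
      using stable[OF coact_rep_in] eqmod_sym by simp
  qed
  finally show ?thesis .
qed

lemma flin_rot_power:
  "flin F ((flin (rot n gen) ^^ j) v) = flin ((rot n ^^ j) F) v"
proof (induction j arbitrary: v)
  case (Suc j)
  have "flin F ((flin (rot n gen) ^^ Suc j) v) = flin ((rot n ^^ j) F) (flin (rot n gen) v)"
    unfolding funpow_Suc_right o_apply by (rule Suc)
  then show ?case
    by (simp add: fs.lext_flin flin_rot)
qed simp

text \<open>Cosets are images under the projection, so any factorization \<open>w'\<close> is forced
  to be given by \<open>rot\<close> on generators; the claim then holds for every projected
  structure.\<close>

theorem cyclic_Y:
  assumes proj: "projects_to Z dZ sZ wZ \<pi> d' s' w'" and para: "para_cyclic_module Y d' s' w'"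
    and stable: "\<And>p x. p \<in> \<rho> x \<Longrightarrow> lext scX (\<lambda>(x0, bs). lactB (hd bs) x0) p = x"
  shows "cyclic_module Y d' s' w'"
proof (intro cyclic_module.intro cyclic_module_axioms.intro para)
  fix z n assume "z \<in> carrier (Y n)"
  then obtain v where z: "z = v +o fspan (bal_rels n)" and v: "supp v \<subseteq> gens n"
    unfolding Y_eq by (elim carrier_quot_modE)
  let ?T = "flin (rot n gen)"
  have T: "supp (?T u) \<subseteq> gens n" if "supp u \<subseteq> gens n" for u
    by (rule keys_flin_gens[OF that keys_rot])
  have w: "w' n (u +o fspan (bal_rels n)) = ?T u +o fspan (bal_rels n)" if u: "supp u \<subseteq> gens n" for u
  proof -
    have "u +o fspan (cyc_rels n) \<in> carrier (Z n)"
      unfolding Z_eq by (rule coset_in_carrier[OF u])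
    then have "w' n (\<pi> n (u +o fspan (cyc_rels n))) = \<pi> n (wZ n (u +o fspan (cyc_rels n)))"
      using proj by (simp add: projects_to_def)
    then show ?thesis
      by (simp add: canonical_map_coset cyc_w_coset u T)
  qed
  \<comment> \<open>The support is carried along in the induction, since \<open>w\<close> evaluates
    \<open>w'\<close> only on representatives supported on lists of the right length.\<close>
  have pow: "(w' n ^^ j) z = (?T ^^ j) v +o fspan (bal_rels n) \<and> supp ((?T ^^ j) v) \<subseteq> gens n" for j
    by (induction j) (simp_all add: z v w T)
  have "(?T ^^ Suc n) v = flin ((rot n ^^ Suc n) gen) v"
    using flin_rot_power[where F = gen and j = "Suc n"] by (simp only: flin_gen_id)
  also have "\<dots> \<approx>[bal_rels n] flin gen v"
  proof (rule eqmod_flin)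
    fix s assume "s \<in> supp v"
    then obtain cs x where "s = (cs, x)" "length cs = Suc n"
      using v by (auto simp: gens_def)
    then show "(rot n ^^ Suc n) gen s \<approx>[bal_rels n] gen s"
      using rot_power_stable[OF balmap_gen _ stable] by blast
  qed
  finally have "(?T ^^ Suc n) v \<approx>[bal_rels n] v"
    by (simp add: flin_gen_id)
  then show "(w' n ^^ (n + 1)) z = z"
    using pow[of "Suc n"] by (simp add: z coset_eq_iff del: funpow.simps)
qed

end

theorem proposition2p19:
  fixes scR :: "'k::comm_ring_1 \<Rightarrow> 'r::{ring,monoid_mult} \<Rightarrow> 'r"
    and scB :: "'k \<Rightarrow> 'b::{ring,monoid_mult} \<Rightarrow> 'b"
    and \<xi> \<zeta> :: "'r \<Rightarrow> 'b" and \<Delta> :: "'b \<Rightarrow> ('b list \<Rightarrow>\<^sub>0 'k) set" and \<epsilon> :: "'b \<Rightarrow> 'r"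
    and scC :: "'k \<Rightarrow> 'c::ab_group_add \<Rightarrow> 'c" and act :: "'c \<Rightarrow> 'b \<Rightarrow> 'c"
    and \<Delta>C :: "'c \<Rightarrow> ('c list \<Rightarrow>\<^sub>0 'k) set" and \<epsilon>C :: "'c \<Rightarrow> 'r"
    and scX :: "'k \<Rightarrow> 'x::ab_group_add \<Rightarrow> 'x" and ractX :: "'x \<Rightarrow> 'r \<Rightarrow> 'x"
    and \<rho> :: "'x \<Rightarrow> ('x \<times> 'b list \<Rightarrow>\<^sub>0 'k) set" and lactB :: "'b \<Rightarrow> 'x \<Rightarrow> 'x"
  assumes "right_times_R_hopf_algebra scR scB \<xi> \<zeta> \<Delta> \<epsilon>"
    and "module_coring scR scB \<xi> \<zeta> \<Delta> \<epsilon> scC act \<Delta>C \<epsilon>C"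
  shows
    "let lC = (\<lambda>r c. act c (\<zeta> r)); rC = (\<lambda>c r. act c (\<xi> r));
         lX = comod_lact \<xi> \<epsilon> scX ractX \<rho>;
         Z = cyc_tensor scC lC rC scX lX ractX;
         d = cyc_face scC lC rC scX lX ractX \<epsilon>C;
         s = cyc_degen scC lC rC scX lX ractX \<Delta>C;
         w = cyc_w scC lC rC scX lX ractX act \<rho>;
         Y = bal_tensor scB \<xi> \<zeta> \<Delta> scC act scX lactB;
         \<pi> = canonical_map scB \<xi> \<zeta> \<Delta> scC act scX lactB
     in (anti_yetter_drinfeld_module scR scB \<xi> \<zeta> \<Delta> \<epsilon> scX ractX \<rho> lactB \<longrightarrow>
           para_cyclic_module Z d s w
           \<and> (\<forall>n. \<pi> n \<in> module_maps (Z n) (Y n) \<and> \<pi> n ` carrier (Z n) = carrier (Y n))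
           \<and> (\<exists>d' s' w'. projects_to Z d s w \<pi> d' s' w' \<and> para_cyclic_module Y d' s' w'))
        \<and> (stable_anti_yetter_drinfeld_module scR scB \<xi> \<zeta> \<Delta> \<epsilon> scX ractX \<rho> lactB \<longrightarrow>
           (\<forall>d' s' w'. projects_to Z d s w \<pi> d' s' w' \<and> para_cyclic_module Y d' s' w' \<longrightarrow>
              cyclic_module Y d' s' w'))"
proof -
  have main: "module_coring_with_coefficients scR scB \<xi> \<zeta> \<Delta> \<epsilon> scC act \<Delta>C \<epsilon>C scX ractX \<rho> lactB"
    if "anti_yetter_drinfeld_module scR scB \<xi> \<zeta> \<Delta> \<epsilon> scX ractX \<rho> lactB"
    using assms(2) that by (simp add: module_coring_with_coefficients_def)
  show ?thesis
    unfolding Let_def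
  proof (intro conjI impI, goal_cases)
    case 1
    then interpret module_coring_with_coefficients scR scB \<xi> \<zeta> \<Delta> \<epsilon> scC act \<Delta>C \<epsilon>C scX ractX \<rho> lactB
      by (rule main)
    show ?case by (rule para_cyclic_Z)
  next
    case 2
    then interpret module_coring_with_coefficients scR scB \<xi> \<zeta> \<Delta> \<epsilon> scC act \<Delta>C \<epsilon>C scX ractX \<rho> lactB
      by (rule main)
    show ?case using canonical_map_hom canonical_map_onto by blast
  next
    case 3
    then interpret module_coring_with_coefficients scR scB \<xi> \<zeta> \<Delta> \<epsilon> scC act \<Delta>C \<epsilon>C scX ractX \<rho> lactB
      by (rule main)
    show ?case using projects para_cyclic_Y by blast
  next
    case 4
    then have "anti_yetter_drinfeld_module scR scB \<xi> \<zeta> \<Delta> \<epsilon> scX ractX \<rho> lactB"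
      by (simp add: stable_anti_yetter_drinfeld_module_def)
    then interpret module_coring_with_coefficients scR scB \<xi> \<zeta> \<Delta> \<epsilon> scC act \<Delta>C \<epsilon>C scX ractX \<rho> lactB
      by (rule main)
    show ?case
      using cyclic_Y stable_anti_yetter_drinfeld_module.stable[OF 4] by blast
  qed
qed

end
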